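(* Let $\ell$ be a prime number and $K$ a discrete valuation field of characteristic zero and residue characteristic $\ell$. Let $\mathfrak{m}$ be the maximal ideal of $\mathcal{O}_K$, $k=\mathcal{O}_K/\mathfrak{m}$, $e=e(K)$, and suppose $2e<\ell-1$. Let $V$ be a $K$-vector space of finite dimension $n$, let $f:V\times V\to K$ be a nondegenerate alternating (respectively, symmetric) $K$-bilinear form, let $G$ be a finite group, and let $\rho:G\hookrightarrow\mathrm{Aut}_K(V,f)$ be a faithful representation preserving $f$. Then there exist a nondegenerate alternating (respectively, symmetric) $k$-valued $k$-bilinear form $f_0$ on $k^n$ and a faithful representation $\bar\rho:G\hookrightarrow\mathrm{Aut}_k(k^n,f_0)$ such that for every $g\in G$ the characteristic polynomial of $\bar\rho(g)$ is the reduction modulo $\mathfrak{m}$ of the characteristic polynomial of $\rho(g)$.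
   Context: For a discrete valuation field $K$ of residue characteristic $\ell$ with valuation $v$ normalized by $v(K^\times)=\mathbf{Z}$, $\mathcal{O}_K$ is its valuation ring and $e(K)=v(\ell)$ is the absolute ramification index. *)

theory Defs
  imports "Jordan_Normal_Form.VS_Connect" "Jordan_Normal_Form.Char_Poly" "HOL-Algebra.Bij"
begin

section \<open>Discrete valuation fields and their residue fields\<close>

text \<open>
  The valuation is a type class parameter, so that the residue field below can be a type, formed
  literally as a quotient of the valuation ring. The axioms concern nonzero elements only: the
  integer \<open>val 0\<close> is unspecified and is never used. No completeness is assumed.
\<close>

class discrete_valuation_field = field +
  fixes val :: "'a \<Rightarrow> int"
  assumes val_mult: "x \<noteq> 0 \<Longrightarrow> y \<noteq> 0 \<Longrightarrow> val (x * y) = val x + val y"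
    and val_add: "x \<noteq> 0 \<Longrightarrow> y \<noteq> 0 \<Longrightarrow> x + y \<noteq> 0 \<Longrightarrow> min (val x) (val y) \<le> val (x + y)"
    and val_normalized: "val ` {x. x \<noteq> 0} = UNIV"

definition valuation_ring :: "'a::discrete_valuation_field set" where
  "valuation_ring = {x. x = 0 \<or> 0 \<le> val x}"

definition valuation_ideal :: "'a::discrete_valuation_field set" where
  "valuation_ideal = {x. x = 0 \<or> 0 < val x}"

lemma val_1 [simp]: "val (1::'a::discrete_valuation_field) = 0"
  using val_mult[of "1::'a" 1] by simp

lemma val_minus [simp]: "val (- x) = val (x::'a::discrete_valuation_field)"
proof (cases "x = 0")
  case False
  have "val (- 1 :: 'a) = 0"
    using val_mult[of "- 1 :: 'a" "- 1"] by simp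
  then show ?thesis
    using val_mult[of "- 1" x] False by simp
qed simp

lemma val_inverse: "x \<noteq> 0 \<Longrightarrow> val (inverse x) = - val (x::'a::discrete_valuation_field)"
  using val_mult[of x "inverse x"] by simp

lemma valuation_ring_0 [simp]: "0 \<in> valuation_ring"
  and valuation_ring_1 [simp]: "1 \<in> valuation_ring"
  and valuation_ring_uminus: "x \<in> valuation_ring \<Longrightarrow> - x \<in> valuation_ring"
  and valuation_ideal_0 [simp]: "0 \<in> valuation_ideal"
  and one_notin_valuation_ideal [simp]: "1 \<notin> valuation_ideal"
  and valuation_ideal_uminus: "x \<in> valuation_ideal \<Longrightarrow> - x \<in> valuation_ideal"
  by (auto simp: valuation_ring_def valuation_ideal_def)

lemma valuation_ring_add:
  "x \<in> valuation_ring \<Longrightarrow> y \<in> valuation_ring \<Longrightarrow> x + y \<in> valuation_ring"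
  using val_add[of x y] by (cases "x = 0 \<or> y = 0 \<or> x + y = 0") (auto simp: valuation_ring_def)

lemma valuation_ideal_add:
  "x \<in> valuation_ideal \<Longrightarrow> y \<in> valuation_ideal \<Longrightarrow> x + y \<in> valuation_ideal"
  using val_add[of x y] by (cases "x = 0 \<or> y = 0 \<or> x + y = 0") (auto simp: valuation_ideal_def)

lemma valuation_ring_mult:
  "x \<in> valuation_ring \<Longrightarrow> y \<in> valuation_ring \<Longrightarrow> x * y \<in> valuation_ring"
  using val_mult[of x y] by (cases "x = 0 \<or> y = 0") (auto simp: valuation_ring_def)

lemma valuation_ideal_mult:
  "x \<in> valuation_ideal \<Longrightarrow> y \<in> valuation_ring \<Longrightarrow> x * y \<in> valuation_ideal"
  using val_mult[of x y] by (cases "x = 0 \<or> y = 0") (auto simp: valuation_ideal_def valuation_ring_def)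

lemma valuation_ideal_diff:
  "x \<in> valuation_ideal \<Longrightarrow> y \<in> valuation_ideal \<Longrightarrow> x - y \<in> valuation_ideal"
  using valuation_ideal_add[of x "- y"] valuation_ideal_uminus[of y] by simp

lemma valuation_ideal_diff_commute: "x - y \<in> valuation_ideal \<longleftrightarrow> y - x \<in> valuation_ideal"
  using valuation_ideal_uminus[of "x - y"] valuation_ideal_uminus[of "y - x"] by auto

lemma inverse_in_valuation_ring:
  "x \<in> valuation_ring \<Longrightarrow> x \<notin> valuation_ideal \<Longrightarrow> inverse x \<in> valuation_ring"
  using val_inverse[of x] by (auto simp: valuation_ring_def valuation_ideal_def)

definition residue_rel :: "'a::discrete_valuation_field \<Rightarrow> 'a \<Rightarrow> bool" where
  "residue_rel x y \<longleftrightarrow> x \<in> valuation_ring \<and> y \<in> valuation_ring \<and> x - y \<in> valuation_ideal"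

quotient_type (overloaded) 'a residue_field =
  "'a::discrete_valuation_field" / partial: residue_rel
proof (rule part_equivpI)
  show "\<exists>x::'a. residue_rel x x"
    by (rule exI[of _ 0]) (simp add: residue_rel_def)
  show "symp (residue_rel :: 'a \<Rightarrow> 'a \<Rightarrow> bool)"
    by (rule sympI) (use valuation_ideal_diff_commute in \<open>auto simp: residue_rel_def\<close>)
  show "transp (residue_rel :: 'a \<Rightarrow> 'a \<Rightarrow> bool)"
    by (rule transpI) (use valuation_ideal_add in \<open>fastforce simp: residue_rel_def\<close>)
qed

instantiation residue_field :: (discrete_valuation_field) field
begin

lift_definition zero_residue_field :: "'a residue_field" is 0
  by (simp add: residue_rel_def)

lift_definition one_residue_field :: "'a residue_field" is 1
  by (simp add: residue_rel_def)

lift_definition plus_residue_field :: "'a residue_field \<Rightarrow> 'a residue_field \<Rightarrow> 'a residue_field"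
  is "(+)"
  using valuation_ideal_add
  by (fastforce simp: residue_rel_def add_diff_add intro: valuation_ring_add)

lift_definition uminus_residue_field :: "'a residue_field \<Rightarrow> 'a residue_field" is uminus
  using valuation_ideal_uminus
  by (fastforce simp: residue_rel_def intro: valuation_ring_uminus)

lift_definition minus_residue_field :: "'a residue_field \<Rightarrow> 'a residue_field \<Rightarrow> 'a residue_field"
  is "\<lambda>x y. x + - y"
proof -
  fix x x' y y' :: 'a
  assume *: "residue_rel x x'" "residue_rel y y'"
  have "(x + - y) - (x' + - y') = (x - x') - (y - y')" by simp
  with * valuation_ideal_diff show "residue_rel (x + - y) (x' + - y')"
    by (metis residue_rel_def valuation_ring_add valuation_ring_uminus)
qed

lift_definition times_residue_field :: "'a residue_field \<Rightarrow> 'a residue_field \<Rightarrow> 'a residue_field"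
  is "(*)"
proof -
  fix x x' y y' :: 'a
  assume *: "residue_rel x x'" "residue_rel y y'"
  have "x * y - x' * y' = (x - x') * y + (y - y') * x'" by (simp add: algebra_simps)
  with * show "residue_rel (x * y) (x' * y')"
    by (auto simp: residue_rel_def intro!: valuation_ring_mult valuation_ideal_add valuation_ideal_mult)
qed

lift_definition inverse_residue_field :: "'a residue_field \<Rightarrow> 'a residue_field"
  is "\<lambda>x. if x \<in> valuation_ideal then 0 else inverse x"
proof -
  fix x y :: 'a
  assume *: "residue_rel x y"
  have iff: "x \<in> valuation_ideal \<longleftrightarrow> y \<in> valuation_ideal"
    using * valuation_ideal_add[of "x - y" y] valuation_ideal_diff[of x "x - y"]
    by (auto simp: residue_rel_def)
  show "residue_rel (if x \<in> valuation_ideal then 0 else inverse x)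
      (if y \<in> valuation_ideal then 0 else inverse y)"
  proof (cases "x \<in> valuation_ideal")
    case False
    then have nz: "x \<noteq> 0" "y \<noteq> 0" using iff by auto
    have "inverse x - inverse y = (y - x) * (inverse x * inverse y)"
      using nz by (simp add: field_simps)
    moreover have "inverse x \<in> valuation_ring" "inverse y \<in> valuation_ring"
      using * False iff by (auto simp: residue_rel_def intro: inverse_in_valuation_ring)
    moreover have "y - x \<in> valuation_ideal"
      using * valuation_ideal_diff_commute by (auto simp: residue_rel_def)
    ultimately show ?thesis
      using False iff by (auto simp: residue_rel_def intro!: valuation_ideal_mult valuation_ring_mult)
  qed (use iff in \<open>simp add: residue_rel_def\<close>)
qed

definition divide_residue_field :: "'a residue_field \<Rightarrow> 'a residue_field \<Rightarrow> 'a residue_field" where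
  "divide_residue_field x y = x * inverse y"

instance
proof
  fix a b c :: "'a residue_field"
  show "a * b * c = a * (b * c)"
    by transfer (simp add: residue_rel_def mult.assoc valuation_ring_mult)
  show "a * b = b * a"
    by transfer (simp add: residue_rel_def mult.commute valuation_ring_mult)
  show "1 * a = a"
    by transfer simp
  show "a + b + c = a + (b + c)"
    by transfer (simp add: residue_rel_def add.assoc valuation_ring_add)
  show "a + b = b + a"
    by transfer (simp add: residue_rel_def add.commute valuation_ring_add)
  show "0 + a = a"
    by transfer simp
  show "- a + a = 0"
    by transfer (simp add: residue_rel_def)
  show "a - b = a + - b"
    by transfer (use valuation_ring_add valuation_ring_uminus in \<open>fastforce simp: residue_rel_def\<close>)
  show "(a + b) * c = a * c + b * c"
    by transfer (simp add: residue_rel_def distrib_right valuation_ring_add valuation_ring_mult)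
  show "(0::'a residue_field) \<noteq> 1"
    by transfer (use valuation_ideal_uminus[of "- 1 :: 'a"] in \<open>auto simp: residue_rel_def\<close>)
  show "a \<noteq> 0 \<Longrightarrow> inverse a * a = 1"
  proof transfer
    fix a :: 'a
    assume "residue_rel a a" "\<not> residue_rel a 0"
    then have "a \<in> valuation_ring" "a \<notin> valuation_ideal" "a \<noteq> 0"
      by (auto simp: residue_rel_def)
    then show "residue_rel ((if a \<in> valuation_ideal then 0 else inverse a) * a) 1"
      by (simp add: residue_rel_def)
  qed
  show "a div b = a * inverse b"
    by (simp add: divide_residue_field_def)
  show "inverse (0::'a residue_field) = 0"
    by transfer (simp add: residue_rel_def)
qed

end

text \<open>The value \<open>0\<close> outside the valuation ring is junk.\<close>

definition reduction :: "'a::discrete_valuation_field \<Rightarrow> 'a residue_field" where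
  "reduction x = (if x \<in> valuation_ring then abs_residue_field x else 0)"

definition ramification_index :: "'a::discrete_valuation_field itself \<Rightarrow> int" where
  "ramification_index _ = val (of_nat CHAR('a residue_field) :: 'a)"

lemma reduction_eq_0_iff: "x \<in> valuation_ring \<Longrightarrow> reduction x = 0 \<longleftrightarrow> x \<in> valuation_ideal"
  using Quotient3_rel[OF Quotient3_residue_field, of x 0]
  by (auto simp: reduction_def zero_residue_field_def residue_rel_def)

lemma reduction_add:
  "x \<in> valuation_ring \<Longrightarrow> y \<in> valuation_ring \<Longrightarrow> reduction (x + y) = reduction x + reduction y"
  by (simp add: reduction_def valuation_ring_add plus_residue_field.abs_eq residue_rel_def)

lemma reduction_mult:
  "x \<in> valuation_ring \<Longrightarrow> y \<in> valuation_ring \<Longrightarrow> reduction (x * y) = reduction x * reduction y"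
  by (simp add: reduction_def valuation_ring_mult times_residue_field.abs_eq residue_rel_def)

lemma reduction_1: "reduction 1 = 1"
  by (simp add: reduction_def one_residue_field_def)

lemma reduction_surj: "reduction ` valuation_ring = UNIV"
proof -
  have "\<exists>x\<in>valuation_ring. reduction x = a" for a :: "'a residue_field"
    using Quotient3_abs_rep[OF Quotient3_residue_field, of a]
      Quotient3_rep_reflp[OF Quotient3_residue_field, of a]
    by (auto simp: residue_rel_def reduction_def intro!: bexI[of _ "rep_residue_field a"])
  then show ?thesis by (metis UNIV_eq_I imageI)
qed

section \<open>Bilinear forms, isometry groups, characteristic polynomials\<close>

definition bilinear_form :: "('a::field, 'v, 'm) module_scheme \<Rightarrow> ('v \<Rightarrow> 'v \<Rightarrow> 'a) \<Rightarrow> bool" where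
  "bilinear_form V f \<longleftrightarrow>
    (\<forall>x\<in>carrier V. \<forall>y\<in>carrier V. \<forall>z\<in>carrier V.
      f (x \<oplus>\<^bsub>V\<^esub> y) z = f x z + f y z \<and> f z (x \<oplus>\<^bsub>V\<^esub> y) = f z x + f z y) \<and>
    (\<forall>c. \<forall>x\<in>carrier V. \<forall>y\<in>carrier V.
      f (c \<odot>\<^bsub>V\<^esub> x) y = c * f x y \<and> f x (c \<odot>\<^bsub>V\<^esub> y) = c * f x y)"

definition nondegenerate :: "('a::field, 'v, 'm) module_scheme \<Rightarrow> ('v \<Rightarrow> 'v \<Rightarrow> 'a) \<Rightarrow> bool" where
  "nondegenerate V f \<longleftrightarrow>
    (\<forall>x\<in>carrier V. (\<forall>y\<in>carrier V. f x y = 0) \<longrightarrow> x = \<zero>\<^bsub>V\<^esub>) \<and>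
    (\<forall>y\<in>carrier V. (\<forall>x\<in>carrier V. f x y = 0) \<longrightarrow> y = \<zero>\<^bsub>V\<^esub>)"

definition alternating :: "('a::field, 'v, 'm) module_scheme \<Rightarrow> ('v \<Rightarrow> 'v \<Rightarrow> 'a) \<Rightarrow> bool" where
  "alternating V f \<longleftrightarrow> (\<forall>x\<in>carrier V. f x x = 0)"

definition symmetric :: "('a::field, 'v, 'm) module_scheme \<Rightarrow> ('v \<Rightarrow> 'v \<Rightarrow> 'a) \<Rightarrow> bool" where
  "symmetric V f \<longleftrightarrow> (\<forall>x\<in>carrier V. \<forall>y\<in>carrier V. f x y = f y x)"

text \<open>
  The group of linear automorphisms of \<open>V\<close> preserving \<open>f\<close>, as a subgroup of the group of
  bijections of the carrier. Its elements are extensional functions on the carrier, so that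
  injectivity of a representation is not spoiled by values outside the carrier.
\<close>

definition isometry_group ::
  "('a::field, 'v, 'm) module_scheme \<Rightarrow> ('v \<Rightarrow> 'v \<Rightarrow> 'a) \<Rightarrow> ('v \<Rightarrow> 'v) monoid" where
  "isometry_group V f = (BijGroup (carrier V))
    \<lparr>carrier := {\<phi> \<in> Bij (carrier V).
       \<phi> \<in> LinearCombinations.module_hom class_ring V V \<and>
       (\<forall>x\<in>carrier V. \<forall>y\<in>carrier V. f (\<phi> x) (\<phi> y) = f x y)}\<rparr>"

definition represents ::
  "('a::field, 'v, 'm) module_scheme \<Rightarrow> 'v list \<Rightarrow> ('v \<Rightarrow> 'v) \<Rightarrow> 'a mat \<Rightarrow> bool" where
  "represents V bs \<phi> A \<longleftrightarrow>
    distinct bs \<and> vectorspace.basis class_ring V (set bs) \<and>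
    A \<in> carrier_mat (length bs) (length bs) \<and>
    (\<forall>j<length bs. \<phi> (bs ! j) = (\<Oplus>\<^bsub>V\<^esub>i\<in>{..<length bs}. A $$ (i, j) \<odot>\<^bsub>V\<^esub> bs ! i))"

text \<open>
  The characteristic polynomial \<open>det (X - \<phi>)\<close> of an endomorphism of a finite-dimensional space,
  computed from the matrix of \<open>\<phi>\<close> in any ordered basis. The description is definite by
  \<open>represents_char_poly_unique\<close> below.
\<close>

definition endo_char_poly ::
  "('a::field, 'v, 'm) module_scheme \<Rightarrow> ('v \<Rightarrow> 'v) \<Rightarrow> 'a poly" where
  "endo_char_poly V \<phi> = (THE p. \<exists>bs A. represents V bs \<phi> A \<and> p = char_poly A)"

lemma represents_char_poly_unique:
  assumes V: "vectorspace class_ring V"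
    and \<phi>: "\<phi> \<in> LinearCombinations.module_hom class_ring V V"
    and A: "represents V bs \<phi> A" and B: "represents V cs \<phi> B"
  shows "char_poly A = char_poly B"
proof -
  interpret vectorspace class_ring V by (rule V)
  define S where "S bs c = (\<Oplus>\<^bsub>V\<^esub>i\<in>{..<length bs}. c i \<odot>\<^bsub>V\<^esub> bs ! i)"
    for bs and c :: "nat \<Rightarrow> 'a"
  define bas where "bas bs \<longleftrightarrow> distinct bs \<and> basis (set bs)" for bs
  have bas: "bas bs" "bas cs"
    using A B by (auto simp: bas_def represents_def)
  have car: "set bs \<subseteq> carrier V" if "bas bs" for bs
    using that by (auto simp: bas_def basis_def)
  have cnth: "bs ! i \<in> carrier V" if "bas bs" "i < length bs" for bs i
    using car that by force
  have sm: "c \<odot>\<^bsub>V\<^esub> x \<in> carrier V" if "x \<in> carrier V" for c x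
    using smult_closed[of c x] that by simp
  have S_closed: "S bs c \<in> carrier V" if "bas bs" for bs c
    unfolding S_def using cnth[OF that] sm by (intro M.finsum_closed) auto
  have lincomb_S: "lincomb a (set bs) = S bs (\<lambda>i. a (bs ! i))" if "bas bs" for bs a
  proof -
    have "inj_on ((!) bs) {..<length bs}"
      using that by (auto simp: bas_def inj_on_nth)
    then have "(\<Oplus>\<^bsub>V\<^esub>v\<in>(!) bs ` {..<length bs}. a v \<odot>\<^bsub>V\<^esub> v) = S bs (\<lambda>i. a (bs ! i))"
      unfolding S_def using cnth[OF that] sm by (intro M.finsum_reindex) auto
    moreover have "(!) bs ` {..<length bs} = set bs" by (auto simp: set_conv_nth)
    ultimately show ?thesis unfolding lincomb_def by simp
  qed
  have ex: "\<exists>c. x = S bs c" if b: "bas bs" and "x \<in> carrier V" for bs x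
  proof -
    have "x \<in> span (set bs)" using that by (auto simp: bas_def basis_def)
    then obtain a where "x = lincomb a (set bs)"
      using finite_span[of "set bs"] car[OF b] by auto
    then show ?thesis using lincomb_S[OF that(1)] by auto
  qed
  have Scong: "S bs c = S bs d" if "bas bs" "\<And>i. i < length bs \<Longrightarrow> c i = d i" for bs c d
    unfolding S_def using that cnth[OF that(1)] sm by (intro M.finsum_cong') auto
  have Sadd: "S bs c \<oplus>\<^bsub>V\<^esub> S bs d = S bs (\<lambda>i. c i + d i)" if "bas bs" for bs c d
  proof -
    have "(c i + d i) \<odot>\<^bsub>V\<^esub> bs ! i = c i \<odot>\<^bsub>V\<^esub> bs ! i \<oplus>\<^bsub>V\<^esub> d i \<odot>\<^bsub>V\<^esub> bs ! i" if "i < length bs" for i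
      using smult_l_distr[of "c i" "d i" "bs ! i"] cnth[OF \<open>bas bs\<close> that] by simp
    then have "S bs (\<lambda>i. c i + d i) =
        (\<Oplus>\<^bsub>V\<^esub>i\<in>{..<length bs}. c i \<odot>\<^bsub>V\<^esub> bs ! i \<oplus>\<^bsub>V\<^esub> d i \<odot>\<^bsub>V\<^esub> bs ! i)"
      unfolding S_def using cnth[OF that] sm by (intro M.finsum_cong') auto
    also have "\<dots> = S bs c \<oplus>\<^bsub>V\<^esub> S bs d"
      unfolding S_def using cnth[OF that] sm by (intro M.finsum_addf) auto
    finally show ?thesis by simp
  qed
  have Ssmult: "a \<odot>\<^bsub>V\<^esub> S bs c = S bs (\<lambda>i. a * c i)" if "bas bs" for bs a c
  proof -
    have "(a * c i) \<odot>\<^bsub>V\<^esub> bs ! i = a \<odot>\<^bsub>V\<^esub> (c i \<odot>\<^bsub>V\<^esub> bs ! i)" if "i < length bs" for i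
      using smult_assoc1[of a "c i" "bs ! i"] cnth[OF \<open>bas bs\<close> that] by simp
    then have "S bs (\<lambda>i. a * c i) = (\<Oplus>\<^bsub>V\<^esub>i\<in>{..<length bs}. a \<odot>\<^bsub>V\<^esub> (c i \<odot>\<^bsub>V\<^esub> bs ! i))"
      unfolding S_def using cnth[OF that] sm by (intro M.finsum_cong') auto
    also have "\<dots> = a \<odot>\<^bsub>V\<^esub> S bs c"
      unfolding S_def using cnth[OF that] sm
      by (intro finsum_smult[symmetric]) auto
    finally show ?thesis by simp
  qed
  have uniq: "c i = d i" if "bas bs" "S bs c = S bs d" "i < length bs" for bs c d i
  proof -
    have inj: "inj_on ((!) bs) {..<length bs}"
      using that by (auto simp: bas_def inj_on_nth)
    have "S bs (\<lambda>i. c i + (- 1) * d i) = S bs d \<oplus>\<^bsub>V\<^esub> S bs (\<lambda>i. (- 1) * d i)"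
      using Sadd[OF that(1), of c "\<lambda>i. (- 1) * d i"] that(2) by simp
    also have "\<dots> = S bs (\<lambda>i. 0 * d i)"
      using Sadd[OF that(1), of d "\<lambda>i. (- 1) * d i"] by simp
    also have "\<dots> = \<zero>\<^bsub>V\<^esub>"
      using smult_l_null[OF S_closed[OF that(1)]] by (simp only: Ssmult[OF that(1), symmetric]) simp
    finally have 0: "S bs (\<lambda>i. c i - d i) = \<zero>\<^bsub>V\<^esub>" by simp
    define g where "g = (\<lambda>v. let i = the_inv_into {..<length bs} ((!) bs) v in c i - d i)"
    have g: "g (bs ! i) = c i - d i" if "i < length bs" for i
      using the_inv_into_f_f[OF inj] that by (auto simp: g_def Let_def)
    have "S bs (\<lambda>i. g (bs ! i)) = S bs (\<lambda>i. c i - d i)"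
      using g by (intro Scong[OF that(1)]) simp
    then have "lincomb g (set bs) = \<zero>\<^bsub>V\<^esub>"
      using 0 lincomb_S[OF that(1)] by simp
    moreover have "lin_indpt (set bs)" using that by (auto simp: bas_def basis_def)
    ultimately have "g v = 0" if "v \<in> set bs" for v
      using lin_dep_crit[of "set bs" "set bs" g v] that by auto
    then show ?thesis using g that(3) by force
  qed
  have SS: "(\<Oplus>\<^bsub>V\<^esub>i\<in>{..<n}. a i \<odot>\<^bsub>V\<^esub> S ds (b i)) = S ds (\<lambda>l. \<Sum>i<n. a i * b i l)"
    if "bas ds" for n :: nat and a :: "nat \<Rightarrow> 'a" and b ds
  proof (induction n)
    case 0
    have "S ds (\<lambda>l. 0) = \<zero>\<^bsub>V\<^esub>"
      using Ssmult[OF that, of 0 "\<lambda>_. 0"] smult_l_null[OF S_closed[OF that]] by simp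
    then show ?case by simp
  next
    case (Suc n)
    have "(\<Oplus>\<^bsub>V\<^esub>i\<in>{..<Suc n}. a i \<odot>\<^bsub>V\<^esub> S ds (b i)) =
        a n \<odot>\<^bsub>V\<^esub> S ds (b n) \<oplus>\<^bsub>V\<^esub> (\<Oplus>\<^bsub>V\<^esub>i\<in>{..<n}. a i \<odot>\<^bsub>V\<^esub> S ds (b i))"
      unfolding lessThan_Suc using sm S_closed[OF that] by (intro M.finsum_insert) auto
    then show ?case
      using Suc by (simp add: Ssmult[OF that] Sadd[OF that] add.commute)
  qed
  have \<phi>S: "\<phi> (S ds c) = (\<Oplus>\<^bsub>V\<^esub>i\<in>{..<length ds}. c i \<odot>\<^bsub>V\<^esub> \<phi> (ds ! i))" if "bas ds" for ds c
  proof -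
    interpret mod_hom class_ring V V \<phi>
      using \<phi> by unfold_locales
    have "\<phi> (\<Oplus>\<^bsub>V\<^esub>i\<in>I. c i \<odot>\<^bsub>V\<^esub> ds ! i) = (\<Oplus>\<^bsub>V\<^esub>i\<in>I. \<phi> (c i \<odot>\<^bsub>V\<^esub> ds ! i))"
      if "finite I" "I \<subseteq> {..<length ds}" for I
      using that
    proof (induction I rule: finite_induct)
      case (insert j J)
      have *: "(\<lambda>i. c i \<odot>\<^bsub>V\<^esub> ds ! i) \<in> insert j J \<rightarrow> carrier V"
        using insert.prems cnth[OF \<open>bas ds\<close>] sm by auto
      then have "\<phi> (\<Oplus>\<^bsub>V\<^esub>i\<in>insert j J. c i \<odot>\<^bsub>V\<^esub> ds ! i) =
          \<phi> (c j \<odot>\<^bsub>V\<^esub> ds ! j \<oplus>\<^bsub>V\<^esub> (\<Oplus>\<^bsub>V\<^esub>i\<in>J. c i \<odot>\<^bsub>V\<^esub> ds ! i))"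
        using insert.hyps by (intro arg_cong[of _ _ \<phi>] M.finsum_insert) auto
      also have "\<dots> = \<phi> (c j \<odot>\<^bsub>V\<^esub> ds ! j) \<oplus>\<^bsub>V\<^esub> \<phi> (\<Oplus>\<^bsub>V\<^esub>i\<in>J. c i \<odot>\<^bsub>V\<^esub> ds ! i)"
        using * by (intro f_add M.finsum_closed) auto
      also have "\<dots> = (\<Oplus>\<^bsub>V\<^esub>i\<in>insert j J. \<phi> (c i \<odot>\<^bsub>V\<^esub> ds ! i))"
        using * insert f_im by (subst M.finsum_insert) auto
      finally show ?case .
    qed simp
    then have "\<phi> (S ds c) = (\<Oplus>\<^bsub>V\<^esub>i\<in>{..<length ds}. \<phi> (c i \<odot>\<^bsub>V\<^esub> ds ! i))"
      unfolding S_def by simp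
    also have "\<dots> = (\<Oplus>\<^bsub>V\<^esub>i\<in>{..<length ds}. c i \<odot>\<^bsub>V\<^esub> \<phi> (ds ! i))"
      using cnth[OF that] sm f_smult f_im by (intro M.finsum_cong') auto
    finally show ?thesis .
  qed
  define n where "n = length bs"
  have n': "length cs = n"
    using A B dim_basis[of "set bs"] dim_basis[of "set cs"]
    by (simp add: represents_def n_def distinct_card)
  have mat: "A \<in> carrier_mat n n" "B \<in> carrier_mat n n"
    using A B n' by (auto simp: represents_def n_def)
  have change: "\<exists>Q\<in>carrier_mat n n. \<forall>j<n. ds ! j = S es (\<lambda>i. Q $$ (i, j))"
    if *: "bas ds" "bas es" "length ds = n" "length es = n" for ds es
  proof -
    obtain q where q: "\<And>j. j < n \<Longrightarrow> ds ! j = S es (q j)"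
      using ex[OF *(2) cnth[OF *(1)]] *(3) by metis
    have "ds ! j = S es (\<lambda>i. mat n n (\<lambda>(i, j). q j i) $$ (i, j))" if "j < n" for j
      unfolding q[OF that] using *(4) that by (intro Scong[OF *(2)]) simp
    then show ?thesis
      by (intro bexI[of _ "mat n n (\<lambda>(i, j). q j i)"]) auto
  qed
  obtain Q where Q: "Q \<in> carrier_mat n n" "\<And>j. j < n \<Longrightarrow> bs ! j = S cs (\<lambda>i. Q $$ (i, j))"
    using change[OF bas n_def[symmetric] n'] by blast
  obtain P where P: "P \<in> carrier_mat n n" "\<And>j. j < n \<Longrightarrow> cs ! j = S bs (\<lambda>i. P $$ (i, j))"
    using change[OF bas(2,1) n' n_def[symmetric]] by blast
  have comp: "S es (\<lambda>i. (Y * X) $$ (i, j)) = S ds (\<lambda>i. X $$ (i, j))"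
    if "bas ds" "bas es" "length ds = n" "length es = n" "j < n" "X \<in> carrier_mat n n"
      "Y \<in> carrier_mat n n" "\<And>i. i < n \<Longrightarrow> ds ! i = S es (\<lambda>l. Y $$ (l, i))" for X Y j ds es
  proof -
    have "S ds (\<lambda>i. X $$ (i, j)) = (\<Oplus>\<^bsub>V\<^esub>i\<in>{..<n}. X $$ (i, j) \<odot>\<^bsub>V\<^esub> S es (\<lambda>l. Y $$ (l, i)))"
      unfolding S_def[of ds] using that sm S_closed[OF that(2)] by (intro M.finsum_cong') auto
    also have "\<dots> = S es (\<lambda>l. \<Sum>i<n. X $$ (i, j) * Y $$ (l, i))" by (rule SS[OF that(2)])
    also have "\<dots> = S es (\<lambda>l. (Y * X) $$ (l, j))"
      using that by (intro Scong) (auto simp: scalar_prod_def mult.commute lessThan_atLeast0)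
    finally show ?thesis by simp
  qed
  have delta: "S ds (\<lambda>i. (1\<^sub>m n) $$ (i, j)) = ds ! j" if "bas ds" "length ds = n" "j < n" for ds j
  proof -
    have "S ds (\<lambda>i. (1\<^sub>m n) $$ (i, j)) = (\<Oplus>\<^bsub>V\<^esub>i\<in>{..<n}. if j = i then ds ! i else \<zero>\<^bsub>V\<^esub>)"
      unfolding S_def using that cnth[OF that(1)] smult_one smult_l_null
      by (intro M.finsum_cong') auto
    also have "\<dots> = ds ! j"
      using that cnth[OF that(1)] by (intro M.finsum_singleton) auto
    finally show ?thesis .
  qed
  have inv: "Y * X = 1\<^sub>m n"
    if "bas ds" "bas es" "length ds = n" "length es = n" "X \<in> carrier_mat n n"
      "Y \<in> carrier_mat n n" "\<And>i. i < n \<Longrightarrow> ds ! i = S es (\<lambda>l. Y $$ (l, i))"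
      "\<And>i. i < n \<Longrightarrow> es ! i = S ds (\<lambda>l. X $$ (l, i))" for X Y ds es
  proof (rule eq_matI)
    fix i j assume "i < dim_row (1\<^sub>m n :: 'a mat)" "j < dim_col (1\<^sub>m n :: 'a mat)"
    then show "(Y * X) $$ (i, j) = 1\<^sub>m n $$ (i, j)"
      using comp[OF that(1-4) _ that(5-7), of j] that(4,8) delta[OF that(2,4), of j]
      by (intro uniq[OF that(2), of "\<lambda>i. (Y * X) $$ (i, j)" "\<lambda>i. 1\<^sub>m n $$ (i, j)" i]) auto
  qed (use that in auto)
  have PQ: "P * Q = 1\<^sub>m n" "Q * P = 1\<^sub>m n"
    using inv[OF bas(2,1) n' n_def[symmetric] Q(1) P(1) P(2) Q(2)]
      inv[OF bas n_def[symmetric] n' P(1) Q(1) Q(2) P(2)] by blast+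
  have "Q * A = B * Q"
  proof (rule eq_matI)
    fix i j assume "i < dim_row (B * Q)" "j < dim_col (B * Q)"
    then have ij: "i < n" "j < n" using mat Q by auto
    have "S cs (\<lambda>i. (Q * A) $$ (i, j)) = S bs (\<lambda>i. A $$ (i, j))"
      by (rule comp[OF bas n_def[symmetric] n' ij(2) mat(1) Q])
    also have "\<dots> = \<phi> (bs ! j)" using A ij by (auto simp: represents_def S_def n_def)
    also have "\<dots> = (\<Oplus>\<^bsub>V\<^esub>i\<in>{..<n}. Q $$ (i, j) \<odot>\<^bsub>V\<^esub> \<phi> (cs ! i))"
      using Q(2)[OF ij(2)] \<phi>S[OF bas(2)] n' by simp
    also have "\<dots> = (\<Oplus>\<^bsub>V\<^esub>i\<in>{..<n}. Q $$ (i, j) \<odot>\<^bsub>V\<^esub> S cs (\<lambda>l. B $$ (l, i)))"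
      using B n' sm S_closed[OF bas(2)] unfolding represents_def S_def
      by (intro M.finsum_cong') auto
    also have "\<dots> = S cs (\<lambda>l. \<Sum>i<n. Q $$ (i, j) * B $$ (l, i))" by (rule SS[OF bas(2)])
    also have "\<dots> = S cs (\<lambda>l. (B * Q) $$ (l, j))"
      using mat Q ij n' bas
      by (intro Scong) (auto simp: scalar_prod_def mult.commute lessThan_atLeast0)
    finally show "(Q * A) $$ (i, j) = (B * Q) $$ (i, j)"
      using uniq[OF bas(2), of "\<lambda>i. (Q * A) $$ (i, j)" "\<lambda>i. (B * Q) $$ (i, j)" i] ij n' by simp
  qed (use mat Q in auto)
  then have "P * B * Q = P * Q * A"
    using mat P(1) Q(1) by (simp add: assoc_mult_mat[of P n n _ n _ n])
  then have "A = P * B * Q"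
    using mat PQ(1) by simp
  then have "similar_mat A B"
    using mat P Q PQ by (intro similar_matI[of A B P Q n]) auto
  then show ?thesis by (rule char_poly_similar)
qed

lemma endo_char_poly_eq:
  assumes "vectorspace class_ring V" "\<phi> \<in> LinearCombinations.module_hom class_ring V V"
    and "represents V bs \<phi> A"
  shows "endo_char_poly V \<phi> = char_poly A"
  unfolding endo_char_poly_def
  using assms represents_char_poly_unique[OF assms(1,2)] by (intro the_equality) blast+

lemma endo_char_poly_mult_mat_vec:
  fixes A :: "'a::field mat"
  assumes A: "A \<in> carrier_mat n n"
  shows "endo_char_poly (module_vec TYPE('a) n) (\<lambda>v\<in>carrier_vec n. A *\<^sub>v v) = char_poly A"
proof (rule endo_char_poly_eq)
  interpret vec_space "TYPE('a)" n .
  let ?\<phi> = "\<lambda>v\<in>carrier_vec n. A *\<^sub>v v"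
  show "vectorspace class_ring (module_vec TYPE('a) n)" by (rule vec_vs)
  show "?\<phi> \<in> LinearCombinations.module_hom class_ring (module_vec TYPE('a) n) (module_vec TYPE('a) n)"
    using A by (auto simp: LinearCombinations.module_hom_def module_vec_simps
        mult_add_distrib_mat_vec mult_mat_vec)
  have 1: "length (unit_vecs n) = n" by simp
  have "?\<phi> (unit_vecs n ! j) =
      finsum (module_vec TYPE('a) n) (\<lambda>i. A $$ (i, j) \<cdot>\<^sub>v unit_vecs n ! i) {..<n}" (is "?l = ?r")
    if j: "j < n" for j
  proof (rule eq_vecI)
    have c: "(\<lambda>i. A $$ (i, j) \<cdot>\<^sub>v unit_vecs n ! i) \<in> {..<n} \<rightarrow> carrier_vec n"
      by (auto simp: unit_vecs_def)
    then have r: "dim_vec ?r = n" by (intro finsum_dim) auto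
    have "dim_vec ?l = n" using A j by (simp add: unit_vecs_def)
    then show "dim_vec ?l = dim_vec ?r" using r by simp
    fix k assume "k < dim_vec ?r"
    then have k: "k < n" using r by simp
    have "?r $ k = (\<Sum>i<n. (A $$ (i, j) \<cdot>\<^sub>v unit_vecs n ! i) $ k)"
      using index_finsum_vec[OF _ k c] by simp
    also have "\<dots> = (\<Sum>i<n. if i = k then A $$ (k, j) else 0)"
      using k by (intro sum.cong) (auto simp: unit_vecs_def unit_vec_def)
    also have "\<dots> = ?l $ k"
      using A j k by (simp add: unit_vecs_def scalar_prod_right_unit[of j n])
    finally show "?l $ k = ?r $ k" by simp
  qed
  then show "represents (module_vec TYPE('a) n) (unit_vecs n) ?\<phi> A"
    using A unit_vecs_basis unit_vecs_distinct by (simp add: represents_def module_vec_simps 1)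
qed

end

theory Submission
  imports Defs
begin

text \<open>
  Let \<open>\<pi>\<close> be a uniformizer and \<open>T\<close> a maximal \<open>G\<close>-stable lattice on which \<open>f\<close> is integral, with dual
  lattice \<open>T\<^sup>*\<close>. Maximality gives \<open>\<pi> T\<^sup>* \<subseteq> T \<subseteq> T\<^sup>*\<close>, so \<open>f\<close> and \<open>\<pi> f\<close> induce nondegenerate
  \<open>k\<close>-valued forms on \<open>T / \<pi> T\<^sup>*\<close> and \<open>T\<^sup>* / T\<close>, and \<open>G\<close> acts on the orthogonal sum of these two
  spaces. Since \<open>T\<^sup>* / T\<close> is isomorphic to \<open>\<pi> T\<^sup>* / \<pi> T\<close>, this sum has the characteristic polynomials
  of \<open>T / \<pi> T\<close>. An element \<open>g\<close> of the kernel satisfies \<open>(g - 1)\<^sup>2 T \<subseteq> \<pi> T\<close>; if it is nontrivial, some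
  power of it has prime order \<open>p\<close>, and the expansion of \<open>(1 + (g - 1))\<^sup>p = 1\<close> is contradictory because
  \<open>2 e < l - 1\<close>.
\<close>

section \<open>The valuation ring as a type\<close>

text \<open>The reduction of f on a stable lattice may be degenerate, and no stable lattice need be
  self-dual; hence the filtration of \<open>T / \<pi> T\<close> by the radical
  \<open>\<pi> T\<^sup>* / \<pi> T\<close>, both layers of which carry a nondegenerate form. The
  price is that an element acting trivially on both layers is unipotent of step two only. In the
  Minkowski--Serre argument each factor \<pi> then costs two powers of h = g - 1 instead of one, and
  this is the origin of 2 e: the term h^p has to absorb p, of valuation c, which needs 2 c + 1 < p.
  For p = l this is the hypothesis, for any other p it says 1 < p. The hypothesis also excludes l =
  2, since l lies in the maximal ideal and e is therefore positive. So one sign s = 1 or s = -1 can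
  stand for both kinds of forms: a skew-symmetric form over k is alternating again. Lattices are
  handled through matrices. The columns of P are a basis of T, F is the Gram matrix and A g the
  matrix of g in this basis, and X = \<pi> F^-1.\<close>

typedef (overloaded) 'a valuation_subring = "valuation_ring :: 'a::discrete_valuation_field set"
  morphisms of_subring to_subring
  by (rule exI[of _ 0]) simp

setup_lifting type_definition_valuation_subring

instantiation valuation_subring :: (discrete_valuation_field) idom
begin

lift_definition zero_valuation_subring :: "'a valuation_subring" is 0 by simp
lift_definition one_valuation_subring :: "'a valuation_subring" is 1 by simp
lift_definition plus_valuation_subring ::
  "'a valuation_subring \<Rightarrow> 'a valuation_subring \<Rightarrow> 'a valuation_subring" is "(+)"
  by (rule valuation_ring_add)
lift_definition uminus_valuation_subring :: "'a valuation_subring \<Rightarrow> 'a valuation_subring"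
  is uminus by (rule valuation_ring_uminus)
lift_definition minus_valuation_subring ::
  "'a valuation_subring \<Rightarrow> 'a valuation_subring \<Rightarrow> 'a valuation_subring" is "(-)"
  using valuation_ring_add valuation_ring_uminus by (metis diff_conv_add_uminus)
lift_definition times_valuation_subring ::
  "'a valuation_subring \<Rightarrow> 'a valuation_subring \<Rightarrow> 'a valuation_subring" is "(*)"
  by (rule valuation_ring_mult)

instance
  by standard (transfer; simp add: algebra_simps)+

end

definition residue :: "'a::discrete_valuation_field valuation_subring \<Rightarrow> 'a residue_field" where
  "residue x = reduction (of_subring x)"

lemma of_subring_in [simp]: "of_subring x \<in> valuation_ring"
  by (rule of_subring)

text \<open>With the valuation ring as a type, inclusion and \<open>residue\<close> are ring
  homomorphisms between types, so products, determinants and characteristic polynomials of matrices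
  commute with both.\<close>

interpretation of_subring: inj_comm_ring_hom
  "of_subring :: 'a::discrete_valuation_field valuation_subring \<Rightarrow> 'a"
  by unfold_locales (transfer; simp)+

interpretation residue: comm_ring_hom
  "residue :: 'a::discrete_valuation_field valuation_subring \<Rightarrow> 'a residue_field"
proof
  fix x y :: "'a valuation_subring"
  show "residue (0 :: 'a valuation_subring) = 0"
    using reduction_eq_0_iff[of 0] by (simp add: residue_def of_subring.hom_zero)
  show "residue (1 :: 'a valuation_subring) = 1"
    by (simp add: residue_def reduction_1 of_subring.hom_one)
  show "residue (x + y) = residue x + residue y"
    by (simp add: residue_def reduction_add of_subring.hom_add)
  show "residue (x * y) = residue x * residue y"
    by (simp add: residue_def reduction_mult of_subring.hom_mult)
qed

lemma residue_surj: "\<exists>x. residue x = a"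
proof -
  obtain x where "x \<in> valuation_ring" "reduction x = a"
    using reduction_surj by (metis UNIV_I imageE)
  then show ?thesis
    by (intro exI[of _ "to_subring x"]) (simp add: residue_def to_subring_inverse)
qed

definition uniformizer :: "'a::discrete_valuation_field valuation_subring" where
  "uniformizer = to_subring (SOME x. x \<noteq> 0 \<and> val x = 1)"

lemma of_uniformizer: "of_subring (uniformizer :: 'a valuation_subring) \<noteq> 0"
  "val (of_subring (uniformizer :: 'a::discrete_valuation_field valuation_subring)) = 1"
proof -
  have "\<exists>x::'a. x \<noteq> 0 \<and> val x = 1"
    using val_normalized by (metis (mono_tags, lifting) UNIV_I imageE mem_Collect_eq)
  then have *: "(SOME x::'a. x \<noteq> 0 \<and> val x = 1) \<noteq> 0 \<and> val (SOME x::'a. x \<noteq> 0 \<and> val x = 1) = 1"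
    by (rule someI_ex)
  then have "(SOME x::'a. x \<noteq> 0 \<and> val x = 1) \<in> valuation_ring"
    by (simp add: valuation_ring_def)
  then have "of_subring (uniformizer :: 'a valuation_subring) = (SOME x::'a. x \<noteq> 0 \<and> val x = 1)"
    by (simp add: uniformizer_def to_subring_inverse)
  then show "of_subring (uniformizer :: 'a valuation_subring) \<noteq> 0"
    "val (of_subring (uniformizer :: 'a valuation_subring)) = 1"
    using * by auto
qed

lemma uniformizer_nonzero [simp]: "uniformizer \<noteq> 0"
  using of_uniformizer(1) of_subring.hom_zero by metis

lemma val_power: "x \<noteq> 0 \<Longrightarrow> val (x ^ m) = int m * val (x::'a::discrete_valuation_field)"
  by (induction m) (auto simp: val_mult algebra_simps)

lemma val_divide:
  "x \<noteq> 0 \<Longrightarrow> y \<noteq> 0 \<Longrightarrow> val (x / y) = val x - val (y::'a::discrete_valuation_field)"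
  using val_mult[of x "inverse y"] by (simp add: val_inverse divide_inverse)

text \<open>The quotient formed in K is integral exactly when the valuations compare. The case
  \<open>y = 0\<close> stands apart because \<open>val 0\<close> is unspecified.\<close>

lemma subring_dvd_iff:
  "x dvd y \<longleftrightarrow> y = 0 \<or> x \<noteq> 0 \<and> val (of_subring x) \<le> val (of_subring y)"
proof
  assume "x dvd y"
  then obtain z where y: "y = x * z" ..
  show "y = 0 \<or> x \<noteq> 0 \<and> val (of_subring x) \<le> val (of_subring y)"
  proof (cases "y = 0")
    case False
    then have "x \<noteq> 0" "z \<noteq> 0" using y by auto
    moreover have "0 \<le> val (of_subring z)"
      using of_subring_in[of z] \<open>z \<noteq> 0\<close> by (simp add: valuation_ring_def)
    ultimately show ?thesis
      using y val_mult[of "of_subring x" "of_subring z"] by (simp add: of_subring.hom_mult)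
  qed simp
next
  assume *: "y = 0 \<or> x \<noteq> 0 \<and> val (of_subring x) \<le> val (of_subring y)"
  show "x dvd y"
  proof (cases "y = 0")
    case False
    then have x: "x \<noteq> 0" "val (of_subring x) \<le> val (of_subring y)" using * by auto
    let ?z = "of_subring y / of_subring x"
    have "?z \<in> valuation_ring"
      using x False by (simp add: valuation_ring_def val_divide)
    then have "of_subring (x * to_subring ?z) = of_subring y"
      using x by (simp add: of_subring.hom_mult to_subring_inverse)
    then have "y = x * to_subring ?z" by simp
    then show ?thesis ..
  qed simp
qed

lemma residue_eq_0_iff: "residue x = 0 \<longleftrightarrow> uniformizer dvd x"
  using reduction_eq_0_iff[of "of_subring x"]
  by (auto simp: residue_def subring_dvd_iff of_uniformizer valuation_ideal_def)

lemma subring_unit_iff: "x dvd 1 \<longleftrightarrow> residue x \<noteq> 0"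
proof
  assume "x dvd 1"
  then show "residue x \<noteq> 0"
    using dvd_trans[of uniformizer x 1]
    by (auto simp: residue_eq_0_iff subring_dvd_iff of_uniformizer of_subring.hom_one)
next
  assume "residue x \<noteq> 0"
  then have "\<not> 0 < val (of_subring x)" "x \<noteq> 0"
    using reduction_eq_0_iff[of "of_subring x"] by (auto simp: residue_def valuation_ideal_def)
  then show "x dvd 1" by (simp add: subring_dvd_iff)
qed

lemma uniformizer_power_dvd_iff:
  "uniformizer ^ m dvd x \<longleftrightarrow> x = 0 \<or> int m \<le> val (of_subring x)"
  by (auto simp: subring_dvd_iff of_subring.hom_power val_power of_uniformizer)

text \<open>The \<pi>-adic filtration is separated. This turns the unlimited divisibility reached in
  the Minkowski--Serre descent into vanishing.\<close>

lemma uniformizer_powers_dvd_imp_0: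
  assumes "\<And>m. uniformizer ^ m dvd x"
  shows "x = 0"
  using assms[of "Suc (nat (val (of_subring x)))"]
  unfolding uniformizer_power_dvd_iff by (auto split: if_splits)

lemma valuation_subring_unit_times_power:
  fixes x :: "'a::discrete_valuation_field valuation_subring"
  assumes "x \<noteq> 0"
  obtains u where "u dvd 1" "x = u * uniformizer ^ nat (val (of_subring x))"
proof -
  have x: "0 \<le> val (of_subring x)"
    using of_subring_in[of x] assms by (simp add: valuation_ring_def)
  then have "uniformizer ^ nat (val (of_subring x)) dvd x"
    by (simp add: uniformizer_power_dvd_iff)
  then obtain u where u: "x = uniformizer ^ nat (val (of_subring x)) * u" ..
  then have "u \<noteq> 0" using assms by auto
  have "val (of_subring x) = val (of_subring (uniformizer ^ nat (val (of_subring x)) * u))"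
    using u by simp
  also have "\<dots> = val (of_subring x) + val (of_subring u)"
    using x \<open>u \<noteq> 0\<close> by (simp add: of_subring.hom_mult of_subring.hom_power val_mult val_power of_uniformizer)
  finally have "u dvd 1"
    using \<open>u \<noteq> 0\<close> by (simp add: subring_dvd_iff)
  then show thesis using that u by (simp add: mult.commute)
qed

section \<open>The Minkowski--Serre lemma\<close>

lemma mat_mult_entry:
  assumes "A \<in> carrier_mat nr n" "B \<in> carrier_mat n nc" "i < nr" "j < nc"
  shows "(A * B) $$ (i, j) = (\<Sum>k<n. A $$ (i, k) * B $$ (k, j))"
  using assms by (simp add: scalar_prod_def lessThan_atLeast0)

text \<open>The factor \<open>h ^\<^sub>m r\<close> closes the induction on \<open>m\<close>:
  peeling off one \<open>1\<^sub>m n + h\<close> produces the exponents \<open>r\<close> and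
  \<open>Suc r\<close>, which Pascal's rule recombines. It later multiplies the relation (1 + h)^p =
  1 by a power of h.\<close>

lemma binomial_mat_entry:
  fixes h :: "'a::comm_ring_1 mat"
  assumes h: "h \<in> carrier_mat n n" and ij: "i < n" "j < n"
  shows "((1\<^sub>m n + h) ^\<^sub>m m * h ^\<^sub>m r) $$ (i, j) =
    (\<Sum>k\<le>m. of_nat (m choose k) * (h ^\<^sub>m (k + r)) $$ (i, j))"
proof (induction m arbitrary: r)
  case 0
  then show ?case using h ij by simp
next
  case (Suc m)
  have c: "(1\<^sub>m n + h) ^\<^sub>m m \<in> carrier_mat n n" "h ^\<^sub>m r \<in> carrier_mat n n"
    "h ^\<^sub>m Suc r \<in> carrier_mat n n" "1\<^sub>m n + h \<in> carrier_mat n n"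
    using h by (auto intro!: pow_carrier_mat mult_carrier_mat)
  have comm: "h * h ^\<^sub>m r = h ^\<^sub>m Suc r"
    using h by (induction r) (auto simp: assoc_mult_mat[symmetric, of _ n n _ n _ n])
  have "(1\<^sub>m n + h) ^\<^sub>m Suc m * h ^\<^sub>m r = (1\<^sub>m n + h) ^\<^sub>m m * (h ^\<^sub>m r + h ^\<^sub>m Suc r)"
    using h c(1,2) comm
    by (simp add: assoc_mult_mat[OF c(1,4,2)] add_mult_distrib_mat[OF one_carrier_mat h c(2)])
  also have "\<dots> = (1\<^sub>m n + h) ^\<^sub>m m * h ^\<^sub>m r + (1\<^sub>m n + h) ^\<^sub>m m * h ^\<^sub>m Suc r"
    by (rule mult_add_distrib_mat[OF c(1-3)])
  finally have "((1\<^sub>m n + h) ^\<^sub>m Suc m * h ^\<^sub>m r) $$ (i, j) =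
      ((1\<^sub>m n + h) ^\<^sub>m m * h ^\<^sub>m r) $$ (i, j) + ((1\<^sub>m n + h) ^\<^sub>m m * h ^\<^sub>m Suc r) $$ (i, j)"
    using ij mult_carrier_mat[OF c(1,3)] by (metis carrier_matD index_add_mat(1))
  also have "\<dots> = (\<Sum>k\<le>m. of_nat (m choose k) * (h ^\<^sub>m (k + r)) $$ (i, j)) +
      (\<Sum>k\<le>m. of_nat (m choose k) * (h ^\<^sub>m (Suc k + r)) $$ (i, j))"
    unfolding Suc.IH by simp
  also have "(\<Sum>k\<le>m. of_nat (m choose k) * (h ^\<^sub>m (k + r)) $$ (i, j)) =
      (\<Sum>k\<le>Suc m. of_nat (m choose k) * (h ^\<^sub>m (k + r)) $$ (i, j))"
    by (simp add: binomial_eq_0)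
  also have "\<dots> = (h ^\<^sub>m r) $$ (i, j) +
      (\<Sum>k\<le>m. of_nat (m choose Suc k) * (h ^\<^sub>m (Suc k + r)) $$ (i, j))"
    by (subst sum.atMost_Suc_shift) simp
  also have "\<dots> + (\<Sum>k\<le>m. of_nat (m choose k) * (h ^\<^sub>m (Suc k + r)) $$ (i, j)) =
      (h ^\<^sub>m r) $$ (i, j) + (\<Sum>k\<le>m. of_nat (Suc m choose Suc k) * (h ^\<^sub>m (Suc k + r)) $$ (i, j))"
    by (simp add: sum.distrib distrib_right add_ac del: pow_mat.simps)
  also have "\<dots> = (\<Sum>k\<le>Suc m. of_nat (Suc m choose k) * (h ^\<^sub>m (k + r)) $$ (i, j))"
    by (subst sum.atMost_Suc_shift) simp
  finally show ?case .
qed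

text \<open>
  The Minkowski--Serre lemma for quadratically unipotent matrices. If \<open>\<pi>\<^sup>a\<close> divides \<open>h\<close>, then
  \<open>\<pi>\<^sup>a\<^sup>+\<^sup>1\<close> divides \<open>h\<^sup>3 = h h\<^sup>2\<close>; the binomial expansion of \<open>(1 + h)\<^sup>p = 1\<close>, divided by \<open>p\<close>,
  then gives first \<open>\<pi>\<^sup>a\<^sup>+\<^sup>1\<close> dividing \<open>h\<^sup>2\<close> and afterwards \<open>\<pi>\<^sup>a\<^sup>+\<^sup>1\<close> dividing \<open>h\<close>.
\<close>

lemma quadratically_unipotent_mat_eq_0:
  fixes h :: "'a::idom mat"
  assumes h: "h \<in> carrier_mat n n"
    and sq: "\<And>i j. i < n \<Longrightarrow> j < n \<Longrightarrow> \<pi> dvd (h * h) $$ (i, j)"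
    and pow: "(1\<^sub>m n + h) ^\<^sub>m p = 1\<^sub>m n"
    and p: "prime p" and u: "of_nat p = u * \<pi> ^ c" "u dvd 1" and c: "2 * c + 1 < p"
    and \<pi>: "\<pi> \<noteq> 0" "\<And>x. (\<And>a. \<pi> ^ a dvd x) \<Longrightarrow> x = 0"
  shows "h = 0\<^sub>m n n"
proof -
  \<comment> \<open>\<open>D m a\<close> says that \<pi>^a divides h^m. One more factor h keeps the
    exponent a; two more raise it by one, because of \<open>sq\<close>.\<close>
  define D where "D m a \<longleftrightarrow> (\<forall>i<n. \<forall>j<n. \<pi> ^ a dvd (h ^\<^sub>m m) $$ (i, j))" for m a :: nat
  have hp [simp]: "h ^\<^sub>m m \<in> carrier_mat n n" for m using h by (rule pow_carrier_mat)
  have D_Suc: "D (Suc m) a" if "D m a" for m a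
    using that h hp[of m] by (auto simp: D_def scalar_prod_def intro!: dvd_sum dvd_mult2)
  have D_Suc2: "D (Suc (Suc m)) (Suc a)" if "D m a" for m a
    unfolding D_def
  proof safe
    fix i j assume ij: "i < n" "j < n"
    have "(h ^\<^sub>m Suc (Suc m)) $$ (i, j) = (h ^\<^sub>m m * (h * h)) $$ (i, j)"
      using h hp[of m] by (simp add: assoc_mult_mat[of _ n n _ n _ n])
    also have "\<dots> = (\<Sum>k<n. (h ^\<^sub>m m) $$ (i, k) * (h * h) $$ (k, j))"
      using h hp[of m] ij by (intro mat_mult_entry[of _ n n _ n]) auto
    also have "\<pi> ^ Suc a dvd \<dots>"
    proof (rule dvd_sum)
      fix k assume "k \<in> {..<n}"
      then have "\<pi> ^ a * \<pi> dvd (h ^\<^sub>m m) $$ (i, k) * (h * h) $$ (k, j)"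
        using that ij sq[of k j] unfolding D_def by (intro mult_dvd_mono) auto
      then show "\<pi> ^ Suc a dvd (h ^\<^sub>m m) $$ (i, k) * (h * h) $$ (k, j)"
        by (simp add: mult.commute)
    qed
    finally show "\<pi> ^ Suc a dvd (h ^\<^sub>m Suc (Suc m)) $$ (i, j)" .
  qed
  have D_add: "D (m + k) a" if "D m a" for m k a
    using that by (induction k) (auto intro: D_Suc)
  have D_add2: "D (m + 2 * k) (a + k)" if "D m a" for m k a
    using that by (induction k) (auto intro: D_Suc2)
  \<comment> \<open>In h^(t-1) (1 + h)^p = h^(t-1) the linear term is p h^t. The terms with 1 < k <
    p have a binomial coefficient divisible by p, hence by \<pi>^c, so \<pi>^b from the matrix
    suffices; the term k = p has coefficient 1 and must supply \<pi>^(b+c) itself. Cancelling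
    \<pi>^c and the unit u leaves \<pi>^b.\<close>
  have step: "D t b" if D: "\<And>k. 2 \<le> k \<Longrightarrow> k < p \<Longrightarrow> D (k - 1 + t) b" "D (p - 1 + t) (b + c)"
    and t: "1 \<le> t" for t b
    unfolding D_def
  proof safe
    fix i j assume ij: "i < n" "j < n"
    define x where "x k = of_nat (p choose k) * (h ^\<^sub>m (k + (t - 1))) $$ (i, j)" for k
    have p2: "2 \<le> p" using p by (rule prime_ge_2_nat)
    have "(h ^\<^sub>m (t - 1)) $$ (i, j) = (\<Sum>k\<le>p. x k)"
      using binomial_mat_entry[OF h ij, of p "t - 1"]
      unfolding pow x_def left_mult_one_mat[OF hp] .
    also have "\<dots> = x 0 + (x 1 + (\<Sum>k\<in>{2..p}. x k))"
    proof -
      have "{..p} = insert 0 (insert 1 {2..p})" using p2 by auto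
      then show ?thesis by simp
    qed
    finally have x1: "x 1 = - (\<Sum>k\<in>{2..p}. x k)"
      by (simp add: x_def eq_neg_iff_add_eq_0)
    have "\<pi> ^ (b + c) dvd (\<Sum>k\<in>{2..p}. x k)"
    proof (rule dvd_sum)
      fix k assume k: "k \<in> {2..p}"
      have e: "k + (t - 1) = k - 1 + t" using k t by auto
      show "\<pi> ^ (b + c) dvd x k"
      proof (cases "k = p")
        case True
        then show ?thesis using D(2) ij e by (simp add: x_def D_def)
      next
        case False
        then have "p dvd (p choose k)" using k p by (intro dvd_choose_prime) auto
        then have "(of_nat p :: 'a) dvd of_nat (p choose k)" by (metis dvd_def of_nat_mult)
        then have "\<pi> ^ c dvd of_nat (p choose k)" using u(1) by (metis dvd_mult_right)
        moreover have "\<pi> ^ b dvd (h ^\<^sub>m (k + (t - 1))) $$ (i, j)"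
          using D(1)[of k] k False ij e by (simp add: D_def)
        ultimately show ?thesis
          unfolding x_def power_add by (subst mult.commute) (rule mult_dvd_mono)
      qed
    qed
    then have "\<pi> ^ (b + c) dvd x 1" using x1 by simp
    moreover have "x 1 = \<pi> ^ c * (u * (h ^\<^sub>m t) $$ (i, j))"
      using t u(1) by (simp add: x_def algebra_simps)
    ultimately have "\<pi> ^ b dvd u * (h ^\<^sub>m t) $$ (i, j)"
      using \<pi>(1) by (simp add: power_add mult.commute)
    moreover obtain v where "1 = u * v" using u(2) ..
    ultimately show "\<pi> ^ b dvd (h ^\<^sub>m t) $$ (i, j)"
      by (metis dvd_mult mult.assoc mult.commute mult_1)
  qed
  have "D 1 a" for a
  proof (induction a)
    case 0
    show ?case by (simp add: D_def)
  next
    case (Suc a)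
    \<comment> \<open>The square comes first: for t = 2 the lowest remaining power is h^3, where the
      gain is available, whereas for t = 1 it is h^2 itself.\<close>
    have D2: "D 2 (Suc a)"
    proof (rule step)
      fix k assume "2 \<le> k" "k < p"
      then have e: "k - 1 + 2 = Suc (Suc 1) + (k - 2)" by simp
      show "D (k - 1 + 2) (Suc a)" unfolding e by (rule D_add[OF D_Suc2[OF Suc]])
    next
      \<comment> \<open>Starting from h, gaining c + 1 takes 2 (c + 1) further factors, so h^(p+1)
        is long enough when p is at least 2 c + 2. Below, h^p starting from h^2 and gaining c leads
        to the same bound.\<close>
      have e: "p - 1 + 2 = 1 + 2 * Suc c + (p - 2 * c - 2)" using c by simp
      show "D (p - 1 + 2) (Suc a + c)"
        using D_add[OF D_add2[OF Suc, of "Suc c"], of "p - 2 * c - 2"] unfolding e by simp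
    qed simp
    show ?case
    proof (rule step)
      fix k assume "2 \<le> k" "k < p"
      then have e: "k - 1 + 1 = 2 + (k - 2)" by simp
      show "D (k - 1 + 1) (Suc a)" unfolding e by (rule D_add[OF D2])
    next
      have e: "p - 1 + 1 = 2 + 2 * c + (p - 2 * c - 2)" using c by simp
      show "D (p - 1 + 1) (Suc a + c)" unfolding e by (rule D_add[OF D_add2[OF D2]])
    qed simp
  qed
  then show ?thesis
    using h \<pi>(2) by (intro eq_matI) (auto simp: D_def)
qed

section \<open>Lattices\<close>

text \<open>The inverse is the adjugate divided by the determinant; this serves over the valuation
  ring as well as over K and k.\<close>

lemma mat_inverse_if_det_unit:
  fixes A :: "'a::comm_ring_1 mat"
  assumes A: "A \<in> carrier_mat n n" and d: "det A dvd 1"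
  obtains B where "B \<in> carrier_mat n n" "A * B = 1\<^sub>m n" "B * A = 1\<^sub>m n"
proof -
  obtain c where c: "1 = det A * c" using d ..
  note adj = adj_mat[OF A]
  have "c \<cdot>\<^sub>m (det A \<cdot>\<^sub>m 1\<^sub>m n) = 1\<^sub>m n"
    using c by (intro eq_matI) (auto simp: mult.commute)
  then have "A * (c \<cdot>\<^sub>m adj_mat A) = 1\<^sub>m n" "(c \<cdot>\<^sub>m adj_mat A) * A = 1\<^sub>m n"
    using mult_smult_distrib[OF A adj(1), of c] mult_smult_assoc_mat[OF adj(1) A, of c] adj(2,3)
    by auto
  then show thesis using that[of "c \<cdot>\<^sub>m adj_mat A"] adj(1) by simp
qed

abbreviation emb_mat :: "'a::discrete_valuation_field valuation_subring mat \<Rightarrow> 'a mat" where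
  "emb_mat \<equiv> map_mat of_subring"

text \<open>The standard lattice O^n. Other lattices are encoded as its images under invertible
  matrices over K.\<close>

definition integral_vecs :: "nat \<Rightarrow> 'a::discrete_valuation_field vec set" where
  "integral_vecs n = {x \<in> carrier_vec n. \<forall>i<n. x $ i \<in> valuation_ring}"

lemma valuation_ring_sum: "(\<And>i. i \<in> I \<Longrightarrow> f i \<in> valuation_ring) \<Longrightarrow> sum f I \<in> valuation_ring"
  by (induction I rule: infinite_finite_induct) (auto intro: valuation_ring_add)

lemma integral_vecs_add: "x \<in> integral_vecs n \<Longrightarrow> y \<in> integral_vecs n \<Longrightarrow> x + y \<in> integral_vecs n"
  and integral_vecs_smult: "c \<in> valuation_ring \<Longrightarrow> x \<in> integral_vecs n \<Longrightarrow> c \<cdot>\<^sub>v x \<in> integral_vecs n"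
  and integral_vecs_0: "0\<^sub>v n \<in> integral_vecs n"
  and integral_vecs_unit: "i < n \<Longrightarrow> unit_vec n i \<in> integral_vecs n"
  by (auto simp: integral_vecs_def intro!: valuation_ring_add valuation_ring_mult)

lemma scalar_prod_integral:
  "x \<in> integral_vecs n \<Longrightarrow> y \<in> integral_vecs n \<Longrightarrow> x \<bullet> y \<in> valuation_ring"
  by (auto simp: integral_vecs_def scalar_prod_def intro!: valuation_ring_sum valuation_ring_mult)

lemma emb_mat_mult_integral_vec:
  "A \<in> carrier_mat m n \<Longrightarrow> x \<in> integral_vecs n \<Longrightarrow> emb_mat A *\<^sub>v x \<in> integral_vecs m"
  by (auto simp: integral_vecs_def scalar_prod_def intro!: valuation_ring_sum valuation_ring_mult)

lemma mat_lift_to_subring: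
  assumes "A \<in> carrier_mat m n" "\<And>i j. i < m \<Longrightarrow> j < n \<Longrightarrow> A $$ (i, j) \<in> valuation_ring"
  obtains B where "B \<in> carrier_mat m n" "emb_mat B = A"
proof -
  have "emb_mat (map_mat to_subring A) = A"
    using assms by (intro eq_matI) (auto simp: to_subring_inverse)
  then show thesis using that[of "map_mat to_subring A"] assms(1) by simp
qed

text \<open>Clearing denominators multiplies the determinant by \<pi>^(n N) and makes it integral.
  The bound ensures that a least valuation exists among determinants of vectors from a
  lattice.\<close>

lemma val_det_ge:
  fixes P :: "'a::discrete_valuation_field mat"
  assumes P: "P \<in> carrier_mat n n" "det P \<noteq> 0"
    and N: "\<And>i j. i < n \<Longrightarrow> j < n \<Longrightarrow> of_subring (uniformizer ^ N) * P $$ (i, j) \<in> valuation_ring"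
  shows "- int (n * N) \<le> val (det P)"
proof -
  let ?t = "of_subring (uniformizer ^ N) :: 'a"
  have t: "?t \<noteq> 0" "val ?t = N"
    using of_uniformizer by (auto simp: of_subring.hom_power val_power)
  obtain B where B: "B \<in> carrier_mat n n" "emb_mat B = ?t \<cdot>\<^sub>m P"
    using mat_lift_to_subring[of "?t \<cdot>\<^sub>m P" n n] P N by auto
  have "of_subring (det B) = ?t ^ n * det P"
    using P B(2) of_subring.hom_det[of B] by simp
  then have "?t ^ n * det P \<in> valuation_ring" by (metis of_subring_in)
  then show ?thesis
    using t P by (simp add: valuation_ring_def val_mult val_power)
qed

text \<open>
  A basis of \<open>M\<close> is given by vectors of \<open>M\<close> whose determinant has minimal valuation: by Cramer's
  rule, exchanging the \<open>i\<close>-th of them for \<open>x \<in> M\<close> multiplies the determinant by the \<open>i\<close>-th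
  coordinate of \<open>x\<close>.
\<close>

lemma lattice_basis:
  fixes M :: "'a::discrete_valuation_field vec set"
  assumes M: "M \<subseteq> carrier_vec n" "0\<^sub>v n \<in> M" "\<And>x y. x \<in> M \<Longrightarrow> y \<in> M \<Longrightarrow> x + y \<in> M"
    "\<And>c x. c \<in> valuation_ring \<Longrightarrow> x \<in> M \<Longrightarrow> c \<cdot>\<^sub>v x \<in> M"
    and N: "\<And>x i. x \<in> M \<Longrightarrow> i < n \<Longrightarrow> of_subring (uniformizer ^ N) * x $ i \<in> valuation_ring"
    and P0: "P0 \<in> carrier_mat n n" "det P0 \<noteq> 0" "\<And>j. j < n \<Longrightarrow> col P0 j \<in> M"
  obtains P where "P \<in> carrier_mat n n" "det P \<noteq> 0" "M = (*\<^sub>v) P ` integral_vecs n"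
proof -
  define S where "S P \<longleftrightarrow> P \<in> carrier_mat n n \<and> det P \<noteq> 0 \<and> (\<forall>j<n. col P j \<in> M)" for P
  \<comment> \<open>The shift by n N makes the valuations natural numbers, among which a least one
    exists.\<close>
  define m where "m P = nat (val (det P) + int (n * N))" for P :: "'a mat"
  have nonneg: "0 \<le> val (det P) + int (n * N)" if "S P" for P
  proof -
    have "of_subring (uniformizer ^ N) * P $$ (i, j) \<in> valuation_ring" if "i < n" "j < n" for i j
      using N[of "col P j" i] \<open>S P\<close> that by (auto simp: S_def)
    then show ?thesis using val_det_ge[of P n N] that by (simp add: S_def)
  qed
  have "S P0" using P0 by (simp add: S_def)
  then obtain P where P: "S P" "\<And>Q. S Q \<Longrightarrow> m P \<le> m Q"
    using ex_has_least_nat[of S P0 m] by blast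
  then have Pc: "P \<in> carrier_mat n n" "det P \<noteq> 0" "\<And>j. j < n \<Longrightarrow> col P j \<in> M"
    by (auto simp: S_def)
  obtain B where B: "B \<in> carrier_mat n n" "P * B = 1\<^sub>m n"
    using mat_inverse_if_det_unit[OF Pc(1)] Pc(2) by (metis dvd_field_iff one_neq_zero)
  have "x \<in> (*\<^sub>v) P ` integral_vecs n" if x: "x \<in> M" for x
  proof -
    define c where "c = B *\<^sub>v x"
    have c: "c \<in> carrier_vec n" "x = P *\<^sub>v c"
      using x M(1) B Pc(1) assoc_mult_mat_vec[OF Pc(1) B(1), of x] by (auto simp: c_def)
    have "c $ i \<in> valuation_ring" if i: "i < n" for i
    proof (rule ccontr)
      assume "c $ i \<notin> valuation_ring"
      then have ci: "c $ i \<noteq> 0" "val (c $ i) < 0" by (auto simp: valuation_ring_def)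
      define Q where "Q = replace_col P x i"
      have det: "det Q = c $ i * det P"
        using cramer_lemma_mat[OF Pc(1) c(1) i] c(2) by (simp add: Q_def)
      have "col Q j = (if j = i then x else col P j)" if "j < n" for j
        using that Pc(1) x M(1) by (intro eq_vecI) (auto simp: Q_def replace_col_def)
      then have Q: "S Q"
        using Pc det ci x by (auto simp: S_def Q_def replace_col_def)
      have "m Q < m P"
        using nonneg[OF P(1)] nonneg[OF Q] det ci Pc(2) by (simp add: m_def val_mult)
      then show False using P(2)[OF Q] by simp
    qed
    then show ?thesis using c by (auto simp: integral_vecs_def)
  qed
  moreover have "P *\<^sub>v c \<in> M" if c: "c \<in> integral_vecs n" for c
  proof -
    \<comment> \<open>The combination is built column by column, \<open>M\<close> being closed under
      binary sums.\<close>
    have "vec n (\<lambda>i. \<Sum>j<k. P $$ (i, j) * c $ j) \<in> M" if "k \<le> n" for k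
      using that
    proof (induction k)
      case 0
      have "vec n (\<lambda>i. \<Sum>j<0. P $$ (i, j) * c $ j) = 0\<^sub>v n" by auto
      then show ?case using M(2) by simp
    next
      case (Suc k)
      have "vec n (\<lambda>i. \<Sum>j<Suc k. P $$ (i, j) * c $ j) =
          vec n (\<lambda>i. \<Sum>j<k. P $$ (i, j) * c $ j) + c $ k \<cdot>\<^sub>v col P k"
        using Pc(1) Suc.prems by (intro eq_vecI) (auto simp: mult.commute)
      then show ?case
        using Suc c Pc(3) by (auto simp: integral_vecs_def intro!: M(3,4))
    qed
    moreover have "P *\<^sub>v c = vec n (\<lambda>i. \<Sum>j<n. P $$ (i, j) * c $ j)"
      using Pc(1) c by (intro eq_vecI) (auto simp: scalar_prod_def integral_vecs_def lessThan_atLeast0)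
    ultimately show ?thesis by simp
  qed
  ultimately show thesis using that[of P] Pc by auto
qed

text \<open>The columns of \<open>P\<close> span a lattice that is stable under \<open>R\<close> and
  on which the form with Gram matrix \<open>J\<close> is integral: \<open>A\<close> is the matrix of
  \<open>X\<close> and \<open>F\<close> the Gram matrix in the basis \<open>P\<close>.\<close>

definition integral_basis ::
  "nat \<Rightarrow> 'a::discrete_valuation_field mat set \<Rightarrow> 'a mat \<Rightarrow> 'a mat \<Rightarrow> bool" where
  "integral_basis n R J P \<longleftrightarrow> P \<in> carrier_mat n n \<and> det P \<noteq> 0 \<and>
    (\<forall>X\<in>R. \<exists>A\<in>carrier_mat n n. X * P = P * emb_mat A) \<and>
    (\<exists>F\<in>carrier_mat n n. P\<^sup>T * (J * P) = emb_mat F)"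

lemma mat_entry_scalar_prod:
  fixes A :: "'a::comm_ring_1 mat"
  assumes "A \<in> carrier_mat m n" "i < m" "j < n"
  shows "A $$ (i, j) = (A *\<^sub>v unit_vec n j) $ i"
  using assms by (simp add: scalar_prod_right_unit)

lemma col_eq_mult_unit_vec:
  fixes A :: "'a::comm_ring_1 mat"
  assumes "A \<in> carrier_mat m n" "j < n"
  shows "col A j = A *\<^sub>v unit_vec n j"
  using assms by (intro eq_vecI) (auto simp: scalar_prod_right_unit)

lemma smult_mat_mult_vec:
  fixes A :: "'a::comm_ring_1 mat"
  assumes "A \<in> carrier_mat m n" "v \<in> carrier_vec n"
  shows "(k \<cdot>\<^sub>m A) *\<^sub>v v = k \<cdot>\<^sub>v (A *\<^sub>v v)"
  using assms by (intro eq_vecI) (auto simp: scalar_prod_def sum_distrib_left mult.assoc)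

text \<open>Column j of P^-1 X P lists the coordinates of X applied to the j-th basis vector, and
  the new Gram matrix lists the values of the form on basis vectors. Stability and integrality of
  \<open>M\<close> are thus integrality of these matrices.\<close>

lemma lattice_integral_basis:
  fixes M :: "'a::discrete_valuation_field vec set"
  assumes M: "M \<subseteq> carrier_vec n" "0\<^sub>v n \<in> M" "\<And>x y. x \<in> M \<Longrightarrow> y \<in> M \<Longrightarrow> x + y \<in> M"
    "\<And>c x. c \<in> valuation_ring \<Longrightarrow> x \<in> M \<Longrightarrow> c \<cdot>\<^sub>v x \<in> M"
    and N: "\<And>x i. x \<in> M \<Longrightarrow> i < n \<Longrightarrow> of_subring (uniformizer ^ N) * x $ i \<in> valuation_ring"
    and P0: "P0 \<in> carrier_mat n n" "det P0 \<noteq> 0" "\<And>j. j < n \<Longrightarrow> col P0 j \<in> M"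
    and R: "R \<subseteq> carrier_mat n n" "\<And>X x. X \<in> R \<Longrightarrow> x \<in> M \<Longrightarrow> X *\<^sub>v x \<in> M"
    and J: "J \<in> carrier_mat n n"
      "\<And>x y. x \<in> M \<Longrightarrow> y \<in> M \<Longrightarrow> x \<bullet> (J *\<^sub>v y) \<in> valuation_ring"
  obtains P where "integral_basis n R J P" "M = (*\<^sub>v) P ` integral_vecs n"
proof -
  have "\<exists>P. P \<in> carrier_mat n n \<and> det P \<noteq> 0 \<and> M = (*\<^sub>v) P ` integral_vecs n"
    by (rule lattice_basis[of M n N P0]) (fact M N P0 | blast)+
  then obtain P where P: "P \<in> carrier_mat n n" "det P \<noteq> 0" "M = (*\<^sub>v) P ` integral_vecs n"
    by blast
  obtain B where B: "B \<in> carrier_mat n n" "P * B = 1\<^sub>m n" "B * P = 1\<^sub>m n"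
    using mat_inverse_if_det_unit[OF P(1)] P(2) by (metis dvd_field_iff one_neq_zero)
  have PM: "P *\<^sub>v unit_vec n j \<in> M" if "j < n" for j
    using that P(3) integral_vecs_unit by auto
  have "\<exists>A\<in>carrier_mat n n. X * P = P * emb_mat A" if X: "X \<in> R" for X
  proof -
    have Xc: "X \<in> carrier_mat n n" using X R(1) by auto
    have "(B * (X * P)) $$ (i, j) \<in> valuation_ring" if ij: "i < n" "j < n" for i j
    proof -
      have "X *\<^sub>v (P *\<^sub>v unit_vec n j) \<in> M" using R(2)[OF X PM[OF ij(2)]] .
      then obtain c where c: "c \<in> integral_vecs n" "X *\<^sub>v (P *\<^sub>v unit_vec n j) = P *\<^sub>v c"
        using P(3) by auto
      have cc: "c \<in> carrier_vec n" using c(1) by (simp add: integral_vecs_def)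
      have "B * (X * P) *\<^sub>v unit_vec n j = B *\<^sub>v (P *\<^sub>v c)"
        using B(1) Xc P(1) c(2)
        by (simp add: assoc_mult_mat_vec[of _ n n _ n] del: mult_mat_vec_carrier)
      also have "\<dots> = c"
        using B P(1) cc by (simp add: assoc_mult_mat_vec[symmetric, of _ n n _ n] del: assoc_mult_mat_vec)
      finally have "(B * (X * P)) $$ (i, j) = c $ i"
        using mat_entry_scalar_prod[of "B * (X * P)" n n i j] B(1) Xc P(1) ij by simp
      then show ?thesis using c(1) ij by (simp add: integral_vecs_def)
    qed
    then obtain A where A: "A \<in> carrier_mat n n" "emb_mat A = B * (X * P)"
      using mat_lift_to_subring[of "B * (X * P)" n n] B(1) Xc P(1) by auto
    have "P * emb_mat A = X * P"
      using A(2) B P(1) Xc assoc_mult_mat[OF P(1) B(1), of "X * P" n] by simp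
    then show ?thesis using A(1) by metis
  qed
  moreover have "\<exists>F\<in>carrier_mat n n. P\<^sup>T * (J * P) = emb_mat F"
  proof -
    have "(P\<^sup>T * (J * P)) $$ (i, j) \<in> valuation_ring" if ij: "i < n" "j < n" for i j
    proof -
      have "(P\<^sup>T * (J * P)) $$ (i, j) = col P i \<bullet> (J *\<^sub>v col P j)"
        unfolding col_mult2[OF J(1) P(1) ij(2), symmetric] using P(1) J(1) ij by simp
      then show ?thesis
        using J(2)[OF PM PM] ij P(1) by (simp add: col_eq_mult_unit_vec)
    qed
    then obtain F where "F \<in> carrier_mat n n" "emb_mat F = P\<^sup>T * (J * P)"
      using mat_lift_to_subring[of "P\<^sup>T * (J * P)" n n] J(1) P(1) by auto
    then show ?thesis by (metis)
  qed
  ultimately show thesis using that[of P] P by (simp add: integral_basis_def)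
qed

lemma common_denominator:
  fixes S :: "'a::discrete_valuation_field set"
  assumes "finite S"
  obtains N where "\<And>x m. x \<in> S \<Longrightarrow> N \<le> m \<Longrightarrow> of_subring (uniformizer ^ m) * x \<in> valuation_ring"
proof -
  \<comment> \<open>A sum of natural numbers bounds each of its terms; a possible term for x = 0 is
    unspecified but can only enlarge it.\<close>
  define N where "N = (\<Sum>x\<in>S. nat (- val x))"
  have "of_subring (uniformizer ^ m) * x \<in> valuation_ring" if x: "x \<in> S" "N \<le> m" for x :: 'a and m
  proof (cases "x = 0")
    case False
    have "nat (- val x) \<le> N"
      using member_le_sum[OF x(1), of "\<lambda>x. nat (- val x)"] assms by (simp add: N_def)
    then have "0 \<le> int m + val x" using x(2) by linarith
    then show ?thesis
      using False
      by (auto simp: valuation_ring_def val_mult of_subring.hom_power val_power of_uniformizer)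
  qed simp
  then show thesis using that by blast
qed

lemma mat_entries_common_denominator:
  fixes R :: "'a::discrete_valuation_field mat set"
  assumes "finite R" "R \<subseteq> carrier_mat n n"
  obtains N where "\<And>X i j m. X \<in> R \<Longrightarrow> i < n \<Longrightarrow> j < n \<Longrightarrow> N \<le> m \<Longrightarrow>
    of_subring (uniformizer ^ m) * X $$ (i, j) \<in> valuation_ring"
proof -
  have "finite (\<Union>X\<in>R. (\<lambda>(i, j). X $$ (i, j)) ` ({..<n} \<times> {..<n}))"
    using assms(1) by auto
  then obtain N where "\<And>x m. x \<in> (\<Union>X\<in>R. (\<lambda>(i, j). X $$ (i, j)) ` ({..<n} \<times> {..<n})) \<Longrightarrow> N \<le> m \<Longrightarrow>
      of_subring (uniformizer ^ m) * x \<in> valuation_ring"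
    using common_denominator by metis
  then show thesis using that[of N] by force
qed

text \<open>The lattice used here is \<open>\<Inter>X\<in>R. X\<inverse> (\<pi>\<^sup>a O\<^sup>n)\<close>, where \<open>\<pi>\<^sup>a\<close> clears the denominators of \<open>J\<close>.\<close>

lemma exists_integral_basis:
  fixes R :: "'a::discrete_valuation_field mat set"
  assumes R: "finite R" "R \<subseteq> carrier_mat n n" "1\<^sub>m n \<in> R" "\<And>X Y. X \<in> R \<Longrightarrow> Y \<in> R \<Longrightarrow> X * Y \<in> R"
    and J: "J \<in> carrier_mat n n"
  obtains P where "integral_basis n R J P"
proof -
  obtain a where a: "\<And>X i j m. X \<in> {J} \<Longrightarrow> i < n \<Longrightarrow> j < n \<Longrightarrow> a \<le> m \<Longrightarrow>
    of_subring (uniformizer ^ m) * X $$ (i, j) \<in> valuation_ring"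
    using mat_entries_common_denominator[of "{J}" n] J by auto
  obtain b where b: "\<And>X i j m. X \<in> R \<Longrightarrow> i < n \<Longrightarrow> j < n \<Longrightarrow> b \<le> m \<Longrightarrow>
    of_subring (uniformizer ^ m) * X $$ (i, j) \<in> valuation_ring"
    using mat_entries_common_denominator[OF R(1,2)] by metis
  define t where "t = (of_subring (uniformizer ^ a) :: 'a)"
  have t: "t \<noteq> 0" "t \<in> valuation_ring"
    using of_uniformizer by (auto simp: t_def)
  define M where "M = {x \<in> carrier_vec n. \<forall>X\<in>R. inverse t \<cdot>\<^sub>v (X *\<^sub>v x) \<in> integral_vecs n}"
  have M1: "inverse t \<cdot>\<^sub>v x \<in> integral_vecs n" if "x \<in> M" for x
    using that R(3) by (auto simp: M_def)
  \<comment> \<open>\<pi>^b clears the denominators of all elements of \<open>R\<close>, so these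
    multiples of the unit vectors lie in \<open>M\<close> and witness its full rank.\<close>
  define P0 where "P0 = of_subring (uniformizer ^ (a + b)) \<cdot>\<^sub>m (1\<^sub>m n :: 'a mat)"
  \<comment> \<open>The denominators are bounded by \<pi>^0, since
    \<open>1\<^sub>m n \<in> R\<close> puts \<open>M\<close> inside \<pi>^a O^n. Closure of
    \<open>R\<close> under products makes \<open>M\<close> stable.\<close>
  show thesis
  proof (rule lattice_integral_basis[of M n 0 P0 R J])
    show "M \<subseteq> carrier_vec n" by (auto simp: M_def)
    show "0\<^sub>v n \<in> M" using R(2) by (auto simp: M_def integral_vecs_def)
    show "x + y \<in> M" if "x \<in> M" "y \<in> M" for x y
    proof -
      have "inverse t \<cdot>\<^sub>v (X *\<^sub>v (x + y)) = inverse t \<cdot>\<^sub>v (X *\<^sub>v x) + inverse t \<cdot>\<^sub>v (X *\<^sub>v y)"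
        if "X \<in> R" for X
        using \<open>x \<in> M\<close> \<open>y \<in> M\<close> that R(2)
        by (auto simp: M_def mult_add_distrib_mat_vec[of _ n n] smult_add_distrib_vec[of _ n])
      then show ?thesis using that by (auto simp: M_def integral_vecs_add)
    qed
    show "c \<cdot>\<^sub>v x \<in> M" if "c \<in> valuation_ring" "x \<in> M" for c x
    proof -
      have "inverse t \<cdot>\<^sub>v (X *\<^sub>v (c \<cdot>\<^sub>v x)) = c \<cdot>\<^sub>v (inverse t \<cdot>\<^sub>v (X *\<^sub>v x))" if "X \<in> R" for X
        using \<open>x \<in> M\<close> that R(2)
        by (auto simp: M_def mult_mat_vec[of _ n n] smult_smult_assoc mult.commute)
      then show ?thesis using that by (auto simp: M_def integral_vecs_smult)
    qed
    show "of_subring (uniformizer ^ 0) * x $ i \<in> valuation_ring" if "x \<in> M" "i < n" for x i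
    proof -
      have "inverse t * x $ i \<in> valuation_ring"
        using M1[OF that(1)] that by (auto simp: integral_vecs_def M_def)
      then have "t * (inverse t * x $ i) \<in> valuation_ring"
        using t(2) by (rule valuation_ring_mult[rotated])
      then show ?thesis using t(1) by (simp add: mult.assoc[symmetric])
    qed
    show "P0 \<in> carrier_mat n n" by (simp add: P0_def)
    show "det P0 \<noteq> 0" using of_uniformizer by (simp add: P0_def of_subring.hom_power)
    show "col P0 j \<in> M" if "j < n" for j
    proof -
      have "inverse t \<cdot>\<^sub>v (X *\<^sub>v col P0 j) \<in> integral_vecs n" if X: "X \<in> R" for X
      proof -
        have eq: "(inverse t \<cdot>\<^sub>v (X *\<^sub>v col P0 j)) $ i = of_subring (uniformizer ^ b) * X $$ (i, j)"
          if "i < n" for i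
        proof -
          have "col P0 j = (t * of_subring (uniformizer ^ b)) \<cdot>\<^sub>v unit_vec n j"
            using \<open>j < n\<close> by (intro eq_vecI) (auto simp: P0_def t_def power_add of_subring.hom_mult)
          then have "X *\<^sub>v col P0 j = (t * of_subring (uniformizer ^ b)) \<cdot>\<^sub>v (X *\<^sub>v unit_vec n j)"
            using X R(2) by (auto simp: mult_mat_vec[of _ n n])
          then show ?thesis
            using X R(2) \<open>j < n\<close> that t(1) mat_entry_scalar_prod[of X n n i j] by auto
        qed
        have "inverse t \<cdot>\<^sub>v (X *\<^sub>v col P0 j) \<in> carrier_vec n"
          using subsetD[OF R(2) X] \<open>j < n\<close> by (auto simp: P0_def intro!: mult_mat_vec_carrier[of _ n n])
        moreover have "(inverse t \<cdot>\<^sub>v (X *\<^sub>v col P0 j)) $ i \<in> valuation_ring" if "i < n" for i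
          unfolding eq[OF that] using b[OF X that \<open>j < n\<close>] by blast
        ultimately show ?thesis unfolding integral_vecs_def by blast
      qed
      moreover have "col P0 j \<in> carrier_vec n" by (intro carrier_vecI) (simp add: P0_def)
      ultimately show ?thesis by (auto simp: M_def)
    qed
    show "R \<subseteq> carrier_mat n n" by (rule R)
    show "X *\<^sub>v x \<in> M" if "X \<in> R" "x \<in> M" for X x
    proof -
      have "Y *\<^sub>v (X *\<^sub>v x) = (Y * X) *\<^sub>v x" if "Y \<in> R" for Y
        using that \<open>X \<in> R\<close> \<open>x \<in> M\<close> R(2)
        by (intro assoc_mult_mat_vec[symmetric, of _ n n _ n]) (auto simp: M_def)
      then show ?thesis using that R(2,4) by (auto simp: M_def)
    qed
    show "J \<in> carrier_mat n n" by (rule J)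
    show "x \<bullet> (J *\<^sub>v y) \<in> valuation_ring" if xy: "x \<in> M" "y \<in> M" for x y
    proof -
      define x' y' where "x' = inverse t \<cdot>\<^sub>v x" and "y' = inverse t \<cdot>\<^sub>v y"
      have *: "x' \<in> integral_vecs n" "y' \<in> integral_vecs n"
        using M1 xy by (auto simp: x'_def y'_def)
      then have c: "x' \<in> carrier_vec n" "y' \<in> carrier_vec n" by (auto simp: integral_vecs_def)
      \<comment> \<open>Of the two factors t, one makes \<open>J\<close> integral and the other is
        left over.\<close>
      have e: "x = t \<cdot>\<^sub>v x'" "y = t \<cdot>\<^sub>v y'"
        using t(1) by (auto simp: x'_def y'_def smult_smult_assoc)
      obtain A where A: "A \<in> carrier_mat n n" "emb_mat A = t \<cdot>\<^sub>m J"
        using mat_lift_to_subring[of "t \<cdot>\<^sub>m J" n n] J a by (auto simp: t_def)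
      have "x \<bullet> (J *\<^sub>v y) = t * (x' \<bullet> (emb_mat A *\<^sub>v y'))"
        using c J unfolding A(2) e by (simp add: mult_mat_vec[of _ n n] smult_mat_mult_vec[OF J])
      then show ?thesis
        using t(2) * A(1) by (simp add: valuation_ring_mult scalar_prod_integral emb_mat_mult_integral_vec)
    qed
  qed (use that in blast)
qed

text \<open>A basis \<open>C\<close> found in the coordinates of \<open>P\<close> yields the basis
  \<open>P * C\<close> in the original ones. In this way minimality of \<open>P\<close> becomes a
  condition on \<open>C\<close>.\<close>

lemma integral_basis_comp:
  assumes P: "P \<in> carrier_mat n n" "det P \<noteq> 0"
    and R: "R \<subseteq> carrier_mat n n" "\<And>X. X \<in> R \<Longrightarrow> A X \<in> carrier_mat n n \<and> X * P = P * emb_mat (A X)"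
    and J: "J \<in> carrier_mat n n" and F: "F \<in> carrier_mat n n" "P\<^sup>T * (J * P) = emb_mat F"
    and C: "integral_basis n ((\<lambda>X. emb_mat (A X)) ` R) (emb_mat F) C"
  shows "integral_basis n R J (P * C)"
proof -
  have Cc: "C \<in> carrier_mat n n" "det C \<noteq> 0" using C by (auto simp: integral_basis_def)
  have "\<exists>B\<in>carrier_mat n n. X * (P * C) = P * C * emb_mat B" if X: "X \<in> R" for X
  proof -
    obtain B where B: "B \<in> carrier_mat n n" "emb_mat (A X) * C = C * emb_mat B"
      using C X by (auto simp: integral_basis_def)
    have Xc: "X \<in> carrier_mat n n" "emb_mat (A X) \<in> carrier_mat n n" "emb_mat B \<in> carrier_mat n n"
      using X R B(1) by auto
    have "X * (P * C) = X * P * C" using Xc P(1) Cc(1) by (simp add: assoc_mult_mat[of _ n n _ n _ n])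
    also have "\<dots> = P * (emb_mat (A X) * C)"
      using R(2)[OF X] Xc P(1) Cc(1) by (simp add: assoc_mult_mat[of _ n n _ n _ n])
    also have "\<dots> = P * C * emb_mat B"
      using Xc P(1) Cc(1) unfolding B(2) by (simp add: assoc_mult_mat[of _ n n _ n _ n])
    finally show ?thesis using B(1) by metis
  qed
  moreover have "\<exists>F'\<in>carrier_mat n n. (P * C)\<^sup>T * (J * (P * C)) = emb_mat F'"
  proof -
    obtain F' where F': "F' \<in> carrier_mat n n" "C\<^sup>T * (emb_mat F * C) = emb_mat F'"
      using C by (auto simp: integral_basis_def)
    have c: "P\<^sup>T \<in> carrier_mat n n" "C\<^sup>T \<in> carrier_mat n n" using P(1) Cc(1) by auto
    have "(P * C)\<^sup>T * (J * (P * C)) = C\<^sup>T * (P\<^sup>T * (J * P) * C)"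
      using P(1) Cc(1) J c by (simp add: transpose_mult[of _ n n _ n] assoc_mult_mat[of _ n n _ n _ n])
    then show ?thesis using F' F(2) by metis
  qed
  ultimately show ?thesis
    using P Cc by (auto simp: integral_basis_def det_mult[OF P(1) Cc(1)])
qed

text \<open>
  If the basis is minimal among all integral ones, then its lattice \<open>T\<close> is a maximal stable
  integral lattice, hence contains the stable integral lattice \<open>T + (\<pi> T\<^sup>* \<inter> \<pi>\<inverse> T)\<close>, where
  \<open>T\<^sup>*\<close> is the dual lattice. In coordinates \<open>T = O\<^sup>n\<close> and \<open>\<pi> T\<^sup>* = F\<inverse> (\<pi> O\<^sup>n)\<close>.
\<close>

lemma integral_if_minimal:
  fixes F :: "'a::discrete_valuation_field valuation_subring mat"
  assumes F: "F \<in> carrier_mat n n" "F\<^sup>T = of_int s \<cdot>\<^sub>m F"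
    and A: "\<A> \<subseteq> carrier_mat n n" "\<And>A. A \<in> \<A> \<Longrightarrow> \<exists>B\<in>carrier_mat n n. F * A = B * F"
    and min: "\<And>C. integral_basis n (emb_mat ` \<A>) (emb_mat F) C \<Longrightarrow> 0 \<le> val (det C)"
    and y: "y \<in> carrier_vec n" "of_subring uniformizer \<cdot>\<^sub>v y \<in> integral_vecs n"
    and w: "w \<in> integral_vecs n" "emb_mat F *\<^sub>v y = of_subring uniformizer \<cdot>\<^sub>v w"
  shows "y \<in> integral_vecs n"
proof -
  define \<pi> where "\<pi> = (of_subring uniformizer :: 'a)"
  have \<pi>: "\<pi> \<noteq> 0" using of_uniformizer by (simp add: \<pi>_def)
  \<comment> \<open>The set \<open>\<pi> T\<^sup>* \<inter> \<pi>\<inverse> T\<close>: integrality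
    of \<open>w\<close> says that f(x, y) is divisible by \<pi> for all x in T, and the other
    condition bounds the denominators.\<close>
  define D where "D = {y \<in> carrier_vec n. \<pi> \<cdot>\<^sub>v y \<in> integral_vecs n \<and>
    (\<exists>w\<in>integral_vecs n. emb_mat F *\<^sub>v y = \<pi> \<cdot>\<^sub>v w)}"
  define M where "M = {x + y |x y. x \<in> integral_vecs n \<and> y \<in> D}"
  have ic: "x \<in> carrier_vec n" if "x \<in> integral_vecs n" for x :: "'a vec"
    using that by (simp add: integral_vecs_def)
  have Fc: "emb_mat F \<in> carrier_mat n n" using F by simp
  have \<pi>v: "\<pi> \<cdot>\<^sub>v u \<in> integral_vecs n" if "u \<in> integral_vecs n" for u
    using integral_vecs_smult[OF _ that] by (simp add: \<pi>_def)
  have D0: "0\<^sub>v n \<in> D"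
    using F integral_vecs_0[of n] \<pi>v[OF integral_vecs_0] by (auto simp: D_def intro!: bexI[of _ "0\<^sub>v n"])
  have Dadd: "x + y \<in> D" if xy: "x \<in> D" "y \<in> D" for x y
  proof -
    obtain v w where vw: "v \<in> integral_vecs n" "emb_mat F *\<^sub>v x = \<pi> \<cdot>\<^sub>v v"
      "w \<in> integral_vecs n" "emb_mat F *\<^sub>v y = \<pi> \<cdot>\<^sub>v w"
      using xy by (auto simp: D_def)
    have c: "x \<in> carrier_vec n" "y \<in> carrier_vec n" using xy by (auto simp: D_def)
    have "emb_mat F *\<^sub>v (x + y) = \<pi> \<cdot>\<^sub>v (v + w)"
      using vw c ic[OF vw(1)] ic[OF vw(3)]
      by (simp add: mult_add_distrib_mat_vec[OF Fc] smult_add_distrib_vec[of _ n])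
    moreover have "\<pi> \<cdot>\<^sub>v (x + y) \<in> integral_vecs n"
      using xy c by (auto simp: D_def smult_add_distrib_vec[of _ n] integral_vecs_add)
    ultimately show ?thesis using c integral_vecs_add[OF vw(1,3)] by (auto simp: D_def)
  qed
  have Dsmult: "c \<cdot>\<^sub>v x \<in> D" if xy: "c \<in> valuation_ring" "x \<in> D" for c x
  proof -
    obtain v where v: "v \<in> integral_vecs n" "emb_mat F *\<^sub>v x = \<pi> \<cdot>\<^sub>v v"
      using xy by (auto simp: D_def)
    have c: "x \<in> carrier_vec n" using xy by (auto simp: D_def)
    have "emb_mat F *\<^sub>v (c \<cdot>\<^sub>v x) = \<pi> \<cdot>\<^sub>v (c \<cdot>\<^sub>v v)"
      using v c by (simp add: mult_mat_vec[OF Fc] smult_smult_assoc mult.commute)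
    moreover have "\<pi> \<cdot>\<^sub>v (c \<cdot>\<^sub>v x) = c \<cdot>\<^sub>v (\<pi> \<cdot>\<^sub>v x)"
      by (simp add: smult_smult_assoc mult.commute)
    then have "\<pi> \<cdot>\<^sub>v (c \<cdot>\<^sub>v x) \<in> integral_vecs n"
      using integral_vecs_smult[OF xy(1)] xy(2) by (simp add: D_def)
    ultimately show ?thesis using c integral_vecs_smult[OF xy(1) v(1)] by (auto simp: D_def)
  qed
  \<comment> \<open>F A = B F with B integral says that A preserves the dual lattice.\<close>
  have DA: "emb_mat A *\<^sub>v x \<in> D" if xy: "A \<in> \<A>" "x \<in> D" for A x
  proof -
    have Ac: "A \<in> carrier_mat n n" "emb_mat A \<in> carrier_mat n n" using xy A(1) by auto
    obtain B where B: "B \<in> carrier_mat n n" "F * A = B * F" using A(2)[OF xy(1)] by auto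
    obtain v where v: "v \<in> integral_vecs n" "emb_mat F *\<^sub>v x = \<pi> \<cdot>\<^sub>v v"
      using xy by (auto simp: D_def)
    have c: "x \<in> carrier_vec n" using xy by (auto simp: D_def)
    have Bc: "emb_mat B \<in> carrier_mat n n" using B(1) by simp
    have "emb_mat F *\<^sub>v (emb_mat A *\<^sub>v x) = emb_mat (F * A) *\<^sub>v x"
      unfolding of_subring.mat_hom_mult[OF F(1) Ac(1)]
      by (rule assoc_mult_mat_vec[OF Fc Ac(2) c, symmetric])
    also have "\<dots> = emb_mat B *\<^sub>v (emb_mat F *\<^sub>v x)"
      unfolding B(2) of_subring.mat_hom_mult[OF B(1) F(1)] by (rule assoc_mult_mat_vec[OF Bc Fc c])
    also have "\<dots> = \<pi> \<cdot>\<^sub>v (emb_mat B *\<^sub>v v)"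
      unfolding v(2) by (rule mult_mat_vec[OF Bc ic[OF v(1)]])
    finally have "emb_mat F *\<^sub>v (emb_mat A *\<^sub>v x) = \<pi> \<cdot>\<^sub>v (emb_mat B *\<^sub>v v)" .
    moreover have "\<pi> \<cdot>\<^sub>v (emb_mat A *\<^sub>v x) \<in> integral_vecs n"
      using emb_mat_mult_integral_vec[OF Ac(1), of "\<pi> \<cdot>\<^sub>v x"] xy(2)
      by (simp add: D_def mult_mat_vec[OF Ac(2) c])
    ultimately show ?thesis
      using Ac c emb_mat_mult_integral_vec[OF B(1) v(1)]
      unfolding D_def by (auto intro!: mult_mat_vec_carrier[of _ n n])
  qed
  have sub: "x \<in> M" if "x \<in> integral_vecs n" for x
    using that D0 ic[OF that] unfolding M_def
    by (intro CollectI exI[of _ x] exI[of _ "0\<^sub>v n"]) simp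
  have "\<exists>C. integral_basis n (emb_mat ` \<A>) (emb_mat F) C \<and> M = (*\<^sub>v) C ` integral_vecs n"
  proof (rule lattice_integral_basis[of M n 1 "1\<^sub>m n" "emb_mat ` \<A>" "emb_mat F"])
    show "M \<subseteq> carrier_vec n" using ic by (auto simp: M_def D_def)
    show "0\<^sub>v n \<in> M" by (rule sub) (rule integral_vecs_0)
    show "x + y \<in> M" if xy: "x \<in> M" "y \<in> M" for x y
    proof -
      obtain x1 x2 y1 y2 where *: "x = x1 + x2" "y = y1 + y2" "x1 \<in> integral_vecs n"
        "y1 \<in> integral_vecs n" "x2 \<in> D" "y2 \<in> D"
        using xy by (auto simp: M_def)
      have "x + y = (x1 + y1) + (x2 + y2)"
        using * ic[OF *(3)] ic[OF *(4)] by (intro eq_vecI) (auto simp: D_def)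
      then show ?thesis using integral_vecs_add[OF *(3,4)] Dadd[OF *(5,6)] by (auto simp: M_def)
    qed
    show "c \<cdot>\<^sub>v x \<in> M" if cx: "c \<in> valuation_ring" "x \<in> M" for c x
    proof -
      obtain x1 x2 where *: "x = x1 + x2" "x1 \<in> integral_vecs n" "x2 \<in> D"
        using cx by (auto simp: M_def)
      have "c \<cdot>\<^sub>v x = c \<cdot>\<^sub>v x1 + c \<cdot>\<^sub>v x2"
        using * ic[OF *(2)] by (simp add: D_def smult_add_distrib_vec[of _ n])
      then show ?thesis using integral_vecs_smult[OF cx(1) *(2)] Dsmult[OF cx(1) *(3)]
        by (auto simp: M_def)
    qed
    show "of_subring (uniformizer ^ 1) * x $ i \<in> valuation_ring" if x: "x \<in> M" "i < n" for x i
    proof -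
      obtain x1 x2 where *: "x = x1 + x2" "x1 \<in> integral_vecs n" "x2 \<in> D"
        using x by (auto simp: M_def)
      have "\<pi> * x $ i = \<pi> * x1 $ i + (\<pi> \<cdot>\<^sub>v x2) $ i"
        using * ic[OF *(2)] x(2) by (auto simp: D_def distrib_left)
      moreover have "\<pi> * x1 $ i \<in> valuation_ring" "(\<pi> \<cdot>\<^sub>v x2) $ i \<in> valuation_ring"
        using * x(2) by (auto simp: D_def integral_vecs_def \<pi>_def intro!: valuation_ring_mult)
      ultimately show ?thesis by (simp add: \<pi>_def valuation_ring_add)
    qed
    show "1\<^sub>m n \<in> carrier_mat n n" "det (1\<^sub>m n) \<noteq> (0::'a)" by auto
    show "col (1\<^sub>m n) j \<in> M" if "j < n" for j
      using that by (simp add: sub integral_vecs_unit)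
    show "emb_mat ` \<A> \<subseteq> carrier_mat n n" using A(1) by auto
    show "X *\<^sub>v x \<in> M" if Xx: "X \<in> emb_mat ` \<A>" "x \<in> M" for X x
    proof -
      obtain B where B: "X = emb_mat B" "B \<in> \<A>" using Xx by auto
      have Bc: "B \<in> carrier_mat n n" "emb_mat B \<in> carrier_mat n n" using B A(1) by auto
      obtain x1 x2 where *: "x = x1 + x2" "x1 \<in> integral_vecs n" "x2 \<in> D"
        using Xx by (auto simp: M_def)
      have "X *\<^sub>v x = emb_mat B *\<^sub>v x1 + emb_mat B *\<^sub>v x2"
        using *(3) unfolding *(1) B(1)
        by (intro mult_add_distrib_mat_vec[OF Bc(2) ic[OF *(2)]]) (simp add: D_def)
      then show ?thesis
        using emb_mat_mult_integral_vec[OF Bc(1) *(2)] DA[OF B(2) *(3)] by (auto simp: M_def)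
    qed
    show "emb_mat F \<in> carrier_mat n n" by (rule Fc)
    show "x \<bullet> (emb_mat F *\<^sub>v y) \<in> valuation_ring" if xy: "x \<in> M" "y \<in> M" for x y
    proof -
      obtain x1 x2 y1 y2 where *: "x = x1 + x2" "y = y1 + y2" "x1 \<in> integral_vecs n"
        "y1 \<in> integral_vecs n" "x2 \<in> D" "y2 \<in> D"
        using xy by (auto simp: M_def)
      obtain v w where v: "v \<in> integral_vecs n" "emb_mat F *\<^sub>v x2 = \<pi> \<cdot>\<^sub>v v"
        and w: "w \<in> integral_vecs n" "emb_mat F *\<^sub>v y2 = \<pi> \<cdot>\<^sub>v w"
        using * by (auto simp: D_def)
      have c: "x1 \<in> carrier_vec n" "y1 \<in> carrier_vec n" "x2 \<in> carrier_vec n" "y2 \<in> carrier_vec n"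
        "v \<in> carrier_vec n" "w \<in> carrier_vec n" "emb_mat F *\<^sub>v y1 \<in> carrier_vec n"
        "emb_mat F *\<^sub>v y2 \<in> carrier_vec n"
        using * ic v w Fc by (auto simp: D_def intro: mult_mat_vec_carrier[of _ n n])
      \<comment> \<open>\<open>D\<close> controls f(x, y) for y in \<open>D\<close>; the other order
        of the arguments is reached by the symmetry of \<open>F\<close> up to sign.\<close>
      have "x2 \<bullet> (emb_mat F *\<^sub>v y1) = ((emb_mat F)\<^sup>T *\<^sub>v x2) \<bullet> y1"
        by (rule transpose_vec_mult_scalar[OF Fc c(2,3), symmetric])
      also have "(emb_mat F)\<^sup>T = of_int s \<cdot>\<^sub>m emb_mat F"
        unfolding map_mat_transpose F(2) by (intro eq_matI) (auto simp: of_subring.hom_mult of_subring.hom_of_int)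
      also have "(of_int s \<cdot>\<^sub>m emb_mat F) *\<^sub>v x2 = of_subring (of_int s) \<cdot>\<^sub>v (\<pi> \<cdot>\<^sub>v v)"
        using v(2) Fc c(3) by (simp add: smult_mat_mult_vec[OF Fc] of_subring.hom_of_int)
      finally have "x2 \<bullet> (emb_mat F *\<^sub>v y1) \<in> valuation_ring"
        using *(4) \<pi>v[OF v(1)]
        by (auto intro!: scalar_prod_integral[of _ n] integral_vecs_smult)
      moreover have "x1 \<bullet> (emb_mat F *\<^sub>v y1) \<in> valuation_ring"
        using * F(1) by (intro scalar_prod_integral emb_mat_mult_integral_vec)
      moreover have "x1 \<bullet> (emb_mat F *\<^sub>v y2) \<in> valuation_ring"
        unfolding w(2) using *(3) \<pi>v[OF w(1)] by (rule scalar_prod_integral)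
      moreover have "x2 \<bullet> (emb_mat F *\<^sub>v y2) = (\<pi> \<cdot>\<^sub>v x2) \<bullet> w"
        unfolding w(2) using c by simp
      then have "x2 \<bullet> (emb_mat F *\<^sub>v y2) \<in> valuation_ring"
        using *(5) w(1) by (auto simp: D_def intro!: scalar_prod_integral)
      moreover have "x \<bullet> (emb_mat F *\<^sub>v y) =
          (x1 \<bullet> (emb_mat F *\<^sub>v y1) + x1 \<bullet> (emb_mat F *\<^sub>v y2)) +
          (x2 \<bullet> (emb_mat F *\<^sub>v y1) + x2 \<bullet> (emb_mat F *\<^sub>v y2))"
        unfolding *(1,2) mult_add_distrib_mat_vec[OF Fc c(2,4)]
        using c by (simp add: add_scalar_prod_distrib[of _ n] scalar_prod_add_distrib[of _ n])
      ultimately show ?thesis by (simp add: valuation_ring_add)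
    qed
  qed blast
  then obtain C where C: "integral_basis n (emb_mat ` \<A>) (emb_mat F) C"
    "M = (*\<^sub>v) C ` integral_vecs n"
    by blast
  have Cc: "C \<in> carrier_mat n n" "det C \<noteq> 0" using C(1) by (auto simp: integral_basis_def)
  \<comment> \<open>Because \<open>M\<close> contains O^n, the inverse of \<open>C\<close> is
    integral and det C has valuation at most 0. Minimality makes it 0, so \<open>C\<close> is
    integral as well and \<open>M\<close> is O^n.\<close>
  have "\<exists>b\<in>integral_vecs n. unit_vec n j = C *\<^sub>v b" if "j < n" for j
    using sub[OF integral_vecs_unit[OF that]] C(2) by auto
  then obtain b where b: "\<And>j. j < n \<Longrightarrow> b j \<in> integral_vecs n \<and> unit_vec n j = C *\<^sub>v b j"
    by metis
  have "\<exists>B\<in>carrier_mat n n. emb_mat B = mat n n (\<lambda>(i, j). b j $ i)"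
    by (rule mat_lift_to_subring[of "mat n n (\<lambda>(i, j). b j $ i)" n n])
      (use b in \<open>auto simp: integral_vecs_def\<close>)
  then obtain B where B: "B \<in> carrier_mat n n" "emb_mat B = mat n n (\<lambda>(i, j). b j $ i)" by auto
  have CB: "C * emb_mat B = 1\<^sub>m n"
  proof (rule mat_col_eqI)
    fix j assume "j < dim_col (1\<^sub>m n :: 'a mat)"
    then have j: "j < n" by simp
    have "col (C * emb_mat B) j = C *\<^sub>v col (emb_mat B) j"
      using Cc B(1) j by (intro col_mult2) auto
    also have "col (emb_mat B) j = b j"
      using b[OF j] j unfolding B(2) by (intro eq_vecI) (auto simp: integral_vecs_def)
    finally show "col (C * emb_mat B) j = col (1\<^sub>m n) j" using b[OF j] j by simp
  qed (use Cc B in auto)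
  have "det C * of_subring (det B) = 1"
    using det_mult[OF Cc(1), of "emb_mat B"] B(1) CB by simp
  moreover from this have "det B \<noteq> 0" by auto
  ultimately have "val (of_subring (det B)) = - val (det C)" "det B \<noteq> 0"
    using val_mult[of "det C" "of_subring (det B)"] Cc(2) by auto
  then have "det B dvd 1"
    using min[OF C(1)] by (simp add: subring_dvd_iff)
  then obtain B' where B': "B' \<in> carrier_mat n n" "B * B' = 1\<^sub>m n"
    using mat_inverse_if_det_unit[OF B(1)] by metis
  have "emb_mat B * emb_mat B' = 1\<^sub>m n"
    unfolding of_subring.mat_hom_mult[OF B(1) B'(1), symmetric] B'(2) by (rule of_subring.mat_hom_one)
  then have "C = C * (emb_mat B * emb_mat B')" using Cc(1) by simp
  also have "\<dots> = emb_mat B'"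
    using assoc_mult_mat[OF Cc(1), of "emb_mat B" n "emb_mat B'" n] B(1) B'(1) CB by simp
  finally have CB': "C = emb_mat B'" .
  have "y \<in> D" using y w by (auto simp: D_def \<pi>_def)
  then have "y \<in> M"
    using integral_vecs_0[of n] y(1) unfolding M_def
    by (intro CollectI exI[of _ "0\<^sub>v n"] exI[of _ y]) simp
  then obtain c where "c \<in> integral_vecs n" "y = C *\<^sub>v c" using C(2) by auto
  then show ?thesis using emb_mat_mult_integral_vec[OF B'(1)] CB' by simp
qed

text \<open>The sign \<open>s\<close> lets one argument serve symmetric forms (s = 1) and
  skew-symmetric forms (s = -1).\<close>

locale isometric_matrix_rep = group G for G (structure) +
  fixes n :: nat and R :: "'a \<Rightarrow> 'b::discrete_valuation_field mat" and J :: "'b mat" and s :: int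
  assumes finite_carrier: "finite (carrier G)"
    and R_carrier: "g \<in> carrier G \<Longrightarrow> R g \<in> carrier_mat n n"
    and R_one: "R \<one> = 1\<^sub>m n"
    and R_mult: "g \<in> carrier G \<Longrightarrow> h \<in> carrier G \<Longrightarrow> R (g \<otimes> h) = R g * R h"
    and J_carrier: "J \<in> carrier_mat n n" and J_det: "det J \<noteq> 0"
    and s_square: "s * s = 1"
    and J_transpose: "J\<^sup>T = of_int s \<cdot>\<^sub>m J"
    and R_isometry: "g \<in> carrier G \<Longrightarrow> (R g)\<^sup>T * (J * R g) = J"
begin

text \<open>
  The lattice \<open>T\<close> is spanned by the columns of \<open>P\<close>. That \<open>X = \<pi> F\<inverse>\<close> is integral means that its
  dual satisfies \<open>\<pi> T\<^sup>* \<subseteq> T\<close>.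
\<close>

lemma almost_selfdual_lattice:
  obtains P A F X where "P \<in> carrier_mat n n" "det P \<noteq> 0"
    "\<And>g. g \<in> carrier G \<Longrightarrow> A g \<in> carrier_mat n n \<and> R g * P = P * emb_mat (A g)"
    "A \<one> = 1\<^sub>m n"
    "\<And>g h. g \<in> carrier G \<Longrightarrow> h \<in> carrier G \<Longrightarrow> A (g \<otimes> h) = A g * A h"
    "F \<in> carrier_mat n n" "P\<^sup>T * (J * P) = emb_mat F" "F\<^sup>T = of_int s \<cdot>\<^sub>m F"
    "\<And>g. g \<in> carrier G \<Longrightarrow> (A g)\<^sup>T * (F * A g) = F"
    "X \<in> carrier_mat n n" "F * X = uniformizer \<cdot>\<^sub>m 1\<^sub>m n" "X * F = uniformizer \<cdot>\<^sub>m 1\<^sub>m n"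
proof -
  let ?R = "R ` carrier G"
  have Rc: "?R \<subseteq> carrier_mat n n" using R_carrier by auto
  obtain P0 where P0: "integral_basis n ?R J P0"
  proof (rule exists_integral_basis[of ?R n J])
    show "1\<^sub>m n \<in> ?R" using R_one one_closed by (metis imageI)
    show "X * Y \<in> ?R" if XY: "X \<in> ?R" "Y \<in> ?R" for X Y
    proof -
      obtain g h where "g \<in> carrier G" "h \<in> carrier G" "X = R g" "Y = R h" using XY by auto
      then show ?thesis using R_mult[of g h] by (intro image_eqI[of _ _ "g \<otimes> h"]) auto
    qed
  qed (use finite_carrier Rc J_carrier in auto)
  \<comment> \<open>The integral Gram matrix has determinant (det P)^2 det J, so val (det P) is
    bounded below. A basis with least valuation spans a maximal lattice, since a proper overlattice
    would have a determinant of smaller valuation.\<close>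
  have bound: "- val (det J) \<le> 2 * val (det P)" if P: "integral_basis n ?R J P" for P
  proof -
    obtain F where F: "F \<in> carrier_mat n n" "P\<^sup>T * (J * P) = emb_mat F"
      and Pc: "P \<in> carrier_mat n n" "det P \<noteq> 0"
      using P by (auto simp: integral_basis_def)
    have "det P * (det J * det P) = det (P\<^sup>T * (J * P))"
      using Pc J_carrier by (simp add: det_mult[of _ n] det_transpose[of _ n])
    also have "\<dots> = of_subring (det F)" using F by simp
    finally have "det P * (det J * det P) \<in> valuation_ring" by (metis of_subring_in)
    then show ?thesis using Pc(2) J_det by (simp add: valuation_ring_def val_mult)
  qed
  define m where "m P = nat (2 * val (det P) + val (det J))" for P :: "'b mat"
  obtain P where P: "integral_basis n ?R J P" "\<And>Q. integral_basis n ?R J Q \<Longrightarrow> m P \<le> m Q"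
    using ex_has_least_nat[of "integral_basis n ?R J" P0 m] P0 by blast
  have min: "val (det P) \<le> val (det Q)" if "integral_basis n ?R J Q" for Q
    using P(2)[OF that] bound[OF that] bound[OF P(1)] by (simp add: m_def)
  have Pc: "P \<in> carrier_mat n n" "det P \<noteq> 0" using P(1) by (auto simp: integral_basis_def)
  obtain A' where A': "\<And>X. X \<in> ?R \<Longrightarrow> A' X \<in> carrier_mat n n \<and> X * P = P * emb_mat (A' X)"
    using P(1) unfolding integral_basis_def by metis
  obtain F where F: "F \<in> carrier_mat n n" "P\<^sup>T * (J * P) = emb_mat F"
    using P(1) by (auto simp: integral_basis_def)
  obtain Q where Q: "Q \<in> carrier_mat n n" "P * Q = 1\<^sub>m n" "Q * P = 1\<^sub>m n"
    using mat_inverse_if_det_unit[OF Pc(1)] Pc(2) by (metis dvd_field_iff one_neq_zero)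
  have cancel: "X = Y" if "P * emb_mat X = P * emb_mat Y" "X \<in> carrier_mat n n" "Y \<in> carrier_mat n n"
    for X Y
  proof -
    have "emb_mat Z = Q * (P * emb_mat Z)" if "Z \<in> carrier_mat n n" for Z
      using that Q Pc(1) by (simp add: assoc_mult_mat[OF Q(1) Pc(1), symmetric, of _ n])
    then have "emb_mat X = emb_mat Y" using that by metis
    then show ?thesis by (rule of_subring.mat_hom_inj)
  qed
  define A where "A g = A' (R g)" for g
  have A: "A g \<in> carrier_mat n n" "R g * P = P * emb_mat (A g)" if "g \<in> carrier G" for g
    using A'[of "R g"] that by (auto simp: A_def)
  have A_one: "A \<one> = 1\<^sub>m n"
  proof (rule cancel)
    show "P * emb_mat (A \<one>) = P * emb_mat (1\<^sub>m n)"
      using A(2)[OF one_closed] Pc(1) by (simp add: R_one of_subring.mat_hom_one)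
  qed (use A in auto)
  have A_mult: "A (g \<otimes> h) = A g * A h" if gh: "g \<in> carrier G" "h \<in> carrier G" for g h
  proof (rule cancel)
    have c: "emb_mat (A g) \<in> carrier_mat n n" "emb_mat (A h) \<in> carrier_mat n n"
      using A gh by auto
    have "P * emb_mat (A (g \<otimes> h)) = R g * (R h * P)"
      using A(2)[of "g \<otimes> h"] gh R_mult[OF gh] R_carrier Pc(1)
      by (simp add: assoc_mult_mat[of _ n n _ n _ n])
    also have "\<dots> = R g * P * emb_mat (A h)"
      unfolding A(2)[OF gh(2)] by (rule assoc_mult_mat[OF R_carrier[OF gh(1)] Pc(1) c(2), symmetric])
    also have "\<dots> = P * emb_mat (A g * A h)"
      using A gh Pc(1) c
      by (simp add: of_subring.mat_hom_mult[of _ n n _ n] assoc_mult_mat[OF Pc(1) c])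
    finally show "P * emb_mat (A (g \<otimes> h)) = P * emb_mat (A g * A h)" .
  qed (use A gh in \<open>auto intro!: mult_carrier_mat[of _ n n]\<close>)
  have F_transpose: "F\<^sup>T = of_int s \<cdot>\<^sub>m F"
  proof (rule of_subring.mat_hom_inj)
    have "emb_mat (F\<^sup>T) = (P\<^sup>T * (J * P))\<^sup>T" unfolding F(2) by (simp add: map_mat_transpose)
    also have "\<dots> = P\<^sup>T * (J\<^sup>T * P)"
      using Pc(1) J_carrier by (simp add: transpose_mult[of _ n n _ n] assoc_mult_mat[of _ n n _ n _ n])
    also have "\<dots> = of_int s \<cdot>\<^sub>m (P\<^sup>T * (J * P))"
      using Pc(1) J_carrier unfolding J_transpose
      by (simp add: mult_smult_assoc_mat[of _ n n _ n] mult_smult_distrib[of _ n n _ n])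
    also have "\<dots> = emb_mat (of_int s \<cdot>\<^sub>m F)"
      unfolding F(2) by (intro eq_matI) (auto simp: of_subring.hom_mult of_subring.hom_of_int)
    finally show "emb_mat (F\<^sup>T) = emb_mat (of_int s \<cdot>\<^sub>m F)" .
  qed
  have F_isometry: "(A g)\<^sup>T * (F * A g) = F" if g: "g \<in> carrier G" for g
  proof (rule of_subring.mat_hom_inj)
    have c: "emb_mat (A g) \<in> carrier_mat n n" "(emb_mat (A g))\<^sup>T \<in> carrier_mat n n"
      "(A g)\<^sup>T \<in> carrier_mat n n" "P\<^sup>T \<in> carrier_mat n n" "R g \<in> carrier_mat n n"
      "(R g)\<^sup>T \<in> carrier_mat n n"
      using A g R_carrier Pc(1) by auto
    have "emb_mat ((A g)\<^sup>T * (F * A g)) = (emb_mat (A g))\<^sup>T * ((P\<^sup>T * (J * P)) * emb_mat (A g))"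
      using A(1)[OF g] F(1) c
      by (simp add: of_subring.mat_hom_mult[of _ n n _ n] F(2) map_mat_transpose)
    also have "\<dots> = (P * emb_mat (A g))\<^sup>T * (J * (P * emb_mat (A g)))"
      using Pc(1) J_carrier c by (simp add: transpose_mult[of _ n n _ n] assoc_mult_mat[of _ n n _ n _ n])
    also have "\<dots> = P\<^sup>T * ((R g)\<^sup>T * (J * R g) * P)"
      unfolding A(2)[OF g, symmetric]
      using Pc(1) J_carrier c by (simp add: transpose_mult[of _ n n _ n] assoc_mult_mat[of _ n n _ n _ n])
    also have "\<dots> = emb_mat F" by (simp add: R_isometry[OF g] F(2))
    finally show "emb_mat ((A g)\<^sup>T * (F * A g)) = emb_mat F" .
  qed
  \<comment> \<open>Here \<open>B\<close> is the contragredient of \<open>A g\<close>, the transpose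
    of \<open>A (inv g)\<close>.\<close>
  have F_comm: "\<exists>B\<in>carrier_mat n n. F * Y = B * F" if Y: "Y \<in> A ` carrier G" for Y
  proof -
    obtain g where g: "g \<in> carrier G" "Y = A g" using Y by auto
    have c: "A g \<in> carrier_mat n n" "A (inv g) \<in> carrier_mat n n" "(A (inv g))\<^sup>T \<in> carrier_mat n n"
      "(A g)\<^sup>T \<in> carrier_mat n n"
      using A g by auto
    have inv: "A g * A (inv g) = 1\<^sub>m n" using A_mult[of g "inv g"] g(1) A_one by simp
    have "(A (inv g))\<^sup>T * F = (A (inv g))\<^sup>T * (A g)\<^sup>T * (F * A g)"
      using F_isometry[OF g(1)] c F(1) by (simp add: assoc_mult_mat[of _ n n _ n _ n])
    also have "(A (inv g))\<^sup>T * (A g)\<^sup>T = 1\<^sub>m n"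
      using inv transpose_mult[OF c(1,2)] by simp
    finally show ?thesis using c F(1) g(2) by (intro bexI[of _ "(A (inv g))\<^sup>T"]) auto
  qed
  have minF: "0 \<le> val (det C)" if C: "integral_basis n (emb_mat ` A ` carrier G) (emb_mat F) C" for C
  proof -
    have "(\<lambda>X. emb_mat (A' X)) ` ?R = emb_mat ` A ` carrier G" by (auto simp: A_def)
    then have "integral_basis n ?R J (P * C)"
      using C integral_basis_comp[OF Pc Rc A' J_carrier F] by simp
    then have "val (det P) \<le> val (det (P * C))" by (rule min)
    moreover have "C \<in> carrier_mat n n" "det C \<noteq> 0" using C by (auto simp: integral_basis_def)
    ultimately show ?thesis using Pc by (simp add: det_mult[OF Pc(1)] val_mult)
  qed
  define \<pi> where "\<pi> = (of_subring uniformizer :: 'b)"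
  have \<pi>: "\<pi> \<noteq> 0" using of_uniformizer by (simp add: \<pi>_def)
  have Fc: "emb_mat F \<in> carrier_mat n n" using F by simp
  \<comment> \<open>\<open>integral_if_minimal\<close> handles denominators \<pi> only. Applied to
    \<pi>^N y, it removes one power of \<pi> from the denominator of y at a time; scaling by \<pi>^N
    preserves the condition on \<open>emb_mat F\<close>.\<close>
  have descent: "y \<in> integral_vecs n"
    if "y \<in> carrier_vec n" "(\<pi> ^ N) \<cdot>\<^sub>v y \<in> integral_vecs n"
      "\<exists>w\<in>integral_vecs n. emb_mat F *\<^sub>v y = \<pi> \<cdot>\<^sub>v w" for N y
    using that
  proof (induction N arbitrary: y)
    case (Suc N)
    let ?y = "(\<pi> ^ N) \<cdot>\<^sub>v y"
    obtain w where w: "w \<in> integral_vecs n" "emb_mat F *\<^sub>v y = \<pi> \<cdot>\<^sub>v w" using Suc.prems(3) by auto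
    have "emb_mat F *\<^sub>v ?y = \<pi> \<cdot>\<^sub>v ((\<pi> ^ N) \<cdot>\<^sub>v w)"
      using w Suc.prems(1) by (simp add: mult_mat_vec[OF Fc] smult_smult_assoc mult.commute)
    moreover have "(\<pi> ^ N) \<cdot>\<^sub>v w \<in> integral_vecs n"
      using integral_vecs_smult[OF _ w(1), of "\<pi> ^ N"]
      by (simp add: \<pi>_def of_subring.hom_power[symmetric])
    moreover have "\<pi> \<cdot>\<^sub>v ?y \<in> integral_vecs n" using Suc.prems(2) by (simp add: smult_smult_assoc)
    ultimately have "?y \<in> integral_vecs n"
      using Suc.prems(1)
      by (intro integral_if_minimal[of F n s "A ` carrier G" ?y "(\<pi> ^ N) \<cdot>\<^sub>v w"]
          F(1) F_transpose F_comm minF) (auto simp: \<pi>_def A(1))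
    then show ?case using Suc.IH[of y] Suc.prems by simp
  qed simp
  have detF: "det (emb_mat F) \<noteq> 0"
    unfolding F(2)[symmetric] using Pc J_carrier J_det by (simp add: det_mult[of _ n] det_transpose[of _ n])
  then obtain H where H: "H \<in> carrier_mat n n" "emb_mat F * H = 1\<^sub>m n" "H * emb_mat F = 1\<^sub>m n"
    using mat_inverse_if_det_unit[OF Fc] by (metis dvd_field_iff one_neq_zero)
  \<comment> \<open>The columns of \<pi> F^-1 are a basis of \<open>\<pi> T\<^sup>*\<close>, so
    \<open>descent\<close> applies to each of them.\<close>
  define Y where "Y = \<pi> \<cdot>\<^sub>m H"
  have Y: "Y \<in> carrier_mat n n" "emb_mat F * Y = \<pi> \<cdot>\<^sub>m 1\<^sub>m n" "Y * emb_mat F = \<pi> \<cdot>\<^sub>m 1\<^sub>m n"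
    using H mult_smult_distrib[OF Fc H(1)] mult_smult_assoc_mat[OF H(1) Fc] by (auto simp: Y_def)
  obtain N where N: "\<And>X i j m. X \<in> {Y} \<Longrightarrow> i < n \<Longrightarrow> j < n \<Longrightarrow> N \<le> m \<Longrightarrow>
    of_subring (uniformizer ^ m) * X $$ (i, j) \<in> valuation_ring"
    using mat_entries_common_denominator[of "{Y}" n] Y(1) by auto
  have "col Y j \<in> integral_vecs n" if j: "j < n" for j
  proof (rule descent)
    show "col Y j \<in> carrier_vec n" using Y(1) j by auto
    show "(\<pi> ^ N) \<cdot>\<^sub>v col Y j \<in> integral_vecs n"
      using N[of Y _ j N] Y(1) j by (auto simp: integral_vecs_def \<pi>_def of_subring.hom_power)
    have "emb_mat F *\<^sub>v col Y j = col (\<pi> \<cdot>\<^sub>m 1\<^sub>m n) j"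
      using col_mult2[OF Fc Y(1) j] Y(2) by simp
    also have "\<dots> = \<pi> \<cdot>\<^sub>v unit_vec n j" using j by (intro eq_vecI) auto
    finally show "\<exists>w\<in>integral_vecs n. emb_mat F *\<^sub>v col Y j = \<pi> \<cdot>\<^sub>v w"
      using integral_vecs_unit[OF j] by auto
  qed
  then have "Y $$ (i, j) \<in> valuation_ring" if "i < n" "j < n" for i j
    using that Y(1) by (fastforce simp: integral_vecs_def)
  then obtain X where X: "X \<in> carrier_mat n n" "emb_mat X = Y"
    using mat_lift_to_subring[OF Y(1)] by metis
  have emb_\<pi>: "\<pi> \<cdot>\<^sub>m 1\<^sub>m n = emb_mat (uniformizer \<cdot>\<^sub>m 1\<^sub>m n)"
    by (intro eq_matI) (auto simp: \<pi>_def)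
  have "emb_mat (F * X) = emb_mat (uniformizer \<cdot>\<^sub>m 1\<^sub>m n)"
    "emb_mat (X * F) = emb_mat (uniformizer \<cdot>\<^sub>m 1\<^sub>m n)"
    using of_subring.mat_hom_mult[OF F(1) X(1)] of_subring.mat_hom_mult[OF X(1) F(1)] X(2) Y(2,3) emb_\<pi>
    by simp_all
  then have "F * X = uniformizer \<cdot>\<^sub>m 1\<^sub>m n" "X * F = uniformizer \<cdot>\<^sub>m 1\<^sub>m n"
    by (auto dest: of_subring.mat_hom_inj)
  then show thesis
    using that[of P A F X] Pc A A_one A_mult F F_transpose F_isometry X(1) by blast
qed

end

section \<open>Reduction of an isometric representation\<close>

text \<open>
  Choosing an invertible \<open>Q\<close> such that as few as possible columns of \<open>F Q\<close> are nonzero: a kernel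
  vector of the remaining block could be exchanged for a basis vector, leaving one column less.
\<close>

lemma radical_complement:
  fixes F :: "'a::field mat"
  assumes F: "F \<in> carrier_mat n n" "F\<^sup>T = c \<cdot>\<^sub>m F"
  obtains Q r A where "Q \<in> carrier_mat n n" "det Q \<noteq> 0" "r \<le> n" "A \<in> carrier_mat r r" "det A \<noteq> 0"
    "Q\<^sup>T * (F * Q) = four_block_mat A (0\<^sub>m r (n - r)) (0\<^sub>m (n - r) r) (0\<^sub>m (n - r) (n - r))"
proof -
  define good where "good r \<longleftrightarrow> r \<le> n \<and> (\<exists>Q\<in>carrier_mat n n. det Q \<noteq> 0 \<and>
    (\<forall>j. r \<le> j \<longrightarrow> j < n \<longrightarrow> F *\<^sub>v col Q j = 0\<^sub>v n))" for r
  have "good n" by (auto simp: good_def intro!: bexI[of _ "1\<^sub>m n"])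
  then obtain r where r: "good r" "\<And>k. k < r \<Longrightarrow> \<not> good k"
    using exists_least_iff[of good] by blast
  then obtain Q where Q: "Q \<in> carrier_mat n n" "det Q \<noteq> 0"
    "\<And>j. r \<le> j \<Longrightarrow> j < n \<Longrightarrow> F *\<^sub>v col Q j = 0\<^sub>v n" and rn: "r \<le> n"
    by (auto simp: good_def)
  define M where "M = Q\<^sup>T * (F * Q)"
  have QT: "Q\<^sup>T \<in> carrier_mat n n" and FQ: "F * Q \<in> carrier_mat n n" using Q(1) F(1) by auto
  have M: "M \<in> carrier_mat n n" using QT FQ by (simp add: M_def)
  have "M\<^sup>T = c \<cdot>\<^sub>m M"
    using F Q(1) QT
    by (simp add: M_def transpose_mult[of _ n n _ n] assoc_mult_mat[of _ n n _ n _ n]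
        mult_smult_assoc_mat[of _ n n _ n] mult_smult_distrib[of _ n n _ n])
  then have MT: "M $$ (j, i) = c * M $$ (i, j)" if "i < n" "j < n" for i j
    using that M by (metis carrier_matD index_smult_mat(1) index_transpose_mat(1))
  have col0: "M $$ (i, j) = 0" if "i < n" "r \<le> j" "j < n" for i j
  proof -
    have "M $$ (i, j) = col M j $ i" using M that by simp
    also have "col M j = Q\<^sup>T *\<^sub>v (F *\<^sub>v col Q j)"
      unfolding M_def col_mult2[OF QT FQ that(3)] col_mult2[OF F(1) Q(1) that(3)] ..
    also have "\<dots> $ i = 0" using Q(1,3) that by simp
    finally show ?thesis .
  qed
  have row0: "M $$ (i, j) = 0" if "r \<le> i" "i < n" "j < n" for i j
    using MT[of j i] col0[of j i] that by simp
  define A where "A = mat r r (\<lambda>(i, j). M $$ (i, j))"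
  have "det A \<noteq> 0"
  proof
    assume "det A = 0"
    then obtain v where v: "v \<in> carrier_vec r" "v \<noteq> 0\<^sub>v r" "A *\<^sub>v v = 0\<^sub>v r"
      using det_0_iff_vec_prod_zero_field[of A r] by (auto simp: A_def)
    then obtain k where k: "k < r" "v $ k \<noteq> 0" by (metis eq_vecI carrier_vecD index_zero_vec)
    define v' where "v' = vec n (\<lambda>i. if i < r then v $ i else 0)"
    have v': "v' \<in> carrier_vec n" by (simp add: v'_def)
    have "M *\<^sub>v v' = 0\<^sub>v n"
    proof (rule eq_vecI)
      fix i assume "i < dim_vec (0\<^sub>v n :: 'a vec)"
      then have i: "i < n" by simp
      have "(M *\<^sub>v v') $ i = (\<Sum>j\<in>{0..<n}. M $$ (i, j) * v' $ j)"
        using M v' i by (simp add: scalar_prod_def)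
      also have "\<dots> = (\<Sum>j\<in>{0..<r}. M $$ (i, j) * v $ j)"
        using rn by (intro sum.mono_neutral_cong_right) (auto simp: v'_def)
      also have "\<dots> = 0"
      proof (cases "i < r")
        case True
        then have "(A *\<^sub>v v) $ i = (\<Sum>j\<in>{0..<r}. M $$ (i, j) * v $ j)"
          using v(1) by (simp add: scalar_prod_def A_def)
        then show ?thesis using v(3) True by simp
      next
        case False
        then show ?thesis using row0[of i] i rn by simp
      qed
      finally show "(M *\<^sub>v v') $ i = 0\<^sub>v n $ i" using i by simp
    qed (use M in auto)
    define w where "w = Q *\<^sub>v v'"
    have w: "w \<in> carrier_vec n" using Q(1) v' by (simp add: w_def)
    have Fw: "F *\<^sub>v w = 0\<^sub>v n"
    proof -
      have "Q\<^sup>T *\<^sub>v (F *\<^sub>v w) = 0\<^sub>v n"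
        using \<open>M *\<^sub>v v' = 0\<^sub>v n\<close> unfolding M_def assoc_mult_mat_vec[OF QT FQ v']
          assoc_mult_mat_vec[OF F(1) Q(1) v'] w_def .
      moreover have "det (Q\<^sup>T) \<noteq> 0" using Q by (simp add: det_transpose)
      moreover have "F *\<^sub>v w \<in> carrier_vec n" using F(1) w by (rule mult_mat_vec_carrier)
      ultimately show ?thesis using det_0_iff_vec_prod_zero_field[OF QT] by auto
    qed
    \<comment> \<open>By Cramer's rule this exchange multiplies the determinant by the k-th entry of
      v, which was chosen nonzero.\<close>
    define Q1 where "Q1 = replace_col Q w k"
    have Q1: "Q1 \<in> carrier_mat n n" using Q(1) by (simp add: Q1_def replace_col_def)
    have "det Q1 = v' $ k * det Q"
      using cramer_lemma_mat[OF Q(1) v'] k rn by (simp add: Q1_def w_def)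
    then have Q1d: "det Q1 \<noteq> 0" using k rn Q(2) by (simp add: v'_def)
    \<comment> \<open>The new null column moves to position r - 1, next to the old ones, so that r -
      1 becomes good.\<close>
    define Q2 where "Q2 = (if k = r - 1 then Q1 else swapcols k (r - 1) Q1)"
    have Q2: "Q2 \<in> carrier_mat n n" "det Q2 \<noteq> 0"
      using Q1 Q1d k rn det_swapcols[OF _ _ _ Q1, of k "r - 1"] by (auto simp: Q2_def mat_swapcols_def)
    have "F *\<^sub>v col Q2 j = 0\<^sub>v n" if j: "r - 1 \<le> j" "j < n" for j
    proof (cases "j = r - 1")
      case True
      then have "col Q2 j = w"
        using j Q(1) w k rn
        by (intro eq_vecI) (auto simp: Q2_def mat_swapcols_def Q1_def replace_col_def)
      then show ?thesis using Fw by simp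
    next
      case False
      then have "col Q2 j = col Q j"
        using j Q(1) w k rn
        by (intro eq_vecI) (auto simp: Q2_def mat_swapcols_def Q1_def replace_col_def)
      then show ?thesis using Q(3)[of j] False j by simp
    qed
    then have "good (r - 1)" using Q2 rn by (auto simp: good_def)
    then show False using r(2)[of "r - 1"] k by simp
  qed
  moreover have "M = four_block_mat A (0\<^sub>m r (n - r)) (0\<^sub>m (n - r) r) (0\<^sub>m (n - r) (n - r))"
    using M rn col0 row0 by (intro eq_matI) (auto simp: A_def)
  moreover have "A \<in> carrier_mat r r" by (simp add: A_def)
  ultimately show thesis using that[of Q r A] Q(1,2) rn unfolding M_def by blast
qed

text \<open>An invertible matrix over k that splits off the radical of the reduced form lifts
  entrywise to the valuation ring, and the lift is invertible because a determinant with nonzero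
  residue is a unit. It changes the basis but not the lattice, so \<pi> F^-1 stays integral.\<close>

lemma (in isometric_matrix_rep) adapted_lattice:
  obtains P A F X r F1 where "P \<in> carrier_mat n n" "det P \<noteq> 0"
    "\<And>g. g \<in> carrier G \<Longrightarrow> A g \<in> carrier_mat n n \<and> R g * P = P * emb_mat (A g)"
    "A \<one> = 1\<^sub>m n"
    "\<And>g h. g \<in> carrier G \<Longrightarrow> h \<in> carrier G \<Longrightarrow> A (g \<otimes> h) = A g * A h"
    "F \<in> carrier_mat n n" "F\<^sup>T = of_int s \<cdot>\<^sub>m F"
    "\<And>g. g \<in> carrier G \<Longrightarrow> (A g)\<^sup>T * (F * A g) = F"
    "X \<in> carrier_mat n n" "F * X = uniformizer \<cdot>\<^sub>m 1\<^sub>m n" "X * F = uniformizer \<cdot>\<^sub>m 1\<^sub>m n"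
    "r \<le> n" "F1 \<in> carrier_mat r r" "det F1 \<noteq> 0"
    "map_mat residue F = four_block_mat F1 (0\<^sub>m r (n - r)) (0\<^sub>m (n - r) r) (0\<^sub>m (n - r) (n - r))"
proof -
  obtain P A F X where P: "P \<in> carrier_mat n n" "det P \<noteq> 0"
    and A: "\<And>g. g \<in> carrier G \<Longrightarrow> A g \<in> carrier_mat n n \<and> R g * P = P * emb_mat (A g)"
    and A1: "A \<one> = 1\<^sub>m n"
    and Amult: "\<And>g h. g \<in> carrier G \<Longrightarrow> h \<in> carrier G \<Longrightarrow> A (g \<otimes> h) = A g * A h"
    and F: "F \<in> carrier_mat n n" "P\<^sup>T * (J * P) = emb_mat F" "F\<^sup>T = of_int s \<cdot>\<^sub>m F"
    and iso: "\<And>g. g \<in> carrier G \<Longrightarrow> (A g)\<^sup>T * (F * A g) = F"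
    and X: "X \<in> carrier_mat n n" "F * X = uniformizer \<cdot>\<^sub>m 1\<^sub>m n" "X * F = uniformizer \<cdot>\<^sub>m 1\<^sub>m n"
    by (rule almost_selfdual_lattice) blast
  have "(map_mat residue F)\<^sup>T = of_int s \<cdot>\<^sub>m map_mat residue F"
    unfolding map_mat_transpose F(3)
    by (intro eq_matI) (auto simp: residue.hom_mult residue.hom_of_int)
  then obtain Qr r F1 where Qr: "Qr \<in> carrier_mat n n" "det Qr \<noteq> 0" and r: "r \<le> n"
    and F1: "F1 \<in> carrier_mat r r" "det F1 \<noteq> 0"
    "Qr\<^sup>T * (map_mat residue F * Qr) =
      four_block_mat F1 (0\<^sub>m r (n - r)) (0\<^sub>m (n - r) r) (0\<^sub>m (n - r) (n - r))"
    using radical_complement[of "map_mat residue F" n "of_int s"] F(1) by (metis map_carrier_mat)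
  define Q where "Q = map_mat (\<lambda>a. SOME x. residue x = a) Qr"
  have "residue (SOME x. residue x = a) = a" for a :: "'b residue_field"
    by (rule someI_ex) (rule residue_surj)
  then have Q: "Q \<in> carrier_mat n n" "map_mat residue Q = Qr"
    using Qr(1) by (auto simp: Q_def intro!: eq_matI)
  have "det Q dvd 1"
    using Qr(2) residue.hom_det[of Q] Q(2) by (simp add: subring_unit_iff)
  then obtain Q' where Q': "Q' \<in> carrier_mat n n" "Q * Q' = 1\<^sub>m n" "Q' * Q = 1\<^sub>m n"
    using mat_inverse_if_det_unit[OF Q(1)] by metis
  have T: "Q\<^sup>T \<in> carrier_mat n n" "Q'\<^sup>T \<in> carrier_mat n n" using Q(1) Q'(1) by auto
  have TT: "Q'\<^sup>T * Q\<^sup>T = 1\<^sub>m n" "Q\<^sup>T * Q'\<^sup>T = 1\<^sub>m n"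
    unfolding transpose_mult[OF Q(1) Q'(1), symmetric] transpose_mult[OF Q'(1) Q(1), symmetric] Q'(2,3)
    by simp_all
  have cancel: "Q * (Q' * Z) = Z" "Q' * (Q * Z) = Z" "Q'\<^sup>T * (Q\<^sup>T * Z) = Z" "Q\<^sup>T * (Q'\<^sup>T * Z) = Z"
    if "Z \<in> carrier_mat n n" for Z
    unfolding assoc_mult_mat[OF Q(1) Q'(1) that, symmetric] assoc_mult_mat[OF Q'(1) Q(1) that, symmetric]
      assoc_mult_mat[OF T(2,1) that, symmetric] assoc_mult_mat[OF T that, symmetric] Q'(2,3) TT
    using that by simp_all
  define A' where "A' g = Q' * (A g * Q)" for g
  define F' where "F' = Q\<^sup>T * (F * Q)"
  \<comment> \<open>\<open>X\<close> transforms like the inverse of a Gram matrix, so that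
    \<open>X'\<close> is \<pi> times the inverse of \<open>F'\<close>.\<close>
  define X' where "X' = Q' * (X * Q'\<^sup>T)"
  define P' where "P' = P * emb_mat Q"
  note assoc = assoc_mult_mat[of _ n n _ n _ n]
  note c = Q(1) Q'(1) T F(1) X(1) P(1)
  have A'c: "A' g \<in> carrier_mat n n" if "g \<in> carrier G" for g
    using A[OF that] Q(1) Q'(1) by (auto simp: A'_def)
  show thesis
  proof (rule that[of P' A' F' X' r F1])
    show "P' \<in> carrier_mat n n" using c by (simp add: P'_def)
    have "det Q \<noteq> 0" using \<open>det Q dvd 1\<close> by auto
    then show "det P' \<noteq> 0" using P Q(1) by (simp add: P'_def det_mult[of _ n])
    show "A' g \<in> carrier_mat n n \<and> R g * P' = P' * emb_mat (A' g)" if g: "g \<in> carrier G" for g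
    proof
      have Ag: "A g \<in> carrier_mat n n" "emb_mat (A g) \<in> carrier_mat n n" using A[OF g] by auto
      have "R g * P' = R g * P * emb_mat Q"
        unfolding P'_def using R_carrier[OF g] P(1) Q(1) by (intro assoc[symmetric]) auto
      also have "\<dots> = P * emb_mat (A g * Q)"
        using A[OF g] P(1) Q(1) Ag by (simp add: of_subring.mat_hom_mult[of _ n n _ n] assoc)
      also have "A g * Q = Q * A' g" using Ag c by (simp add: A'_def cancel)
      also have "P * emb_mat (Q * A' g) = P' * emb_mat (A' g)"
        using A'c[OF g] P(1) Q(1) by (simp add: P'_def of_subring.mat_hom_mult[of _ n n _ n] assoc)
      finally show "R g * P' = P' * emb_mat (A' g)" .
    qed (rule A'c[OF g])
    show "A' \<one> = 1\<^sub>m n" using Q Q' by (simp add: A'_def A1)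
    show "A' (g \<otimes> h) = A' g * A' h" if "g \<in> carrier G" "h \<in> carrier G" for g h
    proof -
      have Agh: "A g \<in> carrier_mat n n" "A h \<in> carrier_mat n n" "A g * Q \<in> carrier_mat n n"
        "A h * Q \<in> carrier_mat n n"
        using A[OF that(1)] A[OF that(2)] Q(1) by auto
      have "A' g * A' h = Q' * (A g * (Q * (Q' * (A h * Q))))"
        using Agh c by (simp add: A'_def assoc)
      then show ?thesis using Agh c by (simp add: A'_def Amult[OF that] assoc cancel)
    qed
    show "F' \<in> carrier_mat n n" "X' \<in> carrier_mat n n" using c by (auto simp: F'_def X'_def)
    show "F'\<^sup>T = of_int s \<cdot>\<^sub>m F'"
      using c F(3)
      by (simp add: F'_def transpose_mult[of _ n n _ n] assoc
          mult_smult_assoc_mat[of _ n n _ n] mult_smult_distrib[of _ n n _ n])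
    show "(A' g)\<^sup>T * (F' * A' g) = F'" if g: "g \<in> carrier G" for g
    proof -
      have Ag: "A g \<in> carrier_mat n n" "(A g)\<^sup>T \<in> carrier_mat n n" using A[OF g] by auto
      have "(A' g)\<^sup>T * (F' * A' g) = Q\<^sup>T * ((A g)\<^sup>T * (F * A g) * Q)"
        using Ag c by (simp add: A'_def F'_def transpose_mult[of _ n n _ n] assoc cancel)
      then show ?thesis by (simp add: iso[OF g] F'_def)
    qed
    have "F' * X' = Q\<^sup>T * (F * X * Q'\<^sup>T)" using c by (simp add: F'_def X'_def assoc cancel)
    also have "\<dots> = uniformizer \<cdot>\<^sub>m 1\<^sub>m n"
      using c TT by (simp add: X(2) mult_smult_assoc_mat[of _ n n _ n] mult_smult_distrib[of _ n n _ n])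
    finally show "F' * X' = uniformizer \<cdot>\<^sub>m 1\<^sub>m n" .
    have "X' * F' = Q' * (X * F * Q)" using c by (simp add: F'_def X'_def assoc cancel)
    also have "\<dots> = uniformizer \<cdot>\<^sub>m 1\<^sub>m n"
      using c Q'(3) by (simp add: X(3) mult_smult_assoc_mat[of _ n n _ n] mult_smult_distrib[of _ n n _ n])
    finally show "X' * F' = uniformizer \<cdot>\<^sub>m 1\<^sub>m n" .
    show "map_mat residue F' = four_block_mat F1 (0\<^sub>m r (n - r)) (0\<^sub>m (n - r) r) (0\<^sub>m (n - r) (n - r))"
      unfolding F1(3)[symmetric] using c
      by (simp add: F'_def residue.mat_hom_mult[of _ n n _ n] Q(2)[symmetric] map_mat_transpose)
  qed (use r F1 in auto)
qed

section \<open>Block matrices\<close>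

lemma four_block_decomposition:
  assumes "M \<in> carrier_mat (r + m) (r + m)"
  obtains A B C D where "A \<in> carrier_mat r r" "B \<in> carrier_mat r m" "C \<in> carrier_mat m r"
    "D \<in> carrier_mat m m" "M = four_block_mat A B C D"
proof -
  obtain A B C D where s: "split_block M r r = (A, B, C, D)" by (metis prod_cases4)
  show thesis using that split_block[OF s, of m m] assms by auto
qed

lemma four_block_mat_inject:
  assumes "A \<in> carrier_mat r r" "B \<in> carrier_mat r m" "C \<in> carrier_mat m r" "D \<in> carrier_mat m m"
    and "A' \<in> carrier_mat r r" "B' \<in> carrier_mat r m" "C' \<in> carrier_mat m r" "D' \<in> carrier_mat m m"
    and eq: "four_block_mat A B C D = four_block_mat A' B' C' D'"
  shows "A = A'" "B = B'" "C = C'" "D = D'"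
proof -
  have e: "four_block_mat A B C D $$ (i, j) = four_block_mat A' B' C' D' $$ (i, j)" for i j
    by (simp add: eq)
  have "A $$ (i, j) = A' $$ (i, j)" if "i < r" "j < r" for i j
    using e[of i j] that assms(1-8) by simp
  then show "A = A'" using assms(1,5) by (intro eq_matI) auto
  have "B $$ (i, j) = B' $$ (i, j)" if "i < r" "j < m" for i j
    using e[of i "j + r"] that assms(1-8) by simp
  then show "B = B'" using assms(2,6) by (intro eq_matI) auto
  have "C $$ (i, j) = C' $$ (i, j)" if "i < m" "j < r" for i j
    using e[of "i + r" j] that assms(1-8) by simp
  then show "C = C'" using assms(3,7) by (intro eq_matI) auto
  have "D $$ (i, j) = D' $$ (i, j)" if "i < m" "j < m" for i j
    using e[of "i + r" "j + r"] that assms(1-8) by simp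
  then show "D = D'" using assms(4,8) by (intro eq_matI) auto
qed

lemma mat_mult_eq_0_left:
  fixes M :: "'a::field mat"
  assumes M: "M \<in> carrier_mat r r" "det M \<noteq> 0" and N: "N \<in> carrier_mat r m" "M * N = 0\<^sub>m r m"
  shows "N = 0\<^sub>m r m"
proof -
  obtain H where H: "H \<in> carrier_mat r r" "H * M = 1\<^sub>m r"
    using mat_inverse_if_det_unit[OF M(1)] M(2) by (metis dvd_field_iff one_neq_zero)
  have "H * (M * N) = N"
    using H M(1) N(1) by (simp add: assoc_mult_mat[symmetric, of _ r r _ r _ m])
  then show ?thesis using N(2) H(1) by simp
qed

lemma smult_mat_cancel:
  fixes M N :: "'a::idom mat"
  assumes "c \<noteq> 0" "c \<cdot>\<^sub>m M = c \<cdot>\<^sub>m N" "M \<in> carrier_mat r m" "N \<in> carrier_mat r m"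
  shows "M = N"
proof (rule eq_matI)
  fix i j assume "i < dim_row N" "j < dim_col N"
  then have "c * M $$ (i, j) = c * N $$ (i, j)"
    using assms by (metis carrier_matD index_smult_mat(1))
  then show "M $$ (i, j) = N $$ (i, j)" using assms(1) by simp
qed (use assms in auto)

text \<open>Since the lower left block leaves no trace here, a block triangular action may be
  replaced by its diagonal blocks.\<close>

lemma char_poly_four_block_lower:
  fixes A :: "'a::field mat"
  assumes c: "A \<in> carrier_mat r r" "C \<in> carrier_mat m r" "D \<in> carrier_mat m m"
  shows "char_poly (four_block_mat A (0\<^sub>m r m) C D) = char_poly A * char_poly D"
proof -
  have "char_poly_matrix (four_block_mat A (0\<^sub>m r m) C D) =
      four_block_mat (char_poly_matrix A) (0\<^sub>m r m) (map_mat (\<lambda>x. [:- x:]) C) (char_poly_matrix D)"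
    using c by (intro eq_matI) (auto simp: char_poly_matrix_def)
  then show ?thesis
    using c unfolding char_poly_def
    by (simp add: det_four_block_mat_upper_right_zero[of _ r _ m])
qed

context isometric_matrix_rep
begin

lemma of_int_s_smult: "of_int s \<cdot>\<^sub>m (of_int s \<cdot>\<^sub>m M) = (M :: 'd::comm_ring_1 mat)"
proof -
  have "of_int s * of_int s = (1 :: 'd)"
    using s_square by (metis of_int_1 of_int_mult)
  then show ?thesis by (intro eq_matI) (simp_all add: mult.assoc[symmetric])
qed

text \<open>Modulo \<pi> the last n - r basis vectors span the radical
  \<open>\<pi> T\<^sup>* / \<pi> T\<close>. Isometries preserve it, so the reduction of
  \<open>A g\<close> is block lower triangular, with diagonal blocks acting on
  \<open>T / \<pi> T\<^sup>*\<close> and on the radical. \<open>\<rho> g\<close> consists of these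
  two blocks, and the form is the orthogonal sum of the reductions of f and of f / \<pi>. The last
  clause records what is lost with the lower left block.\<close>

lemma reduced_rep:
  obtains P A \<rho> F where "P \<in> carrier_mat n n" "det P \<noteq> 0"
    "\<And>g. g \<in> carrier G \<Longrightarrow> A g \<in> carrier_mat n n \<and> R g * P = P * emb_mat (A g)"
    "A \<one> = 1\<^sub>m n"
    "\<And>g h. g \<in> carrier G \<Longrightarrow> h \<in> carrier G \<Longrightarrow> A (g \<otimes> h) = A g * A h"
    "F \<in> carrier_mat n n" "det F \<noteq> 0" "F\<^sup>T = of_int s \<cdot>\<^sub>m F"
    "\<And>g. g \<in> carrier G \<Longrightarrow> \<rho> g \<in> carrier_mat n n \<and> (\<rho> g)\<^sup>T * (F * \<rho> g) = F"
    "\<And>g h. g \<in> carrier G \<Longrightarrow> h \<in> carrier G \<Longrightarrow> \<rho> (g \<otimes> h) = \<rho> g * \<rho> h"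
    "\<And>g. g \<in> carrier G \<Longrightarrow> char_poly (\<rho> g) = map_poly residue (char_poly (A g))"
    "\<rho> \<one> = 1\<^sub>m n"
    "\<And>g. g \<in> carrier G \<Longrightarrow> \<rho> g = 1\<^sub>m n \<Longrightarrow>
      map_mat residue ((A g - 1\<^sub>m n) * (A g - 1\<^sub>m n)) = 0\<^sub>m n n"
proof -
  obtain P A F X r F1 where P: "P \<in> carrier_mat n n" "det P \<noteq> 0"
    and A: "\<And>g. g \<in> carrier G \<Longrightarrow> A g \<in> carrier_mat n n \<and> R g * P = P * emb_mat (A g)"
    and A1: "A \<one> = 1\<^sub>m n"
    and Amult: "\<And>g h. g \<in> carrier G \<Longrightarrow> h \<in> carrier G \<Longrightarrow> A (g \<otimes> h) = A g * A h"
    and F: "F \<in> carrier_mat n n" "F\<^sup>T = of_int s \<cdot>\<^sub>m F"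
    and iso: "\<And>g. g \<in> carrier G \<Longrightarrow> (A g)\<^sup>T * (F * A g) = F"
    and X: "X \<in> carrier_mat n n" "F * X = uniformizer \<cdot>\<^sub>m 1\<^sub>m n" "X * F = uniformizer \<cdot>\<^sub>m 1\<^sub>m n"
    and r: "r \<le> n" and F1: "F1 \<in> carrier_mat r r" "det F1 \<noteq> 0"
    "map_mat residue F = four_block_mat F1 (0\<^sub>m r (n - r)) (0\<^sub>m (n - r) r) (0\<^sub>m (n - r) (n - r))"
    by (rule adapted_lattice) blast
  define m where "m = n - r"
  have n: "n = r + m" using r by (simp add: m_def)
  define \<pi> where "\<pi> = (uniformizer :: 'b valuation_subring)"
  have \<pi>: "\<pi> \<noteq> 0" "residue \<pi> = 0" by (auto simp: \<pi>_def residue_eq_0_iff)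
  have XT: "X\<^sup>T = of_int s \<cdot>\<^sub>m X"
  proof -
    have T: "X\<^sup>T \<in> carrier_mat n n" "F\<^sup>T \<in> carrier_mat n n" using X F by auto
    have "X\<^sup>T * F\<^sup>T = (\<pi> \<cdot>\<^sub>m 1\<^sub>m n)\<^sup>T"
      using transpose_mult[OF F(1) X(1)] by (simp add: X(2) \<pi>_def)
    also have "\<dots> = \<pi> \<cdot>\<^sub>m 1\<^sub>m n" by (intro eq_matI) auto
    finally have "X\<^sup>T * F\<^sup>T * X = \<pi> \<cdot>\<^sub>m 1\<^sub>m n * X" by simp
    also have "\<dots> = \<pi> \<cdot>\<^sub>m X" using X(1) by (simp add: mult_smult_assoc_mat[of _ n n _ n])
    finally have "\<pi> \<cdot>\<^sub>m X = X\<^sup>T * (F\<^sup>T * X)"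
      using T X(1) by (simp add: assoc_mult_mat[of _ n n _ n _ n])
    also have "\<dots> = \<pi> \<cdot>\<^sub>m (of_int s \<cdot>\<^sub>m X\<^sup>T)"
      using T X(1) F(1) unfolding F(2)
      by (intro eq_matI)
        (simp_all add: mult_smult_assoc_mat[of _ n n _ n] X(2) mult_smult_distrib[of _ n n _ n]
          \<pi>_def[symmetric] mult.left_commute)
    finally have "X = of_int s \<cdot>\<^sub>m X\<^sup>T"
      by (rule smult_mat_cancel[OF \<pi>(1), of _ _ n n]) (use X(1) in auto)
    then have "of_int s \<cdot>\<^sub>m X = of_int s \<cdot>\<^sub>m (of_int s \<cdot>\<^sub>m X\<^sup>T)" by (rule arg_cong)
    then show ?thesis unfolding of_int_s_smult ..
  qed
  \<comment> \<open>F X = \<pi> transports the invariance of \<open>F\<close> to the dual form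
    \<open>X\<close>; the factor \<pi> is cancelled at the end.\<close>
  have X_iso: "A g * (X * (A g)\<^sup>T) = X" if g: "g \<in> carrier G" for g
  proof -
    have c: "A g \<in> carrier_mat n n" "(A g)\<^sup>T \<in> carrier_mat n n" "A (inv g) \<in> carrier_mat n n"
      using A g by auto
    have inv: "A g * A (inv g) = 1\<^sub>m n" using Amult[of g "inv g"] g A1 by simp
    have "A g * (X * (A g)\<^sup>T) * F * A g = A g * (X * ((A g)\<^sup>T * (F * A g)))"
      using c F(1) X(1) by (simp add: assoc_mult_mat[of _ n n _ n _ n])
    also have "\<dots> = \<pi> \<cdot>\<^sub>m A g"
      using c F(1) X(1)
      by (simp add: iso[OF g] X(3) \<pi>_def mult_smult_distrib[of _ n n _ n])
    finally have "A g * (X * (A g)\<^sup>T) * F * A g * A (inv g) = \<pi> \<cdot>\<^sub>m A g * A (inv g)" by simp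
    also have "\<dots> = \<pi> \<cdot>\<^sub>m 1\<^sub>m n" using c inv by (simp add: mult_smult_assoc_mat[of _ n n _ n])
    also have "A g * (X * (A g)\<^sup>T) * F * A g * A (inv g) = A g * (X * (A g)\<^sup>T) * F"
      using c F(1) X(1) inv by (simp add: assoc_mult_mat[of _ n n _ n _ n])
    finally have "A g * (X * (A g)\<^sup>T) * F * X = \<pi> \<cdot>\<^sub>m 1\<^sub>m n * X" by simp
    also have "\<dots> = \<pi> \<cdot>\<^sub>m X" using X(1) by (simp add: mult_smult_assoc_mat[of _ n n _ n])
    also have "A g * (X * (A g)\<^sup>T) * F * X = A g * (X * (A g)\<^sup>T) * (F * X)"
      using c F(1) X(1) by (intro assoc_mult_mat[of _ n n _ n _ n]) auto
    also have "\<dots> = \<pi> \<cdot>\<^sub>m (A g * (X * (A g)\<^sup>T))"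
      using c X(1) by (simp add: X(2) \<pi>_def mult_smult_distrib[of _ n n _ n])
    finally show ?thesis
      by (rule smult_mat_cancel[OF \<pi>(1), of _ _ n n]) (use c X(1) in auto)
  qed
  let ?red = "map_mat residue :: 'b valuation_subring mat \<Rightarrow> _"
  have redF: "?red F = four_block_mat F1 (0\<^sub>m r m) (0\<^sub>m m r) (0\<^sub>m m m)"
    using F1(3) by (simp add: m_def)
  have red_\<pi>: "?red (\<pi> \<cdot>\<^sub>m 1\<^sub>m n) = 0\<^sub>m n n"
    by (intro eq_matI) (auto simp: residue.hom_mult \<pi>)
  have "?red X \<in> carrier_mat (r + m) (r + m)" using X(1) n by simp
  then obtain x y z w where x: "x \<in> carrier_mat r r" "y \<in> carrier_mat r m" "z \<in> carrier_mat m r"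
    "w \<in> carrier_mat m m" "?red X = four_block_mat x y z w"
    by (rule four_block_decomposition)
  have zero: "0\<^sub>m n n = four_block_mat (0\<^sub>m r r) (0\<^sub>m r m) (0\<^sub>m m r) (0\<^sub>m m m :: 'b residue_field mat)"
    unfolding n by simp
  \<comment> \<open>F X = \<pi> vanishes modulo \<pi>, and the invertible \<open>F1\<close> makes
    the first block row of the reduced \<open>X\<close> zero. Symmetry up to sign then kills
    \<open>z\<close>, and only \<open>w\<close> survives.\<close>
  have "four_block_mat (F1 * x) (F1 * y) (0\<^sub>m m r) (0\<^sub>m m m) = 0\<^sub>m n n"
  proof -
    have "?red F * ?red X = 0\<^sub>m n n"
      using residue.mat_hom_mult[OF F(1) X(1)] red_\<pi> by (simp add: X(2) \<pi>_def)
    then show ?thesis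
      unfolding redF x(5) using F1(1) x(1-4)
      by (subst (asm) mult_four_block_mat[of _ r r _ m _ m _ _ r _ m]) auto
  qed
  from four_block_mat_inject[of _ r _ m, OF _ _ _ _ _ _ _ _ this[unfolded zero]]
  have "F1 * x = 0\<^sub>m r r" "F1 * y = 0\<^sub>m r m" using F1(1) x(1-4) by auto
  then have xy: "x = 0\<^sub>m r r" "y = 0\<^sub>m r m"
    using mat_mult_eq_0_left[OF F1(1,2)] x(1,2) by auto
  have "y\<^sup>T = of_int s \<cdot>\<^sub>m z" "w\<^sup>T = of_int s \<cdot>\<^sub>m w"
  proof -
    have "(?red X)\<^sup>T = of_int s \<cdot>\<^sub>m ?red X"
      unfolding map_mat_transpose XT by (intro eq_matI) (auto simp: residue.hom_mult residue.hom_of_int)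
    then have "four_block_mat (x\<^sup>T) (z\<^sup>T) (y\<^sup>T) (w\<^sup>T) =
        four_block_mat (of_int s \<cdot>\<^sub>m x) (of_int s \<cdot>\<^sub>m y) (of_int s \<cdot>\<^sub>m z) (of_int s \<cdot>\<^sub>m w)"
      unfolding x(5) using x(1-4)
      by (simp add: transpose_four_block_mat[of _ r r _ m _ m] smult_four_block_mat[of _ r r _ m _ m])
    from four_block_mat_inject[of _ r _ m, OF _ _ _ _ _ _ _ _ this]
    show "y\<^sup>T = of_int s \<cdot>\<^sub>m z" "w\<^sup>T = of_int s \<cdot>\<^sub>m w" using x(1-4) by auto
  qed
  then have wT: "w\<^sup>T = of_int s \<cdot>\<^sub>m w" and "of_int s \<cdot>\<^sub>m z = 0\<^sub>m m r" by (auto simp: xy(2))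
  then have "of_int s \<cdot>\<^sub>m (of_int s \<cdot>\<^sub>m z) = 0\<^sub>m m r" by simp
  then have z: "z = 0\<^sub>m m r" by (simp add: of_int_s_smult)
  \<comment> \<open>The last rows of \<open>F\<close> reduce to zero and can be divided by \<pi>.
    The block \<open>C\<close> obtained below is the Gram matrix of f / \<pi> on the radical, that
    is, of \<pi> f on \<open>T\<^sup>* / T\<close>.\<close>
  have "\<exists>e. F $$ (i + r, k) = \<pi> * e" if "i < m" "k < n" for i k
  proof -
    have "residue (F $$ (i + r, k)) = ?red F $$ (i + r, k)" using F(1) that n by simp
    also have "\<dots> = 0" unfolding redF using F1(1) that n by simp
    finally show ?thesis by (simp add: residue_eq_0_iff \<pi>_def dvd_def)
  qed
  then obtain E where E: "\<And>i k. i < m \<Longrightarrow> k < n \<Longrightarrow> F $$ (i + r, k) = \<pi> * E i k" by metis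
  define C where "C = mat m m (\<lambda>(i, k). residue (E i (k + r)))"
  have C: "C \<in> carrier_mat m m" by (simp add: C_def)
  \<comment> \<open>This is the lower right block of F X = \<pi> divided by \<pi>; the first r rows
    of \<open>X\<close> contribute nothing modulo \<pi>, because y = 0.\<close>
  have Cw: "C * w = 1\<^sub>m m"
  proof (rule eq_matI)
    fix i j assume "i < dim_row (1\<^sub>m m :: 'b residue_field mat)" "j < dim_col (1\<^sub>m m :: 'b residue_field mat)"
    then have ij: "i < m" "j < m" by auto
    have "\<pi> * (\<Sum>k<n. E i k * X $$ (k, j + r)) = (F * X) $$ (i + r, j + r)"
      using ij n E by (simp add: mat_mult_entry[OF F(1) X(1)] sum_distrib_left mult.assoc del: index_mult_mat)
    also have "\<dots> = \<pi> * (if i = j then 1 else 0)" using ij n by (simp add: X(2) \<pi>_def)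
    finally have "(\<Sum>k<n. E i k * X $$ (k, j + r)) = (if i = j then 1 else 0)" using \<pi>(1) by simp
    then have "residue (\<Sum>k<n. E i k * X $$ (k, j + r)) = (if i = j then 1 else 0)" by simp
    then have "(if i = j then 1 else 0) = (\<Sum>k<n. residue (E i k) * ?red X $$ (k, j + r))"
      using X(1) ij n by (simp add: residue.hom_sum residue.hom_mult)
    also have "\<dots> = (\<Sum>k\<in>{0..<r}. residue (E i k) * ?red X $$ (k, j + r)) +
        (\<Sum>k\<in>{0 + r..<m + r}. residue (E i k) * ?red X $$ (k, j + r))"
      unfolding n lessThan_atLeast0 by (simp add: sum.atLeastLessThan_concat add.commute)
    also have "(\<Sum>k\<in>{0..<r}. residue (E i k) * ?red X $$ (k, j + r)) = 0"
      using x(1-4) ij by (intro sum.neutral) (simp add: x(5) xy(2))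
    also have "(\<Sum>k\<in>{0 + r..<m + r}. residue (E i k) * ?red X $$ (k, j + r)) =
        (\<Sum>k\<in>{0..<m}. C $$ (i, k) * w $$ (k, j))"
      unfolding sum.shift_bounds_nat_ivl
      using x(1-4) ij by (intro sum.cong) (simp_all add: x(5) C_def)
    also have "\<dots> = (C * w) $$ (i, j)" using mat_mult_entry[OF C x(4) ij] by (simp add: lessThan_atLeast0)
    finally show "(C * w) $$ (i, j) = 1\<^sub>m m $$ (i, j)" using ij by simp
  qed (use C x(4) in auto)
  then have wC: "w * C = 1\<^sub>m m" by (rule mat_mult_left_right_inverse[OF C x(4)])
  have detC: "det C \<noteq> 0" using det_mult[OF C x(4)] Cw by auto
  have CT: "C\<^sup>T = of_int s \<cdot>\<^sub>m C"
  proof -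
    have "(of_int s \<cdot>\<^sub>m w) * C\<^sup>T = 1\<^sub>m m"
      using transpose_mult[OF C x(4)] by (simp add: Cw wT)
    then have "C * (of_int s \<cdot>\<^sub>m (w * C\<^sup>T)) = C"
      using C x(4) by (simp add: mult_smult_assoc_mat[of _ m m _ m])
    then have "of_int s \<cdot>\<^sub>m (C * w * C\<^sup>T) = C"
      using C x(4) by (simp add: mult_smult_distrib[of _ m m _ m] assoc_mult_mat[of _ m m _ m _ m])
    then have "of_int s \<cdot>\<^sub>m C\<^sup>T = C" using C by (simp add: Cw)
    then show ?thesis using of_int_s_smult[of "C\<^sup>T"] by simp
  qed
  have F1T: "F1\<^sup>T = of_int s \<cdot>\<^sub>m F1"
  proof -
    have "(?red F)\<^sup>T = of_int s \<cdot>\<^sub>m ?red F"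
      unfolding map_mat_transpose F(2) by (intro eq_matI) (auto simp: residue.hom_mult residue.hom_of_int)
    then have "four_block_mat (F1\<^sup>T) (0\<^sub>m r m) (0\<^sub>m m r) (0\<^sub>m m m) =
        four_block_mat (of_int s \<cdot>\<^sub>m F1) (0\<^sub>m r m) (0\<^sub>m m r) (0\<^sub>m m m)"
      unfolding redF using F1(1)
      by (simp add: transpose_four_block_mat[of _ r r _ m _ m] smult_four_block_mat[of _ r r _ m _ m])
    from four_block_mat_inject(1)[of _ r _ m, OF _ _ _ _ _ _ _ _ this] show ?thesis using F1(1) by auto
  qed
  have "\<exists>a b c d. a \<in> carrier_mat r r \<and> b \<in> carrier_mat r m \<and> c \<in> carrier_mat m r \<and>
      d \<in> carrier_mat m m \<and> ?red (A g) = four_block_mat a b c d" if "g \<in> carrier G" for g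
  proof -
    have "?red (A g) \<in> carrier_mat (r + m) (r + m)" using A[OF that] n by simp
    then show ?thesis by (rule four_block_decomposition) blast
  qed
  then obtain a b c d where abcd: "\<And>g. g \<in> carrier G \<Longrightarrow> a g \<in> carrier_mat r r \<and> b g \<in> carrier_mat r m \<and>
    c g \<in> carrier_mat m r \<and> d g \<in> carrier_mat m m \<and>
    ?red (A g) = four_block_mat (a g) (b g) (c g) (d g)"
    by metis
  have main: "(a g)\<^sup>T * (F1 * a g) = F1 \<and> b g = 0\<^sub>m r m \<and> (d g)\<^sup>T * (C * d g) = C"
    if g: "g \<in> carrier G" for g
  proof -
    let ?a = "a g" and ?b = "b g" and ?c = "c g" and ?d = "d g"
    have Ag: "A g \<in> carrier_mat n n" using A[OF g] by simp
    have k: "?a \<in> carrier_mat r r" "?b \<in> carrier_mat r m" "?c \<in> carrier_mat m r" "?d \<in> carrier_mat m m"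
      and red: "?red (A g) = four_block_mat ?a ?b ?c ?d"
      using abcd[OF g] by auto
    have kT: "?a\<^sup>T \<in> carrier_mat r r" "?b\<^sup>T \<in> carrier_mat m r" "?c\<^sup>T \<in> carrier_mat r m" "?d\<^sup>T \<in> carrier_mat m m"
      using k by auto
    have redT: "?red ((A g)\<^sup>T) = four_block_mat (?a\<^sup>T) (?c\<^sup>T) (?b\<^sup>T) (?d\<^sup>T)"
      unfolding map_mat_transpose[symmetric] red by (rule transpose_four_block_mat[OF k])
    have "?red ((A g)\<^sup>T) * (?red F * ?red (A g)) = ?red F"
      using arg_cong[OF iso[OF g], of ?red] Ag F(1) by (simp add: residue.mat_hom_mult[of _ n n _ n])
    then have "four_block_mat (?a\<^sup>T * (F1 * ?a)) (?a\<^sup>T * (F1 * ?b)) (?b\<^sup>T * (F1 * ?a)) (?b\<^sup>T * (F1 * ?b)) =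
        four_block_mat F1 (0\<^sub>m r m) (0\<^sub>m m r) (0\<^sub>m m m)"
      unfolding red redT redF using k kT F1(1)
      by (simp add: mult_four_block_mat[of _ r r _ m _ m _ _ r _ m])
    note e = four_block_mat_inject[of _ r _ m, OF _ _ _ _ _ _ _ _ this]
    have e1: "?a\<^sup>T * (F1 * ?a) = F1" and e2: "?a\<^sup>T * (F1 * ?b) = 0\<^sub>m r m"
      using e(1,2) k kT F1(1) by auto
    \<comment> \<open>As an isometry of the nondegenerate form \<open>F1\<close>, the block
      \<open>a g\<close> is invertible; the mixed block of the invariance relation then forces
      \<open>b g\<close> to vanish, which is stability of the radical.\<close>
    have "det (?a\<^sup>T) \<noteq> 0"
      using det_mult[OF kT(1), of "F1 * ?a"] e1 F1 k(1) by auto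
    from mat_mult_eq_0_left[OF kT(1) this _ e2] have "F1 * ?b = 0\<^sub>m r m" using F1(1) k(2) by auto
    then have b: "?b = 0\<^sub>m r m" by (rule mat_mult_eq_0_left[OF F1(1,2) k(2)])
    have "?red (A g) * (?red X * ?red ((A g)\<^sup>T)) = ?red X"
      using arg_cong[OF X_iso[OF g], of ?red] Ag X(1) by (simp add: residue.mat_hom_mult[of _ n n _ n])
    then have "four_block_mat (0\<^sub>m r r) (0\<^sub>m r m) (0\<^sub>m m r) (?d * (w * ?d\<^sup>T)) =
        four_block_mat (0\<^sub>m r r) (0\<^sub>m r m) (0\<^sub>m m r) w"
      unfolding red redT x(5) xy z b using k kT x(4)
      by (simp add: mult_four_block_mat[of _ r r _ m _ m _ _ r _ m])
    from four_block_mat_inject(4)[of _ r _ m, OF _ _ _ _ _ _ _ _ this]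
    have dw: "?d * (w * ?d\<^sup>T) = w" using k kT x(4) by auto
    \<comment> \<open>Invariance of \<open>w\<close> becomes invariance of its inverse
      \<open>C\<close>: the last factor may be moved to the front, a right inverse of a square
      matrix being a left inverse.\<close>
    have "C * ?d * w * ?d\<^sup>T = C * (?d * (w * ?d\<^sup>T))"
      using C k(4) kT(4) x(4) by (simp add: assoc_mult_mat[of _ m m _ m _ m])
    also have "\<dots> = 1\<^sub>m m" by (simp add: dw Cw)
    finally have "C * ?d * w * ?d\<^sup>T = 1\<^sub>m m" .
    moreover have "C * ?d * w \<in> carrier_mat m m" using C k(4) x(4) by auto
    ultimately have "?d\<^sup>T * (C * ?d * w) = 1\<^sub>m m" using kT(4) by (metis mat_mult_left_right_inverse)
    then have "?d\<^sup>T * (C * ?d * w) * C = C" using C by simp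
    moreover have "?d\<^sup>T * (C * ?d * w) * C = ?d\<^sup>T * (C * ?d * (w * C))"
      using C k(4) kT(4) x(4) by (simp add: assoc_mult_mat[of _ m m _ m _ m])
    ultimately have "?d\<^sup>T * (C * ?d) = C" using C k(4) by (simp add: wC)
    then show ?thesis using e1 b by simp
  qed
  define \<rho> where "\<rho> g = four_block_mat (a g) (0\<^sub>m r m) (0\<^sub>m m r) (d g)" for g
  define F0 where "F0 = four_block_mat F1 (0\<^sub>m r m) (0\<^sub>m m r) C"
  have red: "a g \<in> carrier_mat r r" "c g \<in> carrier_mat m r" "d g \<in> carrier_mat m m"
    "?red (A g) = four_block_mat (a g) (0\<^sub>m r m) (c g) (d g)" if "g \<in> carrier G" for g
    using abcd[OF that] main[OF that] by auto
  show thesis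
  proof (rule that[of P A F0 \<rho>])
    show "F0 \<in> carrier_mat n n" using F1(1) C by (simp add: F0_def n)
    show "det F0 \<noteq> 0"
      using F1 C detC by (simp add: F0_def det_four_block_mat_upper_right_zero[of _ r _ m])
    show "F0\<^sup>T = of_int s \<cdot>\<^sub>m F0"
      using F1(1) C
      by (simp add: F0_def transpose_four_block_mat[of _ r r _ m _ m]
          smult_four_block_mat[of _ r r _ m _ m] F1T CT)
    show "\<rho> g \<in> carrier_mat n n \<and> (\<rho> g)\<^sup>T * (F0 * \<rho> g) = F0" if g: "g \<in> carrier G" for g
      using red[OF g] F1(1) C main[OF g]
      by (simp add: n \<rho>_def F0_def transpose_four_block_mat[of _ r r _ m _ m]
          mult_four_block_mat[of _ r r _ m _ m _ _ r _ m])
    show "\<rho> (g \<otimes> h) = \<rho> g * \<rho> h" if gh: "g \<in> carrier G" "h \<in> carrier G" for g h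
    proof -
      have "?red (A (g \<otimes> h)) = ?red (A g) * ?red (A h)"
        unfolding Amult[OF gh] using A gh by (intro residue.mat_hom_mult[of _ n n _ n]) auto
      then have "four_block_mat (a (g \<otimes> h)) (0\<^sub>m r m) (c (g \<otimes> h)) (d (g \<otimes> h)) =
          four_block_mat (a g * a h) (0\<^sub>m r m) (c g * a h + d g * c h) (d g * d h)"
        unfolding red(4)[OF gh(1)] red(4)[OF gh(2)] red(4)[OF m_closed[OF gh]]
        using red(1-3)[OF gh(1)] red(1-3)[OF gh(2)]
        by (simp add: mult_four_block_mat[of _ r r _ m _ m _ _ r _ m])
      note e = four_block_mat_inject[of _ r _ m, OF _ _ _ _ _ _ _ _ this]
      have "a (g \<otimes> h) = a g * a h" "d (g \<otimes> h) = d g * d h"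
        using e(1,4) red(1-3)[OF gh(1)] red(1-3)[OF gh(2)] red(1-3)[OF m_closed[OF gh]] by auto
      then show ?thesis
        using red(1-3)[OF gh(1)] red(1-3)[OF gh(2)]
        by (simp add: \<rho>_def mult_four_block_mat[of _ r r _ m _ m _ _ r _ m])
    qed
    show "char_poly (\<rho> g) = map_poly residue (char_poly (A g))" if g: "g \<in> carrier G" for g
      using A[OF g] residue.char_poly_hom[of "A g" n] red[OF g]
      by (simp add: \<rho>_def char_poly_four_block_lower)
    show "\<rho> \<one> = 1\<^sub>m n"
    proof -
      have "?red (A \<one>) = 1\<^sub>m (r + m)" by (simp add: A1 n residue.mat_hom_one)
      then have "four_block_mat (a \<one>) (0\<^sub>m r m) (c \<one>) (d \<one>) =
          four_block_mat (1\<^sub>m r) (0\<^sub>m r m) (0\<^sub>m m r) (1\<^sub>m m)"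
        unfolding red(4)[OF one_closed] by simp
      note e = four_block_mat_inject[of _ r _ m, OF _ _ _ _ _ _ _ _ this]
      have "a \<one> = 1\<^sub>m r" "d \<one> = 1\<^sub>m m" using e(1,4) red(1-3)[OF one_closed] by auto
      then show ?thesis by (simp add: \<rho>_def n)
    qed
    show "?red ((A g - 1\<^sub>m n) * (A g - 1\<^sub>m n)) = 0\<^sub>m n n" if g: "g \<in> carrier G" "\<rho> g = 1\<^sub>m n" for g
    proof -
      have "four_block_mat (a g) (0\<^sub>m r m) (0\<^sub>m m r) (d g) =
          four_block_mat (1\<^sub>m r) (0\<^sub>m r m) (0\<^sub>m m r) (1\<^sub>m m)"
        using g(2) unfolding \<rho>_def n by simp
      note e = four_block_mat_inject[of _ r _ m, OF _ _ _ _ _ _ _ _ this]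
      have ad: "a g = 1\<^sub>m r" "d g = 1\<^sub>m m" using e(1,4) red(1-3)[OF g(1)] by auto
      have Ag: "A g \<in> carrier_mat n n" "A g - 1\<^sub>m n \<in> carrier_mat n n" using A[OF g(1)] by auto
      \<comment> \<open>Only the block \<open>c g\<close> discarded by \<open>\<rho>\<close>
        remains, and a strictly lower block matrix squares to zero.\<close>
      have "?red (A g - 1\<^sub>m n) = ?red (A g) - four_block_mat (1\<^sub>m r) (0\<^sub>m r m) (0\<^sub>m m r) (1\<^sub>m m)"
        using Ag by (intro eq_matI) (auto simp: n residue.hom_minus)
      also have "\<dots> = four_block_mat (0\<^sub>m r r) (0\<^sub>m r m) (c g) (0\<^sub>m m m)"
        unfolding red(4)[OF g(1)] ad using red(2)[OF g(1)] by (intro eq_matI) auto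
      finally show ?thesis
        using red(2)[OF g(1)]
        by (simp add: residue.mat_hom_mult[OF Ag(2) Ag(2)] mult_four_block_mat[of _ r r _ m _ m _ _ r _ m] zero)
    qed
  qed (use P A A1 Amult in auto)
qed

end

section \<open>Triviality of the kernel\<close>

lemma (in group) nontrivial_pow_of_prime_order:
  assumes "finite (carrier G)" "g \<in> carrier G" "g \<noteq> \<one>"
  obtains k p :: nat where "prime p" "g [^] k \<noteq> \<one>" "(g [^] k) [^] p = \<one>"
proof -
  have "\<not> inj_on (\<lambda>k::nat. g [^] k) UNIV"
    using assms(1,2) finite_subset[of "range (\<lambda>k::nat. g [^] k)" "carrier G"]
    by (auto dest: finite_imageD)
  then obtain i j :: nat where ij: "i < j" "g [^] i = g [^] j"
    by (metis linorder_inj_onI' UNIV_I)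
  have "g [^] i \<otimes> g [^] (j - i) = g [^] i \<otimes> \<one>"
    using ij assms(2) nat_pow_mult[of g i "j - i"] by simp
  then have "0 < j - i \<and> g [^] (j - i) = \<one>" using ij(1) assms(2) by simp
  \<comment> \<open>\<open>m\<close> is the order of g; for a prime divisor p, the power with
    exponent m / p has order p.\<close>
  then obtain m :: nat where m: "0 < m" "g [^] m = \<one>" "\<And>k. k < m \<Longrightarrow> \<not> (0 < k \<and> g [^] k = \<one>)"
    using exists_least_iff[of "\<lambda>m::nat. 0 < m \<and> g [^] m = \<one>"] by blast
  have "m \<noteq> 1" using m(2) assms(2,3) by auto
  then obtain p where p: "prime p" "p dvd m" using prime_factor_nat by blast
  define k where "k = m div p"
  have k: "k * p = m" using p(2) by (simp add: k_def)
  have "0 < k" "k < m"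
    using k m(1) prime_gt_1_nat[OF p(1)] by (auto intro: Nat.gr0I)
  then have "g [^] k \<noteq> \<one>" using m(3) by blast
  moreover have "(g [^] k) [^] p = \<one>" using assms(2) k m(2) by (simp add: nat_pow_pow)
  ultimately show thesis using that p(1) by blast
qed

text \<open>The bound on the ramification index enters here, in a form valid for all primes:
  \<open>c\<close> is e for p = l, and 0 for any other p, which is a unit.\<close>

lemma prime_as_unit_times_uniformizer_power:
  assumes "prime l" "CHAR('a::{discrete_valuation_field, field_char_0} residue_field) = l"
    and "2 * ramification_index TYPE('a) < int l - 1" and p: "prime p"
  obtains u c where "(of_nat p :: 'a valuation_subring) = u * uniformizer ^ c" "u dvd 1" "2 * c + 1 < p"
proof (cases "p = l")
  case True
  have "(of_nat p :: 'a) \<noteq> 0" using p by auto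
  then have nz: "(of_nat p :: 'a valuation_subring) \<noteq> 0"
    using of_subring.hom_of_nat[of p] of_subring.hom_zero by metis
  have e: "val (of_subring (of_nat p :: 'a valuation_subring)) = ramification_index TYPE('a)"
    using True assms(2) by (simp add: ramification_index_def of_subring.hom_of_nat)
  obtain u :: "'a valuation_subring" where
    "u dvd 1" "of_nat p = u * uniformizer ^ nat (ramification_index TYPE('a))"
    using valuation_subring_unit_times_power[OF nz] unfolding e by blast
  moreover have "2 * nat (ramification_index TYPE('a)) + 1 < p"
    using assms(3) True prime_gt_1_nat[OF p] by linarith
  ultimately show ?thesis using that by blast
next
  case False
  then have "\<not> l dvd p" using primes_dvd_imp_eq[OF assms(1) p] by blast
  then have "residue (of_nat p :: 'a valuation_subring) \<noteq> 0"
    using assms(2) by (simp add: residue.hom_of_nat of_nat_eq_0_iff_char_dvd)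
  then show ?thesis
    using that[of "of_nat p" 0] prime_gt_1_nat[OF p] by (simp add: subring_unit_iff)
qed

theorem isometric_matrix_rep_reduction:
  fixes R :: "'g \<Rightarrow> 'a::{discrete_valuation_field, field_char_0} mat" and G (structure)
  assumes rep: "isometric_matrix_rep G n R J s" and inj: "inj_on R (carrier G)"
    and l: "prime l" "CHAR('a residue_field) = l" "2 * ramification_index TYPE('a) < int l - 1"
  obtains \<rho> F where "F \<in> carrier_mat n n" "det F \<noteq> 0" "F\<^sup>T = of_int s \<cdot>\<^sub>m F"
    "\<And>g. g \<in> carrier G \<Longrightarrow> \<rho> g \<in> carrier_mat n n \<and> (\<rho> g)\<^sup>T * (F * \<rho> g) = F"
    "\<rho> \<one> = 1\<^sub>m n"
    "\<And>g h. g \<in> carrier G \<Longrightarrow> h \<in> carrier G \<Longrightarrow> \<rho> (g \<otimes> h) = \<rho> g * \<rho> h"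
    "inj_on \<rho> (carrier G)"
    "\<And>g i. g \<in> carrier G \<Longrightarrow> coeff (char_poly (R g)) i \<in> valuation_ring"
    "\<And>g. g \<in> carrier G \<Longrightarrow> char_poly (\<rho> g) = map_poly reduction (char_poly (R g))"
proof -
  interpret isometric_matrix_rep G n R J s by (rule rep)
  obtain P A \<rho> F where P: "P \<in> carrier_mat n n" "det P \<noteq> 0"
    and A: "\<And>g. g \<in> carrier G \<Longrightarrow> A g \<in> carrier_mat n n \<and> R g * P = P * emb_mat (A g)"
    and A1: "A \<one> = 1\<^sub>m n"
    and Amult: "\<And>g h. g \<in> carrier G \<Longrightarrow> h \<in> carrier G \<Longrightarrow> A (g \<otimes> h) = A g * A h"
    and F: "F \<in> carrier_mat n n" "det F \<noteq> 0" "F\<^sup>T = of_int s \<cdot>\<^sub>m F"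
    and \<rho>: "\<And>g. g \<in> carrier G \<Longrightarrow> \<rho> g \<in> carrier_mat n n \<and> (\<rho> g)\<^sup>T * (F * \<rho> g) = F"
    and \<rho>_mult: "\<And>g h. g \<in> carrier G \<Longrightarrow> h \<in> carrier G \<Longrightarrow> \<rho> (g \<otimes> h) = \<rho> g * \<rho> h"
    and cp: "\<And>g. g \<in> carrier G \<Longrightarrow> char_poly (\<rho> g) = map_poly residue (char_poly (A g))"
    and \<rho>1: "\<rho> \<one> = 1\<^sub>m n"
    and ker: "\<And>g. g \<in> carrier G \<Longrightarrow> \<rho> g = 1\<^sub>m n \<Longrightarrow>
      map_mat residue ((A g - 1\<^sub>m n) * (A g - 1\<^sub>m n)) = 0\<^sub>m n n"
    by (rule reduced_rep) blast
  obtain Q where Q: "Q \<in> carrier_mat n n" "P * Q = 1\<^sub>m n" "Q * P = 1\<^sub>m n"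
    using mat_inverse_if_det_unit[OF P(1)] P(2) by (metis dvd_field_iff one_neq_zero)
  have R_conj: "R g = P * emb_mat (A g) * Q" if g: "g \<in> carrier G" for g
  proof -
    have "R g * P * Q = R g"
      using R_carrier[OF g] P(1) Q by (simp add: assoc_mult_mat[of _ n n _ n _ n])
    then show ?thesis using A[OF g] by simp
  qed
  \<comment> \<open>Conjugacy over K shows that these coefficients are integral, so
    \<open>reduction\<close> is only applied to elements of the valuation ring.\<close>
  have char_poly_R: "char_poly (R g) = map_poly of_subring (char_poly (A g))" if g: "g \<in> carrier G" for g
  proof -
    have "similar_mat (R g) (emb_mat (A g))"
      using R_carrier[OF g] A[OF g] P(1) Q R_conj[OF g] by (intro similar_matI[of _ _ P Q n]) auto
    then show ?thesis
      using char_poly_similar of_subring.char_poly_hom[of "A g" n] A[OF g] by metis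
  qed
  have pow: "A (g [^] k) = A g ^\<^sub>m k" "\<rho> (g [^] k) = \<rho> g ^\<^sub>m k" if "g \<in> carrier G" for g and k :: nat
    using that A[OF that] \<rho>[OF that] by (induction k; auto simp: A1 Amult \<rho>1 \<rho>_mult)+
  have trivial_kernel: "g = \<one>" if g: "g \<in> carrier G" "\<rho> g = 1\<^sub>m n" for g
  proof (rule ccontr)
    assume "g \<noteq> \<one>"
    then obtain k p :: nat where p: "prime p" and k: "g [^] k \<noteq> \<one>" "(g [^] k) [^] p = \<one>"
      by (rule nontrivial_pow_of_prime_order[OF finite_carrier g(1)]) blast
    \<comment> \<open>A power of g stays in the kernel; having prime order, it is subject to the
      Minkowski--Serre lemma.\<close>
    define h where "h = g [^] k"
    have h: "h \<in> carrier G" "h \<noteq> \<one>" "h [^] p = \<one>" using g(1) k by (auto simp: h_def)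
    have "1\<^sub>m n ^\<^sub>m k = (1\<^sub>m n :: 'a residue_field mat)" by (induction k) auto
    then have \<rho>h: "\<rho> h = 1\<^sub>m n" using pow(2)[OF g(1)] g(2) by (simp add: h_def)
    define H where "H = A h - 1\<^sub>m n"
    have Ah: "A h \<in> carrier_mat n n" using A h(1) by blast
    then have H: "H \<in> carrier_mat n n" "1\<^sub>m n + H = A h"
      by (auto simp: H_def intro!: eq_matI)
    obtain u :: "'a valuation_subring" and c where
      u: "of_nat p = u * uniformizer ^ c" "u dvd 1" "2 * c + 1 < p"
      using prime_as_unit_times_uniformizer_power[OF l p] by metis
    have "H = 0\<^sub>m n n"
    proof (rule quadratically_unipotent_mat_eq_0[OF H(1) _ _ p u uniformizer_nonzero])
      show "(1\<^sub>m n + H) ^\<^sub>m p = 1\<^sub>m n" using pow(1)[OF h(1), of p] h(3) A1 H(2) by simp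
      show "uniformizer dvd (H * H) $$ (i, j)" if "i < n" "j < n" for i j
      proof -
        have "residue ((H * H) $$ (i, j)) = map_mat residue (H * H) $$ (i, j)"
          using H(1) that by simp
        also have "\<dots> = 0" using ker[OF h(1) \<rho>h] that by (simp add: H_def)
        finally show ?thesis by (simp add: residue_eq_0_iff)
      qed
    qed (rule uniformizer_powers_dvd_imp_0)
    then have "A h = 1\<^sub>m n" using H by simp
    then have "R h = R \<one>" using R_conj[OF h(1)] R_conj[OF one_closed] A1 by simp
    then show False using inj h by (auto dest: inj_onD)
  qed
  show thesis
  proof (rule that[of F \<rho>])
    show "inj_on \<rho> (carrier G)"
    proof (rule inj_onI)
      fix g h assume gh: "g \<in> carrier G" "h \<in> carrier G" "\<rho> g = \<rho> h"
      have "\<rho> (g \<otimes> inv h) = \<rho> (h \<otimes> inv h)"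
        unfolding \<rho>_mult[OF gh(1) inv_closed[OF gh(2)]] \<rho>_mult[OF gh(2) inv_closed[OF gh(2)]] gh(3) ..
      then have "g \<otimes> inv h = \<one>" using gh \<rho>1 by (intro trivial_kernel) auto
      then show "g = h" using gh inv_equality[of g "inv h"] by simp
    qed
    show "coeff (char_poly (R g)) i \<in> valuation_ring" if "g \<in> carrier G" for g i
      by (simp add: char_poly_R[OF that] coeff_map_poly)
    show "char_poly (\<rho> g) = map_poly reduction (char_poly (R g))" if "g \<in> carrier G" for g
      \<comment> \<open>Computing coefficients through \<open>map_poly\<close> requires that 0
        reduces to 0.\<close>
      unfolding cp[OF that] char_poly_R[OF that] using reduction_eq_0_iff[of "0 :: 'a"]
      by (intro poly_eqI) (simp add: coeff_map_poly residue_def)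
  qed (use F \<rho> \<rho>1 \<rho>_mult in auto)
qed

section \<open>Coordinates\<close>

locale ordered_basis = vectorspace class_ring V
  for V :: "('a::field, 'v) module" and bs :: "'v list" +
  assumes distinct_bs: "distinct bs" and basis_bs: "basis (set bs)"
begin

definition comb :: "(nat \<Rightarrow> 'a) \<Rightarrow> 'v" where
  "comb c = (\<Oplus>\<^bsub>V\<^esub>i\<in>{..<length bs}. c i \<odot>\<^bsub>V\<^esub> bs ! i)"

text \<open>Only coordinates below \<open>length bs\<close> are determined; beyond, the choice is
  arbitrary, since \<open>comb\<close> does not look there.\<close>

definition coord :: "nat \<Rightarrow> 'v \<Rightarrow> 'a" where
  "coord i x = (SOME c. x = comb c) i"

lemma bs_closed [simp]: "i < length bs \<Longrightarrow> bs ! i \<in> carrier V"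
  using basis_bs by (force simp: basis_def)

lemma smult_in_V: "x \<in> carrier V \<Longrightarrow> c \<odot>\<^bsub>V\<^esub> x \<in> carrier V"
  using smult_closed[of c x] by simp

lemma comb_closed: "comb c \<in> carrier V"
  unfolding comb_def by (intro M.finsum_closed) (auto intro: smult_in_V)

lemma lincomb_eq_comb: "lincomb a (set bs) = comb (\<lambda>i. a (bs ! i))"
proof -
  have "inj_on ((!) bs) {..<length bs}" using distinct_bs by (auto simp: inj_on_nth)
  then have "(\<Oplus>\<^bsub>V\<^esub>v\<in>(!) bs ` {..<length bs}. a v \<odot>\<^bsub>V\<^esub> v) = comb (\<lambda>i. a (bs ! i))"
    unfolding comb_def by (intro M.finsum_reindex) (auto intro: smult_in_V)
  moreover have "(!) bs ` {..<length bs} = set bs" by (auto simp: set_conv_nth)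
  ultimately show ?thesis unfolding lincomb_def by simp
qed

lemma comb_exists:
  assumes "x \<in> carrier V"
  shows "\<exists>c. x = comb c"
proof -
  have "x \<in> span (set bs)" using assms basis_bs by (auto simp: basis_def)
  moreover have "set bs \<subseteq> carrier V" using basis_bs by (auto simp: basis_def)
  ultimately obtain a where "x = lincomb a (set bs)" using finite_span[of "set bs"] by auto
  then show ?thesis using lincomb_eq_comb by auto
qed

lemma comb_coord: "x \<in> carrier V \<Longrightarrow> comb (\<lambda>i. coord i x) = x"
  unfolding coord_def using someI_ex[OF comb_exists] by simp

text \<open>Scalar-valued maps cover both uses: coordinates of the image of a linear map, and a
  bilinear form with one argument fixed.\<close>

lemma linear_comb:
  assumes add: "\<And>x y. x \<in> carrier V \<Longrightarrow> y \<in> carrier V \<Longrightarrow> h (x \<oplus>\<^bsub>V\<^esub> y) = h x + h y"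
    and smult: "\<And>c x. x \<in> carrier V \<Longrightarrow> h (c \<odot>\<^bsub>V\<^esub> x) = c * (h x :: 'a)"
  shows "h (comb c) = (\<Sum>i<length bs. c i * h (bs ! i))"
proof -
  have h0: "h \<zero>\<^bsub>V\<^esub> = 0" using add[of "\<zero>\<^bsub>V\<^esub>" "\<zero>\<^bsub>V\<^esub>"]
    by (metis M.r_zero M.zero_closed add_cancel_right_right)
  have "h (\<Oplus>\<^bsub>V\<^esub>i\<in>{..<k}. c i \<odot>\<^bsub>V\<^esub> bs ! i) = (\<Sum>i<k. c i * h (bs ! i))" if "k \<le> length bs" for k
    using that
  proof (induction k)
    case 0
    then show ?case by (simp add: h0)
  next
    case (Suc k)
    have "(\<Oplus>\<^bsub>V\<^esub>i\<in>{..<Suc k}. c i \<odot>\<^bsub>V\<^esub> bs ! i) =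
        c k \<odot>\<^bsub>V\<^esub> bs ! k \<oplus>\<^bsub>V\<^esub> (\<Oplus>\<^bsub>V\<^esub>i\<in>{..<k}. c i \<odot>\<^bsub>V\<^esub> bs ! i)"
      unfolding lessThan_Suc using Suc.prems by (intro M.finsum_insert) (auto intro: smult_in_V)
    moreover have "(\<Oplus>\<^bsub>V\<^esub>i\<in>{..<k}. c i \<odot>\<^bsub>V\<^esub> bs ! i) \<in> carrier V"
      using Suc.prems by (intro M.finsum_closed) (auto intro: smult_in_V)
    ultimately show ?case
      using Suc by (simp add: add smult smult_in_V add.commute)
  qed
  then show ?thesis by (simp add: comb_def)
qed

lemma comb_add: "comb c \<oplus>\<^bsub>V\<^esub> comb d = comb (\<lambda>i. c i + d i)"
proof -
  have "(c i + d i) \<odot>\<^bsub>V\<^esub> bs ! i = c i \<odot>\<^bsub>V\<^esub> bs ! i \<oplus>\<^bsub>V\<^esub> d i \<odot>\<^bsub>V\<^esub> bs ! i" if "i < length bs" for i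
    using smult_l_distr[of "c i" "d i" "bs ! i"] that by simp
  then have "comb (\<lambda>i. c i + d i) =
      (\<Oplus>\<^bsub>V\<^esub>i\<in>{..<length bs}. c i \<odot>\<^bsub>V\<^esub> bs ! i \<oplus>\<^bsub>V\<^esub> d i \<odot>\<^bsub>V\<^esub> bs ! i)"
    unfolding comb_def by (intro M.finsum_cong') (auto intro: smult_in_V)
  also have "\<dots> = comb c \<oplus>\<^bsub>V\<^esub> comb d"
    unfolding comb_def by (intro M.finsum_addf) (auto intro: smult_in_V)
  finally show ?thesis ..
qed

lemma comb_smult: "a \<odot>\<^bsub>V\<^esub> comb c = comb (\<lambda>i. a * c i)"
proof -
  have "(a * c i) \<odot>\<^bsub>V\<^esub> bs ! i = a \<odot>\<^bsub>V\<^esub> (c i \<odot>\<^bsub>V\<^esub> bs ! i)" if "i < length bs" for i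
    using smult_assoc1[of a "c i" "bs ! i"] that by simp
  then have "comb (\<lambda>i. a * c i) = (\<Oplus>\<^bsub>V\<^esub>i\<in>{..<length bs}. a \<odot>\<^bsub>V\<^esub> (c i \<odot>\<^bsub>V\<^esub> bs ! i))"
    unfolding comb_def by (intro M.finsum_cong') (auto intro: smult_in_V)
  also have "\<dots> = a \<odot>\<^bsub>V\<^esub> comb c"
    unfolding comb_def by (intro finsum_smult[symmetric]) (auto intro: smult_in_V)
  finally show ?thesis ..
qed

text \<open>Linear independence speaks of coefficients attached to vectors; distinctness of
  \<open>bs\<close> converts coefficients attached to positions into such.\<close>

lemma comb_eq_zero:
  assumes "comb c = \<zero>\<^bsub>V\<^esub>" "i < length bs"
  shows "c i = 0"
proof -
  define a where "a v = c (the_inv_into {..<length bs} ((!) bs) v)" for v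
  have "inj_on ((!) bs) {..<length bs}" using distinct_bs by (auto simp: inj_on_nth)
  then have a: "a (bs ! j) = c j" if "j < length bs" for j
    using that by (simp add: a_def the_inv_into_f_f)
  have "comb (\<lambda>i. a (bs ! i)) = comb c"
    unfolding comb_def by (intro M.finsum_cong') (auto intro: smult_in_V simp: a)
  then have "lincomb a (set bs) = \<zero>\<^bsub>V\<^esub>" using assms(1) by (simp add: lincomb_eq_comb)
  moreover have "lin_indpt (set bs)" using basis_bs by (auto simp: basis_def)
  ultimately have "a (bs ! i) = 0"
    using lin_dep_crit[of "set bs" "set bs" a "bs ! i"] assms(2) by auto
  then show ?thesis using a assms(2) by simp
qed

lemma coord_comb:
  assumes "i < length bs"
  shows "coord i (comb c) = c i"
proof -
  define d where "d j = coord j (comb c)" for j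
  have "comb (\<lambda>j. d j + (- 1) * c j) = comb c \<oplus>\<^bsub>V\<^esub> comb (\<lambda>j. (- 1) * c j)"
    using comb_coord[OF comb_closed, of c] by (simp only: comb_add[symmetric] d_def)
  also have "\<dots> = comb (\<lambda>j. 0 * c j)" by (simp add: comb_add)
  also have "\<dots> = \<zero>\<^bsub>V\<^esub>"
    unfolding comb_smult[symmetric] using smult_l_null[OF comb_closed] by simp
  finally show ?thesis using comb_eq_zero[of "\<lambda>j. d j + (- 1) * c j" i] assms by (simp add: d_def)
qed

lemma coord_linear:
  assumes "i < length bs" "x \<in> carrier V" "y \<in> carrier V"
  shows "coord i (x \<oplus>\<^bsub>V\<^esub> y) = coord i x + coord i y" "coord i (a \<odot>\<^bsub>V\<^esub> x) = a * coord i x"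
proof -
  obtain c d where "x = comb c" "y = comb d" using assms comb_exists by blast
  then show "coord i (x \<oplus>\<^bsub>V\<^esub> y) = coord i x + coord i y" "coord i (a \<odot>\<^bsub>V\<^esub> x) = a * coord i x"
    using assms(1) by (simp_all add: comb_add comb_smult coord_comb)
qed

definition matrix_of :: "('v \<Rightarrow> 'v) \<Rightarrow> 'a mat" where
  "matrix_of \<phi> = mat (length bs) (length bs) (\<lambda>(i, j). coord i (\<phi> (bs ! j)))"

definition gram :: "('v \<Rightarrow> 'v \<Rightarrow> 'a) \<Rightarrow> 'a mat" where
  "gram f = mat (length bs) (length bs) (\<lambda>(i, j). f (bs ! i) (bs ! j))"

lemma matrix_of_carrier [simp]: "matrix_of \<phi> \<in> carrier_mat (length bs) (length bs)"
  by (simp add: matrix_of_def)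

lemma matrix_of_index:
  "i < length bs \<Longrightarrow> j < length bs \<Longrightarrow> matrix_of \<phi> $$ (i, j) = coord i (\<phi> (bs ! j))"
  by (simp add: matrix_of_def)

lemma comb_matrix_of_col:
  assumes "j < length bs" "\<phi> (bs ! j) \<in> carrier V"
  shows "\<phi> (bs ! j) = comb (\<lambda>i. matrix_of \<phi> $$ (i, j))"
proof -
  have "comb (\<lambda>i. matrix_of \<phi> $$ (i, j)) = comb (\<lambda>i. coord i (\<phi> (bs ! j)))"
    unfolding comb_def using assms(1) by (intro M.finsum_cong') (auto intro: smult_in_V simp: matrix_of_def)
  then show ?thesis using comb_coord[OF assms(2)] by simp
qed

lemma represents_matrix_of:
  assumes "\<phi> \<in> carrier V \<rightarrow> carrier V"
  shows "represents V bs \<phi> (matrix_of \<phi>)"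
proof -
  have "\<phi> (bs ! j) = comb (\<lambda>i. matrix_of \<phi> $$ (i, j))" if "j < length bs" for j
    using that assms by (intro comb_matrix_of_col) auto
  then show ?thesis using distinct_bs basis_bs by (auto simp: represents_def comb_def)
qed

abbreviation linear_maps where
  "linear_maps \<equiv> LinearCombinations.module_hom class_ring V V"

lemma linear_mapsD:
  assumes "\<phi> \<in> linear_maps"
  shows "\<phi> \<in> carrier V \<rightarrow> carrier V" "\<And>x. x \<in> carrier V \<Longrightarrow> \<phi> x \<in> carrier V"
    "\<And>x y. x \<in> carrier V \<Longrightarrow> y \<in> carrier V \<Longrightarrow> \<phi> (x \<oplus>\<^bsub>V\<^esub> y) = \<phi> x \<oplus>\<^bsub>V\<^esub> \<phi> y"
    "\<And>c x. x \<in> carrier V \<Longrightarrow> \<phi> (c \<odot>\<^bsub>V\<^esub> x) = c \<odot>\<^bsub>V\<^esub> \<phi> x"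
  using assms by (auto simp: LinearCombinations.module_hom_def)

lemma coord_map_comb:
  assumes "\<phi> \<in> linear_maps" "i < length bs"
  shows "coord i (\<phi> (comb c)) = (\<Sum>k<length bs. c k * coord i (\<phi> (bs ! k)))"
  by (rule linear_comb)
    (use assms linear_mapsD[OF assms(1)] coord_linear[OF assms(2)] in simp_all)

lemma matrix_of_comp:
  assumes "\<phi> \<in> linear_maps" "\<psi> \<in> linear_maps"
    and "\<And>x. x \<in> carrier V \<Longrightarrow> \<chi> x = \<phi> (\<psi> x)"
  shows "matrix_of \<chi> = matrix_of \<phi> * matrix_of \<psi>"
proof (rule eq_matI)
  fix i j assume "i < dim_row (matrix_of \<phi> * matrix_of \<psi>)" "j < dim_col (matrix_of \<phi> * matrix_of \<psi>)"
  then have ij: "i < length bs" "j < length bs" by (auto simp: matrix_of_def)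
  have "\<psi> (bs ! j) = comb (\<lambda>k. matrix_of \<psi> $$ (k, j))"
    using ij linear_mapsD[OF assms(2)] by (intro comb_matrix_of_col) auto
  then have "coord i (\<chi> (bs ! j)) =
      (\<Sum>k<length bs. matrix_of \<psi> $$ (k, j) * coord i (\<phi> (bs ! k)))"
    using assms(3)[OF bs_closed[OF ij(2)]] coord_map_comb[OF assms(1) ij(1)] by simp
  then show "matrix_of \<chi> $$ (i, j) = (matrix_of \<phi> * matrix_of \<psi>) $$ (i, j)"
    using ij mat_mult_entry[of "matrix_of \<phi>" "length bs" "length bs" "matrix_of \<psi>" "length bs" i j]
    by (simp add: matrix_of_def mult.commute)
qed (auto simp: matrix_of_def)

lemma matrix_of_inject:
  assumes "\<phi> \<in> linear_maps" "\<psi> \<in> linear_maps" "matrix_of \<phi> = matrix_of \<psi>" "x \<in> carrier V"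
  shows "\<phi> x = \<psi> x"
proof -
  have "coord i (\<phi> (bs ! j)) = coord i (\<psi> (bs ! j))" if "i < length bs" "j < length bs" for i j
    using matrix_of_index[OF that] assms(3) by metis
  then have "coord i (\<phi> x) = coord i (\<psi> x)" if "i < length bs" for i
    using coord_map_comb[OF assms(1) that, of "\<lambda>i. coord i x"]
      coord_map_comb[OF assms(2) that, of "\<lambda>i. coord i x"] comb_coord[OF assms(4)] that by simp
  then have "comb (\<lambda>i. coord i (\<phi> x)) = comb (\<lambda>i. coord i (\<psi> x))"
    unfolding comb_def by (intro M.finsum_cong') (auto intro: smult_in_V)
  then show ?thesis
    using comb_coord linear_mapsD(2)[OF assms(1,4)] linear_mapsD(2)[OF assms(2,4)] by simp
qed

lemma matrix_of_id:
  assumes "\<And>x. x \<in> carrier V \<Longrightarrow> \<phi> x = x"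
  shows "matrix_of \<phi> = 1\<^sub>m (length bs)"
proof (rule eq_matI)
  fix i j assume "i < dim_row (1\<^sub>m (length bs) :: 'a mat)" "j < dim_col (1\<^sub>m (length bs) :: 'a mat)"
  then have ij: "i < length bs" "j < length bs" by auto
  have "comb (\<lambda>k. if j = k then 1 else 0) =
      (\<Oplus>\<^bsub>V\<^esub>k\<in>{..<length bs}. if j = k then bs ! k else \<zero>\<^bsub>V\<^esub>)"
    unfolding comb_def using smult_one smult_l_null by (intro M.finsum_cong') auto
  also have "\<dots> = bs ! j" using ij(2) by (intro M.finsum_singleton) auto
  finally have "coord i (bs ! j) = (if j = i then 1 else 0)"
    using coord_comb[OF ij(1), of "\<lambda>k. if j = k then 1 else 0"] by simp
  then show "matrix_of \<phi> $$ (i, j) = 1\<^sub>m (length bs) $$ (i, j)"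
    using ij assms by (auto simp: matrix_of_def)
qed (auto simp: matrix_of_def)

lemma bilinear_comb:
  assumes f: "bilinear_form V f"
  shows "y \<in> carrier V \<Longrightarrow> f (comb c) y = (\<Sum>i<length bs. c i * f (bs ! i) y)"
    and "x \<in> carrier V \<Longrightarrow> f x (comb c) = (\<Sum>i<length bs. c i * f x (bs ! i))"
proof -
  show "f (comb c) y = (\<Sum>i<length bs. c i * f (bs ! i) y)" if "y \<in> carrier V"
    by (rule linear_comb) (use f that in \<open>auto simp: bilinear_form_def\<close>)
  show "f x (comb c) = (\<Sum>i<length bs. c i * f x (bs ! i))" if "x \<in> carrier V"
    by (rule linear_comb) (use f that in \<open>auto simp: bilinear_form_def\<close>)
qed

lemma gram_carrier [simp]: "gram f \<in> carrier_mat (length bs) (length bs)"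
  by (simp add: gram_def)

lemma gram_index: "i < length bs \<Longrightarrow> j < length bs \<Longrightarrow> gram f $$ (i, j) = f (bs ! i) (bs ! j)"
  by (simp add: gram_def)

lemma gram_isometry:
  assumes f: "bilinear_form V f" and \<phi>: "\<phi> \<in> linear_maps"
    and iso: "\<And>x y. x \<in> carrier V \<Longrightarrow> y \<in> carrier V \<Longrightarrow> f (\<phi> x) (\<phi> y) = f x y"
  shows "(matrix_of \<phi>)\<^sup>T * (gram f * matrix_of \<phi>) = gram f"
proof (rule eq_matI)
  let ?A = "matrix_of \<phi>" and ?n = "length bs"
  have c: "?A \<in> carrier_mat ?n ?n" "gram f \<in> carrier_mat ?n ?n" "?A\<^sup>T \<in> carrier_mat ?n ?n"
    by (auto simp: matrix_of_def gram_def)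
  fix i j assume "i < dim_row (gram f)" "j < dim_col (gram f)"
  then have ij: "i < ?n" "j < ?n" by (auto simp: gram_def)
  have \<phi>b: "\<phi> (bs ! k) = comb (\<lambda>i. ?A $$ (i, k))" if "k < ?n" for k
    using that linear_mapsD[OF \<phi>] by (intro comb_matrix_of_col) auto
  have "gram f $$ (i, j) = f (\<phi> (bs ! i)) (\<phi> (bs ! j))" using ij iso by (simp add: gram_def)
  also have "\<dots> = (\<Sum>k<?n. ?A $$ (k, i) * (\<Sum>l<?n. ?A $$ (l, j) * f (bs ! k) (bs ! l)))"
    unfolding \<phi>b[OF ij(1)] \<phi>b[OF ij(2)] bilinear_comb(1)[OF f comb_closed]
    by (intro sum.cong) (simp_all add: bilinear_comb(2)[OF f])
  also have "\<dots> = (\<Sum>k<?n. ?A\<^sup>T $$ (i, k) * (gram f * ?A) $$ (k, j))"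
    using c ij by (intro sum.cong)
      (simp_all add: mat_mult_entry[OF c(2,1)] carrier_matD[OF c(1)] gram_index mult.commute
        del: index_mult_mat)
  also have "\<dots> = (?A\<^sup>T * (gram f * ?A)) $$ (i, j)"
    by (rule mat_mult_entry[OF c(3) mult_carrier_mat[OF c(2,1)] ij, symmetric])
  finally show "(?A\<^sup>T * (gram f * ?A)) $$ (i, j) = gram f $$ (i, j)" ..
qed (auto simp: matrix_of_def gram_def)

text \<open>A kernel vector of the Gram matrix is the coordinate vector of an element orthogonal to
  the whole space.\<close>

lemma det_gram:
  assumes f: "bilinear_form V f" and nd: "nondegenerate V f"
  shows "det (gram f) \<noteq> 0"
proof
  let ?n = "length bs"
  have J: "gram f \<in> carrier_mat ?n ?n" by (simp add: gram_def)
  assume "det (gram f) = 0"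
  then obtain v where v: "v \<in> carrier_vec ?n" "v \<noteq> 0\<^sub>v ?n" "gram f *\<^sub>v v = 0\<^sub>v ?n"
    using det_0_iff_vec_prod_zero_field[OF J] by auto
  define x where "x = comb (\<lambda>i. v $ i)"
  have bx: "f (bs ! i) x = 0" if "i < ?n" for i
  proof -
    have "f (bs ! i) x = (gram f *\<^sub>v v) $ i"
      using that v(1)
      by (simp add: x_def bilinear_comb(2)[OF f] gram_def scalar_prod_def lessThan_atLeast0 mult.commute)
    then show ?thesis using v(3) that by simp
  qed
  have "f y x = 0" if "y \<in> carrier V" for y
    using bilinear_comb(1)[OF f comb_closed, of "\<lambda>i. coord i y"] comb_coord[OF that] bx
    by (simp add: x_def)
  then have "x = \<zero>\<^bsub>V\<^esub>" using nd comb_closed by (auto simp: nondegenerate_def x_def)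
  then have "v $ i = 0" if "i < ?n" for i using comb_eq_zero[OF _ that] by (simp add: x_def)
  then show False using v(1,2) by (auto intro: eq_vecI)
qed

end

section \<open>Forms and isometries of the standard space given by matrices\<close>

lemma bilinear_form_mult_mat_vec:
  assumes "F \<in> carrier_mat n n"
  shows "bilinear_form (module_vec TYPE('a::field) n) (\<lambda>x y. x \<bullet> (F *\<^sub>v y))"
  using assms
  by (auto simp: bilinear_form_def module_vec_simps add_scalar_prod_distrib[of _ n]
      mult_add_distrib_mat_vec[of _ n n] scalar_prod_add_distrib[of _ n] mult_mat_vec[of _ n n]
      intro!: add_scalar_prod_distrib[of _ n] scalar_prod_add_distrib[of _ n])

lemma mult_mat_vec_form_transpose:
  fixes F :: "'a::field mat"
  assumes "F \<in> carrier_mat n n" "F\<^sup>T = of_int s \<cdot>\<^sub>m F" "x \<in> carrier_vec n" "y \<in> carrier_vec n"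
  shows "x \<bullet> (F *\<^sub>v y) = of_int s * (y \<bullet> (F *\<^sub>v x))"
proof -
  have "x \<bullet> (F *\<^sub>v y) = (F\<^sup>T *\<^sub>v x) \<bullet> y"
    using transpose_vec_mult_scalar[OF assms(1,4,3)] by simp
  also have "F\<^sup>T *\<^sub>v x = of_int s \<cdot>\<^sub>v (F *\<^sub>v x)"
    unfolding assms(2) by (rule smult_mat_mult_vec[OF assms(1,3)])
  also have "(of_int s \<cdot>\<^sub>v (F *\<^sub>v x)) \<bullet> y = of_int s * (y \<bullet> (F *\<^sub>v x))"
    using assms by (simp add: comm_scalar_prod[of "F *\<^sub>v x" n y])
  finally show ?thesis .
qed

lemma nondegenerate_mult_mat_vec:
  fixes F :: "'a::field mat"
  assumes F: "F \<in> carrier_mat n n" "det F \<noteq> 0" and sym: "F\<^sup>T = of_int s \<cdot>\<^sub>m F"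
  shows "nondegenerate (module_vec TYPE('a) n) (\<lambda>x y. x \<bullet> (F *\<^sub>v y))"
proof -
  obtain H where H: "H \<in> carrier_mat n n" "F * H = 1\<^sub>m n"
    using mat_inverse_if_det_unit[OF F(1)] F(2) by (metis dvd_field_iff one_neq_zero)
  have left: "x = 0\<^sub>v n" if x: "x \<in> carrier_vec n" "\<And>y. y \<in> carrier_vec n \<Longrightarrow> x \<bullet> (F *\<^sub>v y) = 0" for x
  proof (rule eq_vecI)
    fix i assume "i < dim_vec (0\<^sub>v n :: 'a vec)"
    then have i: "i < n" by simp
    have "F *\<^sub>v (H *\<^sub>v unit_vec n i) = unit_vec n i"
      using assoc_mult_mat_vec[OF F(1) H(1), of "unit_vec n i"] H(2) by simp
    then have "x \<bullet> unit_vec n i = 0" using x(2)[of "H *\<^sub>v unit_vec n i"] H(1) by simp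
    then show "x $ i = 0\<^sub>v n $ i" using x(1) i by (simp add: scalar_prod_right_unit)
  qed (use x in auto)
  have right: "y = 0\<^sub>v n" if y: "y \<in> carrier_vec n" "\<And>x. x \<in> carrier_vec n \<Longrightarrow> x \<bullet> (F *\<^sub>v y) = 0" for y
    using left[OF y(1)] y mult_mat_vec_form_transpose[OF F(1) sym y(1)] by simp
  show ?thesis using left right by (auto simp: nondegenerate_def module_vec_simps)
qed

text \<open>The inverse \<open>B\<close> provides bijectivity; restriction to
  \<open>carrier_vec n\<close> makes the map extensional, as \<open>Bij\<close> demands.\<close>

lemma mult_mat_vec_in_isometry_group:
  fixes A B F :: "'a::field mat"
  assumes A: "A \<in> carrier_mat n n" "A\<^sup>T * (F * A) = F" and F: "F \<in> carrier_mat n n"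
    and B: "B \<in> carrier_mat n n" "A * B = 1\<^sub>m n" "B * A = 1\<^sub>m n"
  shows "(\<lambda>v\<in>carrier_vec n. A *\<^sub>v v) \<in>
    carrier (isometry_group (module_vec TYPE('a) n) (\<lambda>x y. x \<bullet> (F *\<^sub>v y)))"
proof -
  let ?\<phi> = "\<lambda>v\<in>carrier_vec n. A *\<^sub>v v"
  have "bij_betw ?\<phi> (carrier_vec n) (carrier_vec n)"
    by (rule bij_betw_byWitness[where f' = "\<lambda>v. B *\<^sub>v v"])
      (use A B in \<open>auto simp: assoc_mult_mat_vec[symmetric, of _ n n _ n] simp del: assoc_mult_mat_vec\<close>)
  moreover have "?\<phi> \<in> LinearCombinations.module_hom class_ring (module_vec TYPE('a) n) (module_vec TYPE('a) n)"
    using A by (auto simp: LinearCombinations.module_hom_def module_vec_simps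
        mult_add_distrib_mat_vec mult_mat_vec)
  moreover have "?\<phi> x \<bullet> (F *\<^sub>v ?\<phi> y) = x \<bullet> (F *\<^sub>v y)" if x: "x \<in> carrier_vec n" "y \<in> carrier_vec n" for x y
  proof -
    have AT: "A\<^sup>T \<in> carrier_mat n n" "F * A \<in> carrier_mat n n" using A(1) F by auto
    have FAy: "F *\<^sub>v (A *\<^sub>v y) \<in> carrier_vec n"
      using A(1) F x(2) by (intro mult_mat_vec_carrier[of _ n n]) auto
    have "(A *\<^sub>v x) \<bullet> (F *\<^sub>v (A *\<^sub>v y)) = x \<bullet> (A\<^sup>T *\<^sub>v (F *\<^sub>v (A *\<^sub>v y)))"
      using transpose_vec_mult_scalar[OF AT(1) FAy x(1)] by simp
    also have "A\<^sup>T *\<^sub>v (F *\<^sub>v (A *\<^sub>v y)) = (A\<^sup>T * (F * A)) *\<^sub>v y"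
      unfolding assoc_mult_mat_vec[OF AT x(2)] assoc_mult_mat_vec[OF F A(1) x(2)] ..
    finally show ?thesis using x A(2) by simp
  qed
  ultimately show ?thesis
    by (simp add: isometry_group_def Bij_def module_vec_simps)
qed

text \<open>Choosing a basis of \<open>V\<close> carries the matrix result over to abstract spaces.
  The sign \<open>s\<close> keeps the alternating and the symmetric case together.\<close>

lemma isometric_rep_reduction:
  fixes l n :: nat
    and V :: "('a::{discrete_valuation_field, field_char_0}, 'v) module"
    and G (structure)
  assumes l: "prime l" "CHAR('a residue_field) = l" "2 * ramification_index TYPE('a) < int l - 1"
    and V: "vectorspace class_ring V" "vectorspace.fin_dim class_ring V" "vectorspace.dim class_ring V = n"
    and f: "bilinear_form V f" "nondegenerate V f"
    and s: "s * s = 1" "\<forall>x\<in>carrier V. \<forall>y\<in>carrier V. f x y = of_int s * f y x"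
    and G: "group G" "finite (carrier G)"
    and \<rho>: "\<rho> \<in> hom G (isometry_group V f)" "inj_on \<rho> (carrier G)"
  shows "\<exists>f0 \<rho>0. bilinear_form (module_vec TYPE('a residue_field) n) f0 \<and>
    nondegenerate (module_vec TYPE('a residue_field) n) f0 \<and>
    (\<forall>x\<in>carrier_vec n. \<forall>y\<in>carrier_vec n. f0 x y = of_int s * f0 y x) \<and>
    \<rho>0 \<in> hom G (isometry_group (module_vec TYPE('a residue_field) n) f0) \<and>
    inj_on \<rho>0 (carrier G) \<and>
    (\<forall>g\<in>carrier G.
      (\<forall>i. coeff (endo_char_poly V (\<rho> g)) i \<in> valuation_ring) \<and>
      endo_char_poly (module_vec TYPE('a residue_field) n) (\<rho>0 g) =
        map_poly reduction (endo_char_poly V (\<rho> g)))"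
proof -
  interpret G: group G by (rule G)
  interpret V: vectorspace class_ring V by (rule V)
  obtain B where B: "finite B" "V.basis B" using V.finite_basis_exists[OF V(2)] by blast
  obtain bs where bs: "set bs = B" "distinct bs" using finite_distinct_list[OF B(1)] by blast
  have n: "length bs = n" using V.dim_basis[OF B] V(3) bs distinct_card[OF bs(2)] by simp
  interpret ordered_basis V bs by unfold_locales (use bs B in auto)
  have \<rho>g: "\<rho> g \<in> Bij (carrier V)" "\<rho> g \<in> linear_maps"
    "\<And>x y. x \<in> carrier V \<Longrightarrow> y \<in> carrier V \<Longrightarrow> f (\<rho> g x) (\<rho> g y) = f x y" if "g \<in> carrier G" for g
    using hom_in_carrier[OF \<rho>(1) that] by (auto simp: isometry_group_def)
  have \<rho>_mult: "\<rho> (g \<otimes> h) x = \<rho> g (\<rho> h x)" if "g \<in> carrier G" "h \<in> carrier G" "x \<in> carrier V" for g h x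
    using hom_mult[OF \<rho>(1) that(1,2)] \<rho>g(1)[OF that(1)] \<rho>g(1)[OF that(2)] that(3)
    by (simp add: isometry_group_def BijGroup_def compose_def)
  \<comment> \<open>Being idempotent and injective on the carrier, \<open>\<rho> \<one>\<close> is
    the identity there.\<close>
  have \<rho>_one: "\<rho> \<one> x = x" if x: "x \<in> carrier V" for x
  proof -
    have "\<rho> \<one> (\<rho> \<one> x) = \<rho> \<one> x" using \<rho>_mult[OF G.one_closed G.one_closed x] by simp
    then show ?thesis
      using \<rho>g(1)[OF G.one_closed] linear_mapsD(2)[OF \<rho>g(2)[OF G.one_closed] x] x
      by (auto simp: Bij_def bij_betw_def dest: inj_onD)
  qed
  define R where "R g = matrix_of (\<rho> g)" for g
  have "isometric_matrix_rep G n R (gram f) s"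
  proof
    show "finite (carrier G)" by (rule G)
    show "R g \<in> carrier_mat n n" for g using n by (auto simp: R_def)
    show "R \<one> = 1\<^sub>m n" using matrix_of_id[of "\<rho> \<one>"] \<rho>_one n by (simp add: R_def)
    show "R (g \<otimes> h) = R g * R h" if "g \<in> carrier G" "h \<in> carrier G" for g h
      unfolding R_def by (rule matrix_of_comp) (use that \<rho>g(2) \<rho>_mult in auto)
    show "gram f \<in> carrier_mat n n" using n by auto
    show "det (gram f) \<noteq> 0" by (rule det_gram[OF f])
    show "s * s = 1" by (rule s)
    show "(gram f)\<^sup>T = of_int s \<cdot>\<^sub>m gram f"
    proof (rule eq_matI)
      fix i j assume "i < dim_row (of_int s \<cdot>\<^sub>m gram f)" "j < dim_col (of_int s \<cdot>\<^sub>m gram f)"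
      then show "(gram f)\<^sup>T $$ (i, j) = (of_int s \<cdot>\<^sub>m gram f) $$ (i, j)"
        using bspec[OF bspec[OF s(2)], of "bs ! j" "bs ! i"] by (simp add: gram_def)
    qed (auto simp: gram_def)
    show "(R g)\<^sup>T * (gram f * R g) = gram f" if "g \<in> carrier G" for g
      unfolding R_def by (rule gram_isometry[OF f(1)]) (use \<rho>g[OF that] in auto)
  qed
  moreover have "inj_on R (carrier G)"
  proof (rule inj_onI)
    fix g h assume gh: "g \<in> carrier G" "h \<in> carrier G" "R g = R h"
    \<comment> \<open>Equal matrices only give agreement on the carrier; extensionality of the
      elements of \<open>Bij\<close> upgrades it to equality of functions.\<close>
    have "\<rho> g = \<rho> h"
    proof (rule extensionalityI)
      show "\<rho> g \<in> extensional (carrier V)" "\<rho> h \<in> extensional (carrier V)"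
        using \<rho>g(1)[OF gh(1)] \<rho>g(1)[OF gh(2)] by (auto simp: Bij_def)
      show "\<rho> g x = \<rho> h x" if "x \<in> carrier V" for x
        using matrix_of_inject[OF \<rho>g(2)[OF gh(1)] \<rho>g(2)[OF gh(2)] _ that] gh(3) by (simp add: R_def)
    qed
    then show "g = h" using \<rho>(2) gh by (auto dest: inj_onD)
  qed
  ultimately obtain r F where F: "F \<in> carrier_mat n n" "det F \<noteq> 0" "F\<^sup>T = of_int s \<cdot>\<^sub>m F"
    and r: "\<And>g. g \<in> carrier G \<Longrightarrow> r g \<in> carrier_mat n n \<and> (r g)\<^sup>T * (F * r g) = F"
    and r1: "r \<one> = 1\<^sub>m n"
    and rmult: "\<And>g h. g \<in> carrier G \<Longrightarrow> h \<in> carrier G \<Longrightarrow> r (g \<otimes> h) = r g * r h"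
    and rinj: "inj_on r (carrier G)"
    and int: "\<And>g i. g \<in> carrier G \<Longrightarrow> coeff (char_poly (R g)) i \<in> valuation_ring"
    and cp: "\<And>g. g \<in> carrier G \<Longrightarrow> char_poly (r g) = map_poly reduction (char_poly (R g))"
    by (rule isometric_matrix_rep_reduction[OF _ _ l]) blast
  define f0 where "f0 x y = x \<bullet> (F *\<^sub>v y)" for x y
  define \<rho>0 where "\<rho>0 g = (\<lambda>v\<in>carrier_vec n. r g *\<^sub>v v)" for g
  have f0: "f0 = (\<lambda>x y. x \<bullet> (F *\<^sub>v y))" by (simp add: f0_def fun_eq_iff)
  have \<rho>0: "\<rho>0 g \<in> carrier (isometry_group (module_vec TYPE('a residue_field) n) f0)"
    if g: "g \<in> carrier G" for g
    unfolding \<rho>0_def f0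
    by (rule mult_mat_vec_in_isometry_group[where B = "r (inv g)"])
      (use r g F rmult[of g "inv g"] rmult[of "inv g" g] r1 in auto)
  have cpV: "endo_char_poly V (\<rho> g) = char_poly (R g)" if g: "g \<in> carrier G" for g
    unfolding R_def
    by (rule endo_char_poly_eq[OF V(1) \<rho>g(2)[OF g]])
      (rule represents_matrix_of, rule linear_mapsD(1)[OF \<rho>g(2)[OF g]])
  show ?thesis
  proof (intro exI[of _ f0] exI[of _ \<rho>0] conjI ballI allI)
    show "bilinear_form (module_vec TYPE('a residue_field) n) f0"
      unfolding f0 by (rule bilinear_form_mult_mat_vec[OF F(1)])
    show "nondegenerate (module_vec TYPE('a residue_field) n) f0"
      unfolding f0 by (rule nondegenerate_mult_mat_vec[OF F])
    show "f0 x y = of_int s * f0 y x" if "x \<in> carrier_vec n" "y \<in> carrier_vec n" for x y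
      unfolding f0 by (rule mult_mat_vec_form_transpose[OF F(1,3) that])
    show "\<rho>0 \<in> hom G (isometry_group (module_vec TYPE('a residue_field) n) f0)"
    proof (rule homI)
      fix g h assume gh: "g \<in> carrier G" "h \<in> carrier G"
      have "\<rho>0 (g \<otimes> h) = compose (carrier_vec n) (\<rho>0 g) (\<rho>0 h)"
        using r[OF gh(1)] r[OF gh(2)] by (auto simp: \<rho>0_def compose_def rmult[OF gh] fun_eq_iff)
      then show "\<rho>0 (g \<otimes> h) = \<rho>0 g \<otimes>\<^bsub>isometry_group (module_vec TYPE('a residue_field) n) f0\<^esub> \<rho>0 h"
        using \<rho>0[OF gh(1)] \<rho>0[OF gh(2)] by (simp add: isometry_group_def BijGroup_def module_vec_simps)
    qed (rule \<rho>0)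
    show "inj_on \<rho>0 (carrier G)"
    proof (rule inj_onI)
      fix g h assume gh: "g \<in> carrier G" "h \<in> carrier G" "\<rho>0 g = \<rho>0 h"
      have "r g = r h"
      proof (rule mat_col_eqI)
        fix j assume "j < dim_col (r h)"
        then have j: "j < n" using r[OF gh(2)] by auto
        have "r g *\<^sub>v unit_vec n j = r h *\<^sub>v unit_vec n j"
          using fun_cong[OF gh(3), of "unit_vec n j"] by (simp add: \<rho>0_def)
        then show "col (r g) j = col (r h) j"
          using r[OF gh(1)] r[OF gh(2)] j by (simp add: col_eq_mult_unit_vec[of _ n n])
      qed (use r gh in auto)
      then show "g = h" using rinj gh by (auto dest: inj_onD)
    qed
    show "coeff (endo_char_poly V (\<rho> g)) i \<in> valuation_ring" if "g \<in> carrier G" for g i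
      unfolding cpV[OF that] by (rule int[OF that])
    show "endo_char_poly (module_vec TYPE('a residue_field) n) (\<rho>0 g) =
        map_poly reduction (endo_char_poly V (\<rho> g))" if "g \<in> carrier G" for g
      unfolding cpV[OF that] \<rho>0_def cp[OF that, symmetric]
      using r[OF that] by (intro endo_char_poly_mult_mat_vec) simp
  qed
qed

text \<open>For l = 2 the bound 2 c + 1 < 2 would make 2 a unit of the valuation ring, although it
  vanishes in k.\<close>

lemma two_neq_zero_residue_field:
  assumes "prime l" "CHAR('a::{discrete_valuation_field, field_char_0} residue_field) = l"
    "2 * ramification_index TYPE('a) < int l - 1"
  shows "(2 :: 'a residue_field) \<noteq> 0"
proof
  assume "(2 :: 'a residue_field) = 0"
  then have "(of_nat 2 :: 'a residue_field) = 0" by simp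
  then have "l dvd 2" using assms(2) by (simp only: of_nat_eq_0_iff_char_dvd)
  then have "l = 2" using primes_dvd_imp_eq[OF assms(1) two_is_prime_nat] by blast
  then obtain u :: "'a valuation_subring" and c where
    u: "of_nat 2 = u * uniformizer ^ c" "u dvd 1" "2 * c + 1 < (2::nat)"
    using prime_as_unit_times_uniformizer_power[OF assms two_is_prime_nat] by metis
  then have "(of_nat 2 :: 'a valuation_subring) dvd 1" by simp
  then show False
    using \<open>(of_nat 2 :: 'a residue_field) = 0\<close> by (simp only: subring_unit_iff residue.hom_of_nat simp_thms)
qed

theorem theorem5p1:
  fixes l n :: nat
    and V :: "('a::{discrete_valuation_field, field_char_0}, 'v) module"
    and f :: "'v \<Rightarrow> 'v \<Rightarrow> 'a"
    and G :: "'g monoid"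
    and \<rho> :: "'g \<Rightarrow> 'v \<Rightarrow> 'v"
  assumes "prime l"
    and "CHAR('a residue_field) = l"
    and "2 * ramification_index TYPE('a) < int l - 1"
    and "vectorspace class_ring V"
    and "vectorspace.fin_dim class_ring V"
    and "vectorspace.dim class_ring V = n"
    and "bilinear_form V f"
    and "nondegenerate V f"
    and "group G"
    and "finite (carrier G)"
    and "\<rho> \<in> hom G (isometry_group V f)"
    and "inj_on \<rho> (carrier G)"
  shows
    "(alternating V f \<longrightarrow>
       (\<exists>f0 \<rho>0. bilinear_form (module_vec TYPE('a residue_field) n) f0 \<and>
          nondegenerate (module_vec TYPE('a residue_field) n) f0 \<and>
          alternating (module_vec TYPE('a residue_field) n) f0 \<and>
          \<rho>0 \<in> hom G (isometry_group (module_vec TYPE('a residue_field) n) f0) \<and>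
          inj_on \<rho>0 (carrier G) \<and>
          (\<forall>g\<in>carrier G.
             (\<forall>i. coeff (endo_char_poly V (\<rho> g)) i \<in> valuation_ring) \<and>
             endo_char_poly (module_vec TYPE('a residue_field) n) (\<rho>0 g) =
               map_poly reduction (endo_char_poly V (\<rho> g))))) \<and>
     (symmetric V f \<longrightarrow>
       (\<exists>f0 \<rho>0. bilinear_form (module_vec TYPE('a residue_field) n) f0 \<and>
          nondegenerate (module_vec TYPE('a residue_field) n) f0 \<and>
          symmetric (module_vec TYPE('a residue_field) n) f0 \<and>
          \<rho>0 \<in> hom G (isometry_group (module_vec TYPE('a residue_field) n) f0) \<and>
          inj_on \<rho>0 (carrier G) \<and>
          (\<forall>g\<in>carrier G.
             (\<forall>i. coeff (endo_char_poly V (\<rho> g)) i \<in> valuation_ring) \<and>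
             endo_char_poly (module_vec TYPE('a residue_field) n) (\<rho>0 g) =
               map_poly reduction (endo_char_poly V (\<rho> g)))))"
proof (intro conjI impI, goal_cases)
  case 1
  interpret V: vectorspace class_ring V by (rule assms(4))
  \<comment> \<open>Expanding f(x + y, x + y) = 0 shows that alternating forms have the sign s =
    -1.\<close>
  have skew: "\<forall>x\<in>carrier V. \<forall>y\<in>carrier V. f x y = of_int (- 1) * f y x"
  proof (intro ballI)
    fix x y assume that: "x \<in> carrier V" "y \<in> carrier V"
    have "f (x \<oplus>\<^bsub>V\<^esub> y) (x \<oplus>\<^bsub>V\<^esub> y) = f x x + f x y + (f y x + f y y)"
      using assms(7) that by (simp add: bilinear_form_def)
    then show "f x y = of_int (- 1) * f y x"
      using 1 that by (simp add: alternating_def eq_neg_iff_add_eq_0)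
  qed
  \<comment> \<open>The sign s = -1 yields only 2 f0(x, x) = 0, so here residue characteristic 2
    must be excluded.\<close>
  have alternating_f0: "alternating (module_vec TYPE('a residue_field) n) f0"
    if "\<forall>x\<in>carrier_vec n. \<forall>y\<in>carrier_vec n. f0 x y = of_int (- 1) * f0 y x" for f0
    unfolding alternating_def
  proof
    fix x assume "x \<in> carrier (module_vec TYPE('a residue_field) n)"
    then have "f0 x x = - f0 x x" using bspec[OF bspec[OF that], of x x] by (simp add: module_vec_simps)
    then have "2 * f0 x x = 0" by (simp only: eq_neg_iff_add_eq_0 mult_2)
    then show "f0 x x = 0" using two_neq_zero_residue_field[OF assms(1-3)] by simp
  qed
  have "- 1 * - 1 = (1 :: int)" by simp
  note isometric_rep_reduction[OF assms(1-8) this skew assms(9-12)]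
  then show ?case by (elim exE conjE) (intro exI conjI; (assumption | rule alternating_f0; assumption))
next
  case 2
  then have sym: "\<forall>x\<in>carrier V. \<forall>y\<in>carrier V. f x y = of_int 1 * f y x"
    by (simp add: symmetric_def)
  have symmetric_f0: "symmetric (module_vec TYPE('a residue_field) n) f0"
    if "\<forall>x\<in>carrier_vec n. \<forall>y\<in>carrier_vec n. f0 x y = of_int 1 * f0 y x" for f0
    using that by (simp add: symmetric_def module_vec_simps)
  have "1 * 1 = (1 :: int)" by simp
  note isometric_rep_reduction[OF assms(1-8) this sym assms(9-12)]
  then show ?case by (elim exE conjE) (intro exI conjI; (assumption | rule symmetric_f0; assumption))
qed

end
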